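(* For any non-degenerate hypersurface $Z_0\subseteq\mathbb{P}^{k-1}$, there exist an integer $n$ and a non-degenerate hypersurface $X\subseteq\mathbb{P}^n$ with an induced additive action such that the boundary $X_0$ of $X$ (the complement in $X$ to the open $\mathbb{G}_a^{n-1}$-orbit) is a projective cone over $Z_0$ in $\mathbb{P}^{n-1}$, where $\mathbb{P}^{n-1}=\{z_0=0\}\subseteq\mathbb{P}^n$ is the hyperplane containing $X_0$.
   Context: The base field $\mathbb{K}$ is algebraically closed of characteristic zero; all varieties are over $\mathbb{K}$ and $\mathbb{G}_a^m=(\mathbb{K}^m,+)$. A hypersurface in $\mathbb{P}^N$ is the zero locus of a non-zero homogeneous polynomial of positive degree (it may be reducible). An additive action on an (irreducible) variety $X$ is an effective regular action of $\mathbb{G}_a^m$ on $X$ with an open orbit. An additive action $\mathbb{G}_a^{n-1}\times X\to X$ on a projective hypersurface $X\subseteq\mathbb{P}^n$ is called induced if it extends to a regular action of $\mathbb{G}_a^{n-1}$ on $\mathbb{P}^n$. A hypersurface in $\mathbb{P}^N$ given by a homogeneous equation $g(z_0,\ldots,z_N)=0$ is called non-degenerate if there is no linear change of variables after which $g$ depends on fewer than $N+1$ variables (equivalently, it is not a projective cone over a hypersurface in a projective subspace $\mathbb{P}^k\subseteq\mathbb{P}^N$ with $k<N$). A hypersurface $Y\subseteq\mathbb{P}^N$ is a projective cone over a hypersurface $Z\subseteq\mathbb{P}^k$, $k\le N$, if for some choice of homogeneous coordinates in $\mathbb{P}^N$ and $\mathbb{P}^k$ the equations of $Y$ and $Z$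 are the same. Known facts fixing the hyperplane: all algebras being commutative, associative and unital, an $H$-pair is a pair $(A,U)$, where $A$ is a local finite-dimensional $\mathbb{K}$-algebra with maximal ideal $\mathfrak{m}$ (so $A=\mathbb{K}\oplus\mathfrak{m}$) and $U\subseteq\mathfrak{m}$ is a hyperplane generating $A$ as a unital algebra. Induced additive actions on hypersurfaces in $\mathbb{P}^n$ other than hyperplanes correspond, up to equivalence, bijectively to $H$-pairs with $\dim A=n+1$: with $\mathbb{P}^n$ identified with $\mathbb{P}(A)$ and $p\colon A\setminus\{0\}\to\mathbb{P}(A)$ the canonical projection, $X=p(\overline{\mathbb{K}^\times\exp U})$ with $\mathbb{G}_a^{n-1}\cong\exp U$ acting by multiplication. Writing elements of $A$ as $z_0+z$ with $z_0\in\mathbb{K}$, $z\in\mathfrak{m}$, the open orbit is $X\cap\{z_0\neq0\}$, and the boundary $X_0=X\cap\{z_0=0\}$ is a hypersurface in $\{z_0=0\}=\mathbb{P}(\mathfrak{m})\cong\mathbb{P}^{n-1}$. *)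

theory Defs
  imports
    "Jordan_Normal_Form.Matrix"
    "HOL-Library.Poly_Mapping"
    "HOL-Computational_Algebra.Polynomial"
    "HOL-Algebra.Group_Action"
begin

section \<open>Polynomials in several variables\<close>

text \<open>A polynomial in variables indexed by natural numbers is a finitely supported map from
  exponent vectors to coefficients; multiplication is the convolution product of
  \<^theory>\<open>HOL-Library.Poly_Mapping\<close>.\<close>

type_synonym 'a mpoly = "(nat \<Rightarrow>\<^sub>0 nat) \<Rightarrow>\<^sub>0 'a"

definition vars :: "'a::zero mpoly \<Rightarrow> nat set" where
  "vars f = (\<Union>\<mu>\<in>Poly_Mapping.keys f. Poly_Mapping.keys \<mu>)"

text \<open>Only meaningful if every variable index of \<open>f\<close> is below the dimension of \<open>v\<close>.\<close>

definition peval :: "'a::comm_ring_1 mpoly \<Rightarrow> 'a vec \<Rightarrow> 'a" where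
  "peval f v = (\<Sum>\<mu>\<in>Poly_Mapping.keys f. Poly_Mapping.lookup f \<mu> *
     (\<Prod>i\<in>Poly_Mapping.keys \<mu>. (v $ i) ^ Poly_Mapping.lookup \<mu> i))"

text \<open>Polynomials in the variables \<open>0, \<dots>, m + r - 1\<close> that are homogeneous of degree \<open>d\<close> in the
  last \<open>r\<close> variables; \<open>forms r d\<close> are the homogeneous polynomials of degree \<open>d\<close> in \<open>r\<close> variables
  (including \<open>0\<close>).\<close>

definition part_forms :: "nat \<Rightarrow> nat \<Rightarrow> nat \<Rightarrow> 'a::zero mpoly set" where
  "part_forms m r d =
     {f. vars f \<subseteq> {..<m + r} \<and>
        (\<forall>\<mu>\<in>Poly_Mapping.keys f. (\<Sum>i\<in>{m..<m + r}. Poly_Mapping.lookup \<mu> i) = d)}"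

abbreviation forms :: "nat \<Rightarrow> nat \<Rightarrow> 'a::zero mpoly set" where
  "forms r d \<equiv> part_forms 0 r d"

text \<open>The linear substitution \<open>z\<^sub>i \<mapsto> \<Sum>\<^sub>j A\<^sub>i\<^sub>j z\<^sub>j\<close>.\<close>

definition lin_subst :: "'a::comm_ring_1 mat \<Rightarrow> 'a mpoly \<Rightarrow> 'a mpoly" where
  "lin_subst A f =
     (\<Sum>\<mu>\<in>Poly_Mapping.keys f. Poly_Mapping.single 0 (Poly_Mapping.lookup f \<mu>) *
        (\<Prod>i\<in>Poly_Mapping.keys \<mu>.
           (\<Sum>j<dim_col A. Poly_Mapping.single (Poly_Mapping.single j 1) (A $$ (i, j)))
           ^ Poly_Mapping.lookup \<mu> i))"

definition GL :: "nat \<Rightarrow> 'a::comm_ring_1 mat set" where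
  "GL r = {A \<in> carrier_mat r r. invertible_mat A}"


section \<open>Projective space and hypersurfaces\<close>

definition proj_rel :: "nat \<Rightarrow> ('a::field vec \<times> 'a vec) set" where
  "proj_rel N = {(x, y). x \<in> carrier_vec (Suc N) - {0\<^sub>v (Suc N)} \<and>
                         y \<in> carrier_vec (Suc N) - {0\<^sub>v (Suc N)} \<and> (\<exists>c. c \<noteq> 0 \<and> y = c \<cdot>\<^sub>v x)}"

definition proj_space :: "nat \<Rightarrow> 'a::field vec set set" where
  "proj_space N = (carrier_vec (Suc N) - {0\<^sub>v (Suc N)}) // proj_rel N"

definition zero_locus :: "nat \<Rightarrow> 'a::field mpoly \<Rightarrow> 'a vec set set" where
  "zero_locus N f = {p \<in> proj_space N. \<forall>x\<in>p. peval f x = 0}"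

definition zariski_closed :: "nat \<Rightarrow> 'a::field vec set set \<Rightarrow> bool" where
  "zariski_closed N C \<longleftrightarrow>
     (\<exists>T. T \<subseteq> (\<Union>d. forms (Suc N) d) \<and> C = {p \<in> proj_space N. \<forall>f\<in>T. p \<in> zero_locus N f})"

definition zariski_open_in :: "nat \<Rightarrow> 'a::field vec set set \<Rightarrow> 'a vec set set \<Rightarrow> bool" where
  "zariski_open_in N X U \<longleftrightarrow> (\<exists>C. zariski_closed N C \<and> U = X - C)"

definition irreducible_variety :: "nat \<Rightarrow> 'a::field vec set set \<Rightarrow> bool" where
  "irreducible_variety N X \<longleftrightarrow> zariski_closed N X \<and> X \<noteq> {} \<and>
     (\<forall>C D. zariski_closed N C \<and> zariski_closed N D \<and> X \<subseteq> C \<union> D \<longrightarrow> X \<subseteq> C \<or> X \<subseteq> D)"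

definition hypersurface_eq :: "nat \<Rightarrow> 'a::field mpoly \<Rightarrow> 'a vec set set \<Rightarrow> bool" where
  "hypersurface_eq N g X \<longleftrightarrow>
     (\<exists>d>0. g \<in> forms (Suc N) d) \<and> g \<noteq> 0 \<and> X = zero_locus N g"

definition hypersurface :: "nat \<Rightarrow> 'a::field vec set set \<Rightarrow> bool" where
  "hypersurface N X \<longleftrightarrow> (\<exists>g. hypersurface_eq N g X)"

text \<open>Whether a form is non-degenerate depends only on its zero locus (over an algebraically closed
  field of characteristic zero), so it does not matter which equation is used.\<close>

definition nondegenerate_hypersurface :: "nat \<Rightarrow> 'a::field vec set set \<Rightarrow> bool" where
  "nondegenerate_hypersurface N X \<longleftrightarrow>
     (\<exists>g. hypersurface_eq N g X \<and> \<not> (\<exists>A\<in>GL (Suc N). card (vars (lin_subst A g)) < Suc N))"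

text \<open>\<open>Y \<subseteq> \<P>\<^sup>N\<close> and \<open>Z \<subseteq> \<P>\<^sup>k\<close> have the same equation \<open>h\<close>, in the homogeneous
  coordinates \<open>A z\<close> on \<open>\<P>\<^sup>N\<close> and \<open>B z\<close> on \<open>\<P>\<^sup>k\<close>.\<close>

definition projective_cone ::
    "nat \<Rightarrow> 'a::field vec set set \<Rightarrow> nat \<Rightarrow> 'a vec set set \<Rightarrow> bool" where
  "projective_cone N Y k Z \<longleftrightarrow> k \<le> N \<and>
     (\<exists>h. \<exists>d>0. h \<in> forms (Suc k) d \<and> h \<noteq> 0 \<and>
        (\<exists>A\<in>GL (Suc N). \<exists>B\<in>GL (Suc k).
           Y = zero_locus N (lin_subst A h) \<and> Z = zero_locus k (lin_subst B h)))"

text \<open>The hyperplane \<open>z\<^sub>0 = 0\<close> in \<open>\<P>\<^sup>n\<close>, and the embedding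
  \<open>[z\<^sub>1 : \<dots> : z\<^sub>n] \<mapsto> [0 : z\<^sub>1 : \<dots> : z\<^sub>n]\<close> of \<open>\<P>\<^sup>n\<^sup>-\<^sup>1\<close> onto it.\<close>

definition hyperplane0 :: "nat \<Rightarrow> 'a::field vec set set" where
  "hyperplane0 n = {p \<in> proj_space n. \<forall>x\<in>p. x $ 0 = 0}"

definition hyperplane0_emb :: "'a::field vec set \<Rightarrow> 'a vec set" where
  "hyperplane0_emb p = vCons 0 ` p"


section \<open>Additive actions\<close>

text \<open>Morphisms from a subset \<open>W\<close> of \<open>\<bbbK>\<^sup>m \<times> \<P>\<^sup>N\<close> to \<open>\<P>\<^sup>M\<close>: every point of \<open>W\<close> has a basic
  Zariski open neighbourhood \<open>h \<noteq> 0\<close> in \<open>W\<close> on which the map is given by \<open>M + 1\<close> polynomials without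
  common zeros, all homogeneous of the same degree in the coordinates of \<open>\<P>\<^sup>N\<close>. That there are no
  common zeros is implied by the tuple of values being an element of a point of \<open>\<P>\<^sup>M\<close>.\<close>

definition regular_map ::
    "nat \<Rightarrow> nat \<Rightarrow> ('a::field vec \<times> 'a vec set) set \<Rightarrow> nat \<Rightarrow> ('a vec \<times> 'a vec set \<Rightarrow> 'a vec set) \<Rightarrow> bool"
  where
  "regular_map m N W M f \<longleftrightarrow> f ` W \<subseteq> proj_space M \<and>
     (\<forall>(t0, p0)\<in>W. \<exists>e d h F.
        h \<in> part_forms m (Suc N) e \<and> (\<forall>i\<le>M. F i \<in> part_forms m (Suc N) d) \<and>
        (\<forall>x\<in>p0. peval h (t0 @\<^sub>v x) \<noteq> 0) \<and>
        (\<forall>(t, p)\<in>W. \<forall>x\<in>p. peval h (t @\<^sub>v x) \<noteq> 0 \<longrightarrow>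
           vec (Suc M) (\<lambda>i. peval (F i) (t @\<^sub>v x)) \<in> f (t, p)))"

definition regular_action ::
    "nat \<Rightarrow> nat \<Rightarrow> 'a::field vec set set \<Rightarrow> ('a vec \<Rightarrow> 'a vec set \<Rightarrow> 'a vec set) \<Rightarrow> bool" where
  "regular_action m N X \<phi> \<longleftrightarrow>
     group_action (monoid_vec TYPE('a) m) X \<phi> \<and>
     regular_map m N (carrier_vec m \<times> X) N (\<lambda>(t, p). \<phi> t p)"

definition open_orbit ::
    "nat \<Rightarrow> nat \<Rightarrow> 'a::field vec set set \<Rightarrow> ('a vec \<Rightarrow> 'a vec set \<Rightarrow> 'a vec set) \<Rightarrow> 'a vec set set \<Rightarrow> bool"
  where
  "open_orbit m N X \<phi> U \<longleftrightarrow>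
     U \<in> orbits (monoid_vec TYPE('a) m) X \<phi> \<and> zariski_open_in N X U"

definition additive_action ::
    "nat \<Rightarrow> nat \<Rightarrow> 'a::field vec set set \<Rightarrow> ('a vec \<Rightarrow> 'a vec set \<Rightarrow> 'a vec set) \<Rightarrow> bool" where
  "additive_action m N X \<phi> \<longleftrightarrow>
     irreducible_variety N X \<and> regular_action m N X \<phi> \<and>
     faithful_action (monoid_vec TYPE('a) m) X \<phi> \<and> (\<exists>U. open_orbit m N X \<phi> U)"

definition induced_additive_action ::
    "nat \<Rightarrow> 'a::field vec set set \<Rightarrow> ('a vec \<Rightarrow> 'a vec set \<Rightarrow> 'a vec set) \<Rightarrow> bool" where
  "induced_additive_action n X \<phi> \<longleftrightarrow>
     hypersurface n X \<and> additive_action (n - 1) n X \<phi> \<and>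
     (\<exists>\<psi>. regular_action (n - 1) n (proj_space n) \<psi> \<and>
          (\<forall>t\<in>carrier_vec (n - 1). \<forall>p\<in>X. \<psi> t p = \<phi> t p))"

end

theory Submission
  imports Defs "Jordan_Normal_Form.Determinant"
begin

text \<open>Let \<open>f\<close> be a non-degenerate equation of \<open>Z\<^sub>0\<close>, of degree \<open>d \<ge> 2\<close> (otherwise square it), and let \<open>A\<close> be
  the quotient of the ring of differential operators with constant coefficients by the annihilator
  of \<open>f\<close>. It is a graded local Gorenstein algebra with socle functional \<open>\<pi> a = (a f)(0)\<close>, and
  \<open>U = ker \<pi> \<inter> \<mm>\<close> is a hyperplane in its maximal ideal complementary to the socle. The closure of the
  orbit of \<open>1\<close> under \<open>exp U\<close> is the hypersurface \<open>z\<^sub>0\<^sup>d \<pi> (ln (1 + z/z\<^sub>0)) = 0\<close>, which is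
  non-degenerate because the form \<open>\<pi> (a b)\<close> is. For \<open>z\<^sub>0 = 0\<close> this equation becomes \<open>\<pi> (z\<^sup>d) = 0\<close>, and
  \<open>\<pi> (z\<^sup>d) = d! f(a)\<close> where \<open>a\<close> is the linear part of \<open>z\<close>: the boundary is a cone over \<open>Z\<^sub>0\<close>.\<close>

section \<open>Polynomial functions\<close>

text \<open>The hypersurface is defined by its equation, and that it is the closure of the orbit
  comes down to divisibility. Where \<open>z\<^sub>0 \<noteq> 0\<close> the equation says that the
  logarithm lies in \<open>U\<close>. It has degree one in the socle coordinate, with leading
  coefficient a power of \<open>z\<^sub>0\<close>, so a polynomial vanishing on the orbit becomes a
  multiple of the equation once multiplied by a power of \<open>z\<^sub>0\<close>. This power
  cancels because \<open>\<pi> (z\<^sup>d)\<close> is not identically zero. Irreducibility follows,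
  the orbit being a polynomial image of affine space. Non-degeneracy of \<open>f\<close> says that
  no nonzero linear form annihilates it. Only then is the linear part \<open>a\<close> well defined
  on the quotient \<open>A\<close>, and it maps the maximal ideal onto all of the space on which
  \<open>f\<close> lives. Degree 1 is excluded since \<open>A\<close> would have dimension 2 and the
  equation would be linear in two variables, hence degenerate. The quotient \<open>A\<close> is
  never formed: dual bases of the finite-rank pairing \<open>\<pi> (x * y)\<close> replace a basis
  of it.\<close>

definition mon_eval :: "(nat \<Rightarrow>\<^sub>0 nat) \<Rightarrow> 'a::comm_ring_1 vec \<Rightarrow> 'a" where
  "mon_eval \<mu> v = (\<Prod>i\<in>Poly_Mapping.keys \<mu>. (v $ i) ^ Poly_Mapping.lookup \<mu> i)"

lemma mon_eval_superset:
  assumes "finite M" "Poly_Mapping.keys \<mu> \<subseteq> M"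
  shows "mon_eval \<mu> v = (\<Prod>i\<in>M. (v $ i) ^ Poly_Mapping.lookup \<mu> i)"
  unfolding mon_eval_def
  by (rule prod.mono_neutral_left) (use assms in \<open>auto simp: in_keys_iff\<close>)

lemma mon_eval_add: "mon_eval (\<mu> + \<nu>) v = mon_eval \<mu> v * mon_eval \<nu> v"
proof -
  let ?M = "Poly_Mapping.keys \<mu> \<union> Poly_Mapping.keys \<nu>"
  have "mon_eval (\<mu> + \<nu>) v = (\<Prod>i\<in>?M. (v $ i) ^ Poly_Mapping.lookup (\<mu> + \<nu>) i)"
    by (rule mon_eval_superset) (use Poly_Mapping.keys_add[of \<mu> \<nu>] in auto)
  also have "\<dots> = mon_eval \<mu> v * mon_eval \<nu> v"
    by (simp add: mon_eval_superset[of ?M] lookup_add power_add prod.distrib)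
  finally show ?thesis .
qed

lemma mon_eval_0 [simp]: "mon_eval 0 v = 1"
  by (simp add: mon_eval_def)

lemma mon_eval_single [simp]: "mon_eval (Poly_Mapping.single i e) v = (v $ i) ^ e"
  by (cases "e = 0") (auto simp: mon_eval_def)

lemma peval_mon: "peval f v = (\<Sum>\<mu>\<in>Poly_Mapping.keys f. Poly_Mapping.lookup f \<mu> * mon_eval \<mu> v)"
  by (simp add: peval_def mon_eval_def)

lemma peval_superset:
  assumes "finite M" "Poly_Mapping.keys f \<subseteq> M"
  shows "peval f v = (\<Sum>\<mu>\<in>M. Poly_Mapping.lookup f \<mu> * mon_eval \<mu> v)"
  unfolding peval_mon
  by (rule sum.mono_neutral_left) (use assms in \<open>auto simp: in_keys_iff\<close>)

lemma peval_0 [simp]: "peval 0 v = 0"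
  by (simp add: peval_def)

lemma peval_single [simp]: "peval (Poly_Mapping.single \<mu> c) v = c * mon_eval \<mu> v"
  by (cases "c = 0") (auto simp: peval_mon)

lemma peval_1 [simp]: "peval 1 v = 1"
  using peval_single[of 0 1 v] by simp

lemma peval_add [simp]: "peval (f + g) v = peval f v + peval g v"
proof -
  let ?M = "Poly_Mapping.keys f \<union> Poly_Mapping.keys g"
  have "peval (f + g) v = (\<Sum>\<mu>\<in>?M. Poly_Mapping.lookup (f + g) \<mu> * mon_eval \<mu> v)"
    by (rule peval_superset) (use Poly_Mapping.keys_add[of f g] in auto)
  also have "\<dots> = peval f v + peval g v"
    by (simp add: peval_superset[of ?M] lookup_add algebra_simps sum.distrib)
  finally show ?thesis .
qed

lemma peval_sum [simp]: "peval (sum F I) v = (\<Sum>i\<in>I. peval (F i) v)"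
  by (induction I rule: infinite_finite_induct) auto

lemma poly_mapping_sum_single:
  "(\<Sum>\<mu>\<in>Poly_Mapping.keys f. Poly_Mapping.single \<mu> (Poly_Mapping.lookup f \<mu>)) = f"
  by (rule poly_mapping_eqI)
     (auto simp: lookup_sum lookup_single when_def in_keys_iff if_distrib sum.delta cong: if_cong)

lemma mpoly_mult_expand:
  "f * g = (\<Sum>\<mu>\<in>Poly_Mapping.keys f. \<Sum>\<nu>\<in>Poly_Mapping.keys g.
      Poly_Mapping.single (\<mu> + \<nu>) (Poly_Mapping.lookup f \<mu> * Poly_Mapping.lookup g \<nu>))"
  by (subst poly_mapping_sum_single[of f, symmetric], subst poly_mapping_sum_single[of g, symmetric])
     (simp add: sum_product mult_single)

lemma peval_mult [simp]: "peval (f * g) v = peval f v * peval g v"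
  unfolding mpoly_mult_expand[of f g]
  by (simp add: sum_product peval_mon[of f] peval_mon[of g] mon_eval_add mult_ac)

lemma peval_power [simp]: "peval (f ^ j) v = peval f v ^ j"
  by (induction j) auto

lemma peval_prod [simp]: "peval (prod F I) v = (\<Prod>i\<in>I. peval (F i) v)"
  by (induction I rule: infinite_finite_induct) auto

lemma vars_0 [simp]: "vars 0 = {}"
  by (simp add: vars_def)

lemma vars_add: "vars (f + g) \<subseteq> vars f \<union> vars g"
  using Poly_Mapping.keys_add[of f g] by (fastforce simp: vars_def)

lemma vars_sum: "vars (sum F I) \<subseteq> (\<Union>i\<in>I. vars (F i))"
proof (induction I rule: infinite_finite_induct)
  case (insert x A)
  thus ?case using vars_add[of "F x" "sum F A"] by auto
qed auto

lemma vars_mult: "vars (f * g) \<subseteq> vars f \<union> vars g"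
proof
  fix i assume "i \<in> vars (f * g)"
  then obtain \<mu> where \<mu>: "\<mu> \<in> Poly_Mapping.keys (f * g)" "i \<in> Poly_Mapping.keys \<mu>"
    by (auto simp: vars_def)
  then obtain a b where ab: "\<mu> = a + b" "a \<in> Poly_Mapping.keys f" "b \<in> Poly_Mapping.keys g"
    using keys_mult[of f g] by blast
  with \<mu>(2) Poly_Mapping.keys_add[of a b] show "i \<in> vars f \<union> vars g"
    by (auto simp: vars_def)
qed

lemma vars_prod: "vars (prod F I) \<subseteq> (\<Union>i\<in>I. vars (F i))"
proof (induction I rule: infinite_finite_induct)
  case (insert x A)
  thus ?case using vars_mult[of "F x" "prod F A"] by auto
qed (auto simp: vars_def)

lemma vars_power: "vars ((f :: 'a::comm_semiring_1 mpoly) ^ j) \<subseteq> vars f"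
  using vars_prod[of "\<lambda>_. f" "{..<j}"] by (auto split: if_splits)

lemma vars_single: "vars (Poly_Mapping.single \<mu> c) \<subseteq> Poly_Mapping.keys \<mu>"
  by (auto simp: vars_def split: if_splits)

lemma part_forms_0 [simp]: "0 \<in> part_forms m r d"
  by (simp add: part_forms_def)

lemma part_forms_add:
  assumes "f \<in> part_forms m r d" "g \<in> part_forms m r d"
  shows "f + g \<in> part_forms m r d"
  using assms vars_add[of f g] Poly_Mapping.keys_add[of f g] unfolding part_forms_def by blast

lemma part_forms_mult:
  assumes "f \<in> part_forms m r d" "g \<in> part_forms m r e"
  shows "f * g \<in> part_forms m r (d + e)"
proof -
  have "(\<Sum>i\<in>{m..<m + r}. Poly_Mapping.lookup \<mu> i) = d + e"
    if "\<mu> \<in> Poly_Mapping.keys (f * g)" for \<mu>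
  proof -
    obtain a b where "\<mu> = a + b" "a \<in> Poly_Mapping.keys f" "b \<in> Poly_Mapping.keys g"
      using keys_mult[of f g] \<open>\<mu> \<in> _\<close> by blast
    with assms show ?thesis by (simp add: part_forms_def lookup_add sum.distrib)
  qed
  thus ?thesis using assms vars_mult[of f g] unfolding part_forms_def by blast
qed

lemma part_forms_const: "Poly_Mapping.single 0 c \<in> part_forms m r 0"
  by (auto simp: part_forms_def vars_def split: if_splits)

lemma part_forms_coord:
  assumes "i < m + r"
  shows "Poly_Mapping.single (Poly_Mapping.single i 1) c \<in> part_forms m r (if i < m then 0 else 1)"
  using assms by (auto simp: part_forms_def vars_def lookup_single when_def split: if_splits)

text \<open>Functions on \<open>\<bbbK>\<^sup>m\<^sup>+\<^sup>r\<close> given by elements of \<open>part_forms m r d\<close>. The case \<open>r = d = 0\<close>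
  gives all polynomial functions, since the degree condition is then void.\<close>

definition form_fun :: "nat \<Rightarrow> nat \<Rightarrow> nat \<Rightarrow> ('a::comm_ring_1 vec \<Rightarrow> 'a) \<Rightarrow> bool" where
  "form_fun m r d q \<longleftrightarrow> (\<exists>f\<in>part_forms m r d. \<forall>v\<in>carrier_vec (m + r). peval f v = q v)"

abbreviation poly_fun :: "nat \<Rightarrow> ('a::comm_ring_1 vec \<Rightarrow> 'a) \<Rightarrow> bool" where
  "poly_fun N \<equiv> form_fun N 0 0"

lemma form_fun_0: "form_fun m r d (\<lambda>v. 0)"
  unfolding form_fun_def by (rule bexI[of _ 0]) auto

lemma form_fun_const: "form_fun m r 0 (\<lambda>v. c)"
  unfolding form_fun_def by (rule bexI[OF _ part_forms_const[of c]]) auto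

lemma form_fun_coord_low: "i < m \<Longrightarrow> form_fun m r 0 (\<lambda>v. v $ i)"
  unfolding form_fun_def using part_forms_coord[of i m r 1]
  by (intro bexI[of _ "Poly_Mapping.single (Poly_Mapping.single i 1) 1"]) auto

lemma form_fun_coord_high: "m \<le> i \<Longrightarrow> i < m + r \<Longrightarrow> form_fun m r 1 (\<lambda>v. v $ i)"
  unfolding form_fun_def using part_forms_coord[of i m r 1]
  by (intro bexI[of _ "Poly_Mapping.single (Poly_Mapping.single i 1) 1"]) auto

lemma form_fun_add:
  "form_fun m r d p \<Longrightarrow> form_fun m r d q \<Longrightarrow> form_fun m r d (\<lambda>v. p v + q v)"
  unfolding form_fun_def by (metis (no_types, lifting) part_forms_add peval_add)

lemma form_fun_mult:
  "form_fun m r d p \<Longrightarrow> form_fun m r e q \<Longrightarrow> form_fun m r (d + e) (\<lambda>v. p v * q v)"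
  unfolding form_fun_def by (metis (no_types, lifting) part_forms_mult peval_mult)

lemma form_fun_cmult: "form_fun m r d q \<Longrightarrow> form_fun m r d (\<lambda>v. c * q v)"
  using form_fun_mult[OF form_fun_const, of m r d q c] by simp

lemma form_fun_diff:
  fixes p q :: "'a::comm_ring_1 vec \<Rightarrow> 'a"
  assumes "form_fun m r d p" "form_fun m r d q"
  shows "form_fun m r d (\<lambda>v. p v - q v)"
  using form_fun_add[OF assms(1) form_fun_cmult[OF assms(2), of "-1"]] by simp

lemma form_fun_sum:
  "(\<And>i. i \<in> I \<Longrightarrow> form_fun m r d (q i)) \<Longrightarrow> form_fun m r d (\<lambda>v. \<Sum>i\<in>I. q i v)"
  by (induction I rule: infinite_finite_induct) (auto intro: form_fun_0 form_fun_add)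

lemma form_fun_power: "form_fun m r d q \<Longrightarrow> form_fun m r (j * d) (\<lambda>v. q v ^ j)"
  by (induction j) (auto intro: form_fun_const form_fun_mult)

lemma poly_fun_mult: "poly_fun N p \<Longrightarrow> poly_fun N q \<Longrightarrow> poly_fun N (\<lambda>v. p v * q v)"
  using form_fun_mult[of N 0 0 p 0 q] by simp

lemma poly_fun_power: "poly_fun N q \<Longrightarrow> poly_fun N (\<lambda>v. q v ^ j)"
  using form_fun_power[of N 0 0 q j] by simp

lemma form_fun_cong:
  "form_fun m r d p \<Longrightarrow> (\<And>v. v \<in> carrier_vec (m + r) \<Longrightarrow> p v = q v) \<Longrightarrow> form_fun m r d q"
  unfolding form_fun_def by metis

lemma peval_poly_fun: "vars f \<subseteq> {..<N} \<Longrightarrow> poly_fun N (peval f)"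
  unfolding form_fun_def part_forms_def by auto

lemma form_fun_imp_poly_fun: "form_fun m r d q \<Longrightarrow> poly_fun (m + r) q"
  unfolding form_fun_def part_forms_def by auto

lemma peval_induct [consumes 1, case_names const coord add mult]:
  assumes "vars f \<subseteq> {..<N}"
    and const: "\<And>c. P (\<lambda>v. c)"
    and coord: "\<And>i. i < N \<Longrightarrow> P (\<lambda>v. v $ i)"
    and add: "\<And>p q. P p \<Longrightarrow> P q \<Longrightarrow> P (\<lambda>v. p v + q v)"
    and mult: "\<And>p q. P p \<Longrightarrow> P q \<Longrightarrow> P (\<lambda>v. p v * q v)"
  shows "P (peval f)"
proof -
  have pow: "P (\<lambda>v. (v $ i) ^ j)" if "i < N" for i j
    by (induction j) (auto intro: const mult coord[OF that])
  have prod: "P (\<lambda>v. \<Prod>i\<in>I. (v $ i) ^ h i)" if "finite I" "I \<subseteq> {..<N}" for I h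
    using that by (induction I rule: finite_induct) (auto intro: const mult pow)
  have "P (\<lambda>v. \<Sum>\<mu>\<in>M. Poly_Mapping.lookup f \<mu> *
     (\<Prod>i\<in>Poly_Mapping.keys \<mu>. (v $ i) ^ Poly_Mapping.lookup \<mu> i))"
    if "finite M" "M \<subseteq> Poly_Mapping.keys f" for M
    using that
  proof (induction M rule: finite_induct)
    case (insert \<mu> M)
    have "Poly_Mapping.keys \<mu> \<subseteq> {..<N}"
      using insert.prems assms(1) by (auto simp: vars_def)
    thus ?case using insert by (auto intro!: add mult const prod)
  qed (auto intro: const)
  thus ?thesis unfolding peval_def[abs_def] by auto
qed

text \<open>Polynomial functions are determined only on \<open>carrier_vec N\<close>, hence the
  extra case \<open>cong\<close>.\<close>

lemma poly_fun_induct [consumes 1, case_names cong const coord add mult]: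
  assumes "poly_fun N q"
    and cong: "\<And>p q. P p \<Longrightarrow> (\<And>v. v \<in> carrier_vec N \<Longrightarrow> p v = q v) \<Longrightarrow> P q"
    and "\<And>c. P (\<lambda>v. c)"
    and "\<And>i. i < N \<Longrightarrow> P (\<lambda>v. v $ i)"
    and "\<And>p q. P p \<Longrightarrow> P q \<Longrightarrow> P (\<lambda>v. p v + q v)"
    and "\<And>p q. P p \<Longrightarrow> P q \<Longrightarrow> P (\<lambda>v. p v * q v)"
  shows "P q"
proof -
  from assms(1) obtain f where f: "vars f \<subseteq> {..<N}" "\<forall>v\<in>carrier_vec N. peval f v = q v"
    unfolding form_fun_def part_forms_def by auto
  show ?thesis
    by (rule cong[of "peval f"], rule peval_induct[OF f(1)]) (use assms f in auto)
qed

lemma poly_fun_compose: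
  assumes "poly_fun N q" "\<And>i. i < N \<Longrightarrow> poly_fun M (h i)"
  shows "poly_fun M (\<lambda>v. q (vec N (\<lambda>i. h i v)))"
  using assms(1)
proof (induction rule: poly_fun_induct)
  case (cong p q)
  thus ?case by (rule_tac form_fun_cong) auto
next
  case (coord i)
  thus ?case using assms(2)[of i] by simp
qed (auto intro: form_fun_const form_fun_add poly_fun_mult)

lemma poly_fun_line:
  assumes "poly_fun N q" "v \<in> carrier_vec N" "w \<in> carrier_vec N"
  shows "\<exists>p. \<forall>r. poly p r = q (v + r \<cdot>\<^sub>v w)"
  using assms(1)
proof (induction rule: poly_fun_induct)
  case (cong p q)
  thus ?case using assms(2,3) by auto
next
  case (const c)
  show ?case by (rule exI[of _ "[:c:]"]) simp
next
  case (coord i)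
  show ?case by (rule exI[of _ "[:v $ i, w $ i:]"]) (use coord assms in auto)
next
  case (add p q)
  thus ?case by (metis poly_add)
next
  case (mult p q)
  thus ?case by (metis poly_mult)
qed

lemma poly_eq_0_if_all_roots:
  fixes p :: "'a::{idom, ring_char_0} poly"
  assumes "\<And>r. poly p r = 0"
  shows "p = 0"
  using assms poly_all_0_iff_0 by blast

text \<open>A point where \<open>p\<close> is nonzero and a point where \<open>q\<close> is nonzero
  are joined by a line. Both restrictions to it are nonzero polynomials in one variable, so their
  product has a non-root.\<close>

lemma poly_fun_mult_eq_0:
  fixes p q :: "'a::{field_char_0} vec \<Rightarrow> 'a"
  assumes "poly_fun N p" "poly_fun N q" "\<And>v. v \<in> carrier_vec N \<Longrightarrow> p v * q v = 0"
  shows "(\<forall>v\<in>carrier_vec N. p v = 0) \<or> (\<forall>v\<in>carrier_vec N. q v = 0)"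
proof (rule ccontr)
  assume "\<not> ?thesis"
  then obtain v w where vw: "v \<in> carrier_vec N" "p v \<noteq> 0" "w \<in> carrier_vec N" "q w \<noteq> 0"
    by auto
  obtain P where P: "\<And>r. poly P r = p (v + r \<cdot>\<^sub>v (w - v))"
    using poly_fun_line[OF assms(1) vw(1), of "w - v"] vw by auto
  obtain Q where Q: "\<And>r. poly Q r = q (v + r \<cdot>\<^sub>v (w - v))"
    using poly_fun_line[OF assms(2) vw(1), of "w - v"] vw by auto
  have "poly (P * Q) r = 0" for r
    using assms(3)[of "v + r \<cdot>\<^sub>v (w - v)"] vw by (simp add: P Q)
  hence "P * Q = 0" by (rule poly_eq_0_if_all_roots)
  moreover have "v + 0 \<cdot>\<^sub>v (w - v) = v" "v + 1 \<cdot>\<^sub>v (w - v) = w"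
    using vw by auto
  hence "P \<noteq> 0" "Q \<noteq> 0" using P[of 0] Q[of 1] vw by auto
  ultimately show False by simp
qed

section \<open>Linear substitutions, homogeneity, and polynomials determined by their values\<close>

lemma peval_lin_subst:
  assumes "vars f \<subseteq> {..<dim_row A}" "v \<in> carrier_vec (dim_col A)"
  shows "peval (lin_subst A f) v = peval f (A *\<^sub>v v)"
proof -
  have "(\<Sum>j<dim_col A. A $$ (i, j) * v $ j) = (A *\<^sub>v v) $ i" if "i < dim_row A" for i
    using that assms(2) by (auto simp: scalar_prod_def atLeast0LessThan intro!: sum.cong)
  moreover have "i < dim_row A" if "i \<in> Poly_Mapping.keys \<mu>" "\<mu> \<in> Poly_Mapping.keys f" for i \<mu>
    using that assms(1) by (auto simp: vars_def)
  ultimately show ?thesis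
    unfolding lin_subst_def peval_def[of f] by (auto intro!: sum.cong prod.cong)
qed

lemma vars_lin_subst: "vars (lin_subst A f) \<subseteq> {..<dim_col A}"
proof -
  have 1: "vars (\<Sum>j<dim_col A. Poly_Mapping.single (Poly_Mapping.single j (1::nat)) (A $$ (i, j)))
      \<subseteq> {..<dim_col A}" for i
    by (rule order.trans[OF vars_sum]) (use vars_single in fastforce)
  have 2: "vars (\<Prod>i\<in>Poly_Mapping.keys \<mu>. (\<Sum>j<dim_col A. Poly_Mapping.single (Poly_Mapping.single j 1) (A $$ (i, j)))
           ^ Poly_Mapping.lookup \<mu> i) \<subseteq> {..<dim_col A}" for \<mu>
    by (rule order.trans[OF vars_prod]) (use order.trans[OF vars_power 1] in blast)
  have 3: "vars (Poly_Mapping.single 0 c * (\<Prod>i\<in>Poly_Mapping.keys \<mu>. (\<Sum>j<dim_col A. Poly_Mapping.single (Poly_Mapping.single j 1) (A $$ (i, j)))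
           ^ Poly_Mapping.lookup \<mu> i)) \<subseteq> {..<dim_col A}" for \<mu> c
    by (rule order.trans[OF vars_mult]) (use 2 vars_single[of 0 c] in auto)
  show ?thesis unfolding lin_subst_def
    by (rule order.trans[OF vars_sum]) (use 3 in auto)
qed

lemma peval_form_smult:
  assumes "f \<in> forms N d" "v \<in> carrier_vec N"
  shows "peval f (c \<cdot>\<^sub>v v) = c ^ d * peval f v"
proof -
  have "mon_eval \<mu> (c \<cdot>\<^sub>v v) = c ^ d * mon_eval \<mu> v" if "\<mu> \<in> Poly_Mapping.keys f" for \<mu>
  proof -
    have "Poly_Mapping.keys \<mu> \<subseteq> {..<N}" "(\<Sum>i\<in>{..<N}. Poly_Mapping.lookup \<mu> i) = d"
      using that assms(1) by (auto simp: part_forms_def vars_def atLeast0LessThan)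
    thus ?thesis using assms(2)
      by (simp add: mon_eval_superset[of "{..<N}"] power_mult_distrib prod.distrib power_sum[symmetric])
  qed
  thus ?thesis by (simp add: peval_mon sum_distrib_left mult_ac)
qed

text \<open>Reduction modulo \<open>B\<close> recovers the lowest digit; the quotient carries the
  others.\<close>

lemma base_expansion_inj:
  fixes a b :: "nat \<Rightarrow> nat"
  assumes "\<And>i. i < N \<Longrightarrow> a i < B" "\<And>i. i < N \<Longrightarrow> b i < B"
    and "(\<Sum>i<N. a i * B ^ i) = (\<Sum>i<N. b i * B ^ i)" "i < N"
  shows "a i = b i"
  using assms
proof (induction N arbitrary: a b i)
  case (Suc N)
  have split: "(\<Sum>i<Suc N. c i * B ^ i) = c 0 + B * (\<Sum>i<N. c (Suc i) * B ^ i)" for c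
    unfolding sum.lessThan_Suc_shift by (simp add: sum_distrib_left mult_ac)
  have eq: "a 0 + B * (\<Sum>i<N. a (Suc i) * B ^ i) = b 0 + B * (\<Sum>i<N. b (Suc i) * B ^ i)"
    using Suc.prems(3) by (simp only: split)
  have B: "a 0 < B" "b 0 < B" using Suc.prems(1,2)[of 0] by auto
  have 0: "a 0 = b 0"
    using arg_cong[OF eq, of "\<lambda>x. x mod B"] B by simp
  hence "(\<Sum>i<N. a (Suc i) * B ^ i) = (\<Sum>i<N. b (Suc i) * B ^ i)"
    using eq B by simp
  hence "a (Suc j) = b (Suc j)" if "j < N" for j
    using Suc.IH[of "\<lambda>j. a (Suc j)" "\<lambda>j. b (Suc j)" j] Suc.prems(1,2) that by auto
  with 0 Suc.prems(4) show ?case by (cases i) auto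
qed simp

text \<open>Kronecker substitution: on the points \<open>(r, r\<^bsup>B\<^esup>, r\<^bsup>B\<^sup>2\<^esup>, \<dots>)\<close> distinct monomials become distinct
  powers of \<open>r\<close>, provided that \<open>B\<close> exceeds all exponents.\<close>

lemma peval_eq_0_imp_eq_0:
  fixes f :: "'a::field_char_0 mpoly"
  assumes "vars f \<subseteq> {..<N}" "\<And>v. v \<in> carrier_vec N \<Longrightarrow> peval f v = 0"
  shows "f = 0"
proof -
  define B where "B = Suc (\<Sum>\<mu>\<in>Poly_Mapping.keys f. \<Sum>i<N. Poly_Mapping.lookup \<mu> i)"
  define K where "K \<mu> = (\<Sum>i<N. Poly_Mapping.lookup \<mu> i * B ^ i)" for \<mu>
  have keys: "Poly_Mapping.keys \<mu> \<subseteq> {..<N}" if "\<mu> \<in> Poly_Mapping.keys f" for \<mu>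
    using that assms(1) by (auto simp: vars_def)
  have lt: "Poly_Mapping.lookup \<mu> i < B" if "\<mu> \<in> Poly_Mapping.keys f" "i < N" for \<mu> i
  proof -
    have "Poly_Mapping.lookup \<mu> i \<le> (\<Sum>i<N. Poly_Mapping.lookup \<mu> i)"
      using that by (intro member_le_sum) auto
    also have "\<dots> \<le> (\<Sum>\<mu>\<in>Poly_Mapping.keys f. \<Sum>i<N. Poly_Mapping.lookup \<mu> i)"
      using that by (intro member_le_sum[where f = "\<lambda>\<mu>. \<Sum>i<N. Poly_Mapping.lookup \<mu> i"]) auto
    finally show ?thesis by (simp add: B_def)
  qed
  have inj: "inj_on K (Poly_Mapping.keys f)"
  proof (rule inj_onI)
    fix \<mu> \<nu> assume *: "\<mu> \<in> Poly_Mapping.keys f" "\<nu> \<in> Poly_Mapping.keys f" "K \<mu> = K \<nu>"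
    have "Poly_Mapping.lookup \<mu> i = Poly_Mapping.lookup \<nu> i" for i
    proof (cases "i < N")
      case True
      show ?thesis by (rule base_expansion_inj[where N = N and B = B])
        (use * lt True in \<open>auto simp: K_def\<close>)
    next
      case False
      thus ?thesis using keys[OF *(1)] keys[OF *(2)] by (metis in_keys_iff lessThan_iff subset_iff)
    qed
    thus "\<mu> = \<nu>" by (rule poly_mapping_eqI)
  qed
  define p where "p = (\<Sum>\<mu>\<in>Poly_Mapping.keys f. monom (Poly_Mapping.lookup f \<mu>) (K \<mu>))"
  have "poly p r = 0" for r
  proof -
    have "poly p r = peval f (vec N (\<lambda>i. r ^ (B ^ i)))"
      unfolding p_def peval_mon poly_sum
      by (intro sum.cong refl)
         (simp add: mon_eval_superset[OF _ keys] K_def poly_monom power_sum power_mult[symmetric] mult_ac)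
    thus ?thesis using assms(2) by simp
  qed
  hence p: "p = 0" by (rule poly_eq_0_if_all_roots)
  have "Poly_Mapping.lookup f \<mu> = 0" if "\<mu> \<in> Poly_Mapping.keys f" for \<mu>
  proof -
    have "coeff p (K \<mu>) = (\<Sum>\<nu>\<in>Poly_Mapping.keys f. if \<nu> = \<mu> then Poly_Mapping.lookup f \<nu> else 0)"
      unfolding p_def coeff_sum coeff_monom
      by (intro sum.cong refl) (use inj_onD[OF inj] that in auto)
    thus ?thesis using that p by simp
  qed
  thus ?thesis by (metis keys_eq_empty in_keys_iff equals0I)
qed

text \<open>Moving the point to \<open>v $ j = 0\<close> does not change the value of
  \<open>f\<close> and kills every monomial containing variable \<open>j\<close>. So
  \<open>f\<close> agrees with its part \<open>h\<close> free of that variable, as a function and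
  hence as a polynomial.\<close>

lemma not_in_vars_if_peval_indep:
  fixes f :: "'a::field_char_0 mpoly"
  assumes "vars f \<subseteq> {..<N}" "j < N"
    and indep: "\<And>v r. v \<in> carrier_vec N \<Longrightarrow> peval f (v + r \<cdot>\<^sub>v unit_vec N j) = peval f v"
  shows "j \<notin> vars f"
proof -
  let ?M = "{\<mu> \<in> Poly_Mapping.keys f. j \<notin> Poly_Mapping.keys \<mu>}"
  define h where "h = (\<Sum>\<mu>\<in>?M. Poly_Mapping.single \<mu> (Poly_Mapping.lookup f \<mu>))"
  have vh: "vars h \<subseteq> {i. i < N \<and> i \<noteq> j}"
    unfolding h_def
    by (rule order.trans[OF vars_sum]) (use vars_single assms(1) in \<open>fastforce simp: vars_def\<close>)
  have "peval (f + Poly_Mapping.single 0 (-1) * h) v = 0" if v: "v \<in> carrier_vec N" for v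
  proof -
    define w where "w = v + (- (v $ j)) \<cdot>\<^sub>v unit_vec N j"
    have wi: "w $ i = (if i = j then 0 else v $ i)" if "i < N" for i
      using v that assms(2) by (auto simp: w_def unit_vec_def)
    have "peval f v = peval f w" using indep[OF v] by (simp add: w_def)
    also have "\<dots> = (\<Sum>\<mu>\<in>?M. Poly_Mapping.lookup f \<mu> * mon_eval \<mu> w)"
      unfolding peval_mon
    proof (rule sum.mono_neutral_right)
      show "\<forall>\<mu>\<in>Poly_Mapping.keys f - ?M. Poly_Mapping.lookup f \<mu> * mon_eval \<mu> w = 0"
        using wi assms(2) by (auto simp: mon_eval_def in_keys_iff intro!: bexI[of _ j])
    qed auto
    also have "\<dots> = (\<Sum>\<mu>\<in>?M. Poly_Mapping.lookup f \<mu> * mon_eval \<mu> v)"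
      by (intro sum.cong refl, simp add: mon_eval_def, intro disjI2 prod.cong refl)
         (use wi assms(1) in \<open>auto simp: vars_def subset_iff\<close>)
    also have "\<dots> = peval h v" by (simp add: h_def)
    finally show ?thesis by simp
  qed
  moreover have "vars (f + Poly_Mapping.single 0 (-1) * h) \<subseteq> {..<N}"
    using vars_add[of f "Poly_Mapping.single 0 (-1) * h"] vars_mult[of "Poly_Mapping.single 0 (-1)" h]
      vars_single[of 0 "-1::'a"] vh assms(1) by fastforce
  ultimately have "f + Poly_Mapping.single 0 (-1) * h = 0" by (rule_tac peval_eq_0_imp_eq_0)
  hence "f = h" by (simp add: single_uminus)
  thus ?thesis using vh by auto
qed

section \<open>Biorthogonal systems\<close>

text \<open>The form is an arbitrary function of two arguments: with no vector space structure on
  the types, the same lemmas serve the dot product of coordinate functions and the pairing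
  \<open>\<pi> (x * y)\<close> on a polynomial ring. Finite rank takes the place of finite
  dimension.\<close>

definition biorthogonal :: "('b \<Rightarrow> 'c \<Rightarrow> 'a::field) \<Rightarrow> nat \<Rightarrow> (nat \<Rightarrow> 'b) \<Rightarrow> (nat \<Rightarrow> 'c) \<Rightarrow> bool" where
  "biorthogonal \<beta> N s t \<longleftrightarrow> (\<forall>i<N. \<forall>j<N. \<beta> (s i) (t j) = (if i = j then 1 else 0))"

text \<open>If \<open>N > card R\<close>, padding the factorisation \<open>1 = P Q\<close> with zeros gives square matrices, one of
  which has a zero column.\<close>

lemma biorthogonal_le_rank:
  fixes \<beta> :: "'b \<Rightarrow> 'c \<Rightarrow> 'a::field"
  assumes "biorthogonal \<beta> N s t"
    and "finite R" and rank: "\<And>x y. \<beta> x y = (\<Sum>r\<in>R. a r x * b r y)"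
  shows "N \<le> card R"
proof (rule ccontr)
  assume "\<not> N \<le> card R"
  hence lt: "card R < N" by simp
  obtain h where h: "bij_betw h {..<card R} R"
    using ex_bij_betw_nat_finite[OF assms(2)] by (auto simp: atLeast0LessThan)
  define P where "P = mat N N (\<lambda>(i, r). if r < card R then a (h r) (s i) else 0)"
  define Q where "Q = mat N N (\<lambda>(r, j). if r < card R then b (h r) (t j) else 0)"
  have PQ: "P * Q = 1\<^sub>m N"
  proof (rule eq_matI)
    fix i j assume "i < dim_row (1\<^sub>m N)" "j < dim_col (1\<^sub>m N)"
    hence ij: "i < N" "j < N" by auto
    have "(P * Q) $$ (i, j) = (\<Sum>r<N. if r < card R then a (h r) (s i) * b (h r) (t j) else 0)"
      using ij by (auto simp: P_def Q_def scalar_prod_def atLeast0LessThan intro!: sum.cong)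
    also have "\<dots> = (\<Sum>r<card R. a (h r) (s i) * b (h r) (t j))"
      using lt by (intro sum.mono_neutral_cong_right) auto
    also have "\<dots> = (\<Sum>r\<in>R. a r (s i) * b r (t j))"
      by (rule sum.reindex_bij_betw[OF h])
    finally show "(P * Q) $$ (i, j) = 1\<^sub>m N $$ (i, j)"
      using assms(1) ij by (simp add: rank[symmetric] biorthogonal_def)
  qed (auto simp: P_def Q_def)
  have carr: "P \<in> carrier_mat N N" "Q \<in> carrier_mat N N" by (auto simp: P_def Q_def)
  have "det P * det Q = 1"
    using det_mult[OF carr] PQ by simp
  moreover have "det P = 0"
  proof -
    define v :: "'a vec" where "v = unit_vec N (card R)"
    have "P *\<^sub>v v = 0\<^sub>v N"
      using lt by (auto simp: P_def v_def scalar_prod_def unit_vec_def intro!: eq_vecI sum.neutral)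
    moreover have "v \<noteq> 0\<^sub>v N"
      using lt by (auto simp: v_def unit_vec_def vec_eq_iff)
    moreover have "v \<in> carrier_vec N" by (simp add: v_def)
    ultimately show ?thesis using det_0_iff_vec_prod_zero[OF carr(1)] by blast
  qed
  ultimately show False by simp
qed

text \<open>A maximal biorthogonal system represents the whole form: subtracting from \<open>x\<close> and \<open>y\<close> their
  expansions leaves a pair which, if \<open>\<beta>\<close> did not vanish on it, would extend the system.\<close>

lemma biorthogonal_extend:
  fixes \<beta> :: "'b \<Rightarrow> 'c \<Rightarrow> 'a::field"
  assumes init: "biorthogonal \<beta> m s0 t0"
    and "finite R" and rank: "\<And>x y. \<beta> x y = (\<Sum>r\<in>R. a r x * b r y)"
    and left: "\<And>x x' c. \<exists>x''. \<forall>y. \<beta> x'' y = \<beta> x y - c * \<beta> x' y"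
    and right: "\<And>y y' c. \<exists>y''. \<forall>x. \<beta> x y'' = \<beta> x y - c * \<beta> x y'"
  obtains N s t where "m \<le> N" "N \<le> card R" "biorthogonal \<beta> N s t"
    "\<And>i. i < m \<Longrightarrow> s i = s0 i" "\<And>i. i < m \<Longrightarrow> t i = t0 i"
    "\<And>x y. \<beta> x y = (\<Sum>i<N. \<beta> x (t i) * \<beta> (s i) y)"
proof -
  define Ext where "Ext N \<longleftrightarrow> (\<exists>s t. m \<le> N \<and> biorthogonal \<beta> N s t \<and> (\<forall>i<m. s i = s0 i \<and> t i = t0 i))" for N
  have bound: "\<And>N. Ext N \<Longrightarrow> N \<le> card R"
    unfolding Ext_def using biorthogonal_le_rank[where \<beta> = \<beta>, OF _ assms(2) rank] by blast
  have "Ext m" unfolding Ext_def using init by auto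
  define N where "N = (GREATEST N. Ext N)"
  have N: "Ext N" unfolding N_def by (rule GreatestI_nat[of Ext m "card R"]) (use \<open>Ext m\<close> bound in auto)
  have maxN: "N' \<le> N" if "Ext N'" for N'
    unfolding N_def by (rule Greatest_le_nat[of Ext N' "card R"]) (use that bound in auto)
  from N obtain s t where st: "m \<le> N" "biorthogonal \<beta> N s t" "\<forall>i<m. s i = s0 i \<and> t i = t0 i"
    unfolding Ext_def by blast
  have L: "\<exists>x''. \<forall>y. \<beta> x'' y = \<beta> x y - (\<Sum>i<k. c i * \<beta> (s i) y)" for x c k
  proof (induction k)
    case (Suc k)
    then obtain x1 where x1: "\<forall>y. \<beta> x1 y = \<beta> x y - (\<Sum>i<k. c i * \<beta> (s i) y)" by blast
    show ?case using left[of x1 "c k" "s k"] by (auto simp: x1 algebra_simps)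
  qed auto
  have R: "\<exists>y''. \<forall>x. \<beta> x y'' = \<beta> x y - (\<Sum>i<k. c i * \<beta> x (t i))" for y c k
  proof (induction k)
    case (Suc k)
    then obtain y1 where y1: "\<forall>x. \<beta> x y1 = \<beta> x y - (\<Sum>i<k. c i * \<beta> x (t i))" by blast
    show ?case using right[of y1 "c k" "t k"] by (auto simp: y1 algebra_simps)
  qed auto
  have "\<beta> x y = (\<Sum>i<N. \<beta> x (t i) * \<beta> (s i) y)" for x y
  proof (rule ccontr)
    assume neq: "\<beta> x y \<noteq> (\<Sum>i<N. \<beta> x (t i) * \<beta> (s i) y)"
    define \<gamma> where "\<gamma> = \<beta> x y - (\<Sum>i<N. \<beta> x (t i) * \<beta> (s i) y)"
    have \<gamma>: "\<gamma> \<noteq> 0" using neq by (simp add: \<gamma>_def)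
    obtain x' where x': "\<And>w. \<beta> x' w = \<beta> x w - (\<Sum>i<N. \<beta> x (t i) * \<beta> (s i) w)"
      using L[of x "\<lambda>i. \<beta> x (t i)" N] by blast
    obtain y' where y': "\<And>w. \<beta> w y' = \<beta> w y - (\<Sum>i<N. \<beta> (s i) y * \<beta> w (t i))"
      using R[of y "\<lambda>i. \<beta> (s i) y" N] by blast
    have bo: "\<beta> (s i) (t j) = (if i = j then 1 else 0)" if "i < N" "j < N" for i j
      using st(2) that by (simp add: biorthogonal_def)
    have xt: "\<beta> x' (t j) = 0" if "j < N" for j
    proof -
      have "(\<Sum>i<N. \<beta> x (t i) * \<beta> (s i) (t j)) = (\<Sum>i<N. if i = j then \<beta> x (t i) else 0)"
        by (intro sum.cong) (auto simp: bo that)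
      thus ?thesis using that by (simp add: x')
    qed
    have sy: "\<beta> (s j) y' = 0" if "j < N" for j
    proof -
      have "(\<Sum>i<N. \<beta> (s i) y * \<beta> (s j) (t i)) = (\<Sum>i<N. if i = j then \<beta> (s i) y else 0)"
        by (intro sum.cong) (auto simp: bo that)
      thus ?thesis using that by (simp add: y')
    qed
    have xy: "\<beta> x' y' = \<gamma>"
      using xt by (simp add: y') (simp add: x' \<gamma>_def)
    \<comment> \<open>Only subtraction of multiples is available, so \<open>x' / \<gamma>\<close> is
      produced as \<open>x' - (1 - 1 / \<gamma>) x'\<close>.\<close>
    obtain z where z: "\<And>w. \<beta> z w = \<beta> x' w - (1 - 1 / \<gamma>) * \<beta> x' w"
      using left[of x' "1 - 1 / \<gamma>" x'] by blast
    have "biorthogonal \<beta> (Suc N) (s(N := z)) (t(N := y'))"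
      using bo sy xt xy \<gamma> by (auto simp: biorthogonal_def z less_Suc_eq algebra_simps)
    hence "Ext (Suc N)"
      unfolding Ext_def using st by (intro exI[of _ "s(N := z)"] exI[of _ "t(N := y')"]) auto
    thus False using maxN[of "Suc N"] by simp
  qed
  thus ?thesis using that[of N s t] st bound[OF N] by blast
qed

text \<open>A maximal extension has length exactly \<open>n\<close>: its expansion bounds the rank
  of the dot product by its length, while the standard basis is biorthogonal of length
  \<open>n\<close>. Its rows and columns then form mutually inverse matrices. This completes a
  vector, or a rectangular matrix with a right inverse, to an invertible matrix.\<close>

lemma biorthogonal_extend_GL:
  fixes s0 t0 :: "nat \<Rightarrow> nat \<Rightarrow> 'a::field"
  assumes "biorthogonal (\<lambda>x y. \<Sum>i<n. x i * y i) m s0 t0"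
  obtains A B where "m \<le> n" "A \<in> GL n" "B \<in> GL n" "A * B = 1\<^sub>m n"
    "\<And>i j. i < m \<Longrightarrow> j < n \<Longrightarrow> A $$ (i, j) = s0 i j"
    "\<And>i j. i < m \<Longrightarrow> j < n \<Longrightarrow> B $$ (j, i) = t0 i j"
proof -
  let ?\<beta> = "\<lambda>x y. \<Sum>i<n. (x i :: 'a) * y i"
  have left: "\<exists>x''. \<forall>y. ?\<beta> x'' y = ?\<beta> x y - c * ?\<beta> x' y" for x x' c
    by (rule exI[of _ "\<lambda>i. x i - c * x' i"])
       (simp add: left_diff_distrib sum_subtractf sum_distrib_left mult.assoc)
  have right: "\<exists>y''. \<forall>x. ?\<beta> x y'' = ?\<beta> x y - c * ?\<beta> x y'" for y y' c
    by (rule exI[of _ "\<lambda>i. y i - c * y' i"])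
       (simp add: right_diff_distrib sum_subtractf sum_distrib_left mult_ac)
  obtain N s t where st: "m \<le> N" "N \<le> card {..<n}" "biorthogonal ?\<beta> N s t"
    "\<And>i. i < m \<Longrightarrow> s i = s0 i" "\<And>i. i < m \<Longrightarrow> t i = t0 i"
    "\<And>x y. ?\<beta> x y = (\<Sum>i<N. ?\<beta> x (t i) * ?\<beta> (s i) y)"
    by (rule biorthogonal_extend[where \<beta> = ?\<beta> and R = "{..<n}" and a = "\<lambda>i x. x i" and b = "\<lambda>i y. y i",
          OF assms finite_lessThan refl left right], rule that)
  let ?e = "\<lambda>i j. if j = (i::nat) then 1 else (0::'a)"
  have "biorthogonal (\<lambda>i j. ?\<beta> (?e i) (?e j)) n id id"
    unfolding biorthogonal_def by (auto simp: if_distrib[of "\<lambda>x. x * _"] sum.delta cong: if_cong)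
  hence "n \<le> card {..<N}"
    by (rule biorthogonal_le_rank[where a = "\<lambda>k i. ?\<beta> (?e i) (t k)" and b = "\<lambda>k j. ?\<beta> (s k) (?e j)"])
       (auto intro: st(6))
  hence N: "N = n" using st(2) by simp
  define A where "A = mat n n (\<lambda>(i, j). s i j)"
  define B where "B = mat n n (\<lambda>(i, j). t j i)"
  have carr: "A \<in> carrier_mat n n" "B \<in> carrier_mat n n" by (auto simp: A_def B_def)
  have AB: "A * B = 1\<^sub>m n"
  proof (rule eq_matI)
    fix i j assume "i < dim_row (1\<^sub>m n)" "j < dim_col (1\<^sub>m n)"
    hence ij: "i < n" "j < n" by auto
    have "(A * B) $$ (i, j) = ?\<beta> (s i) (t j)"
      using ij by (simp add: A_def B_def scalar_prod_def atLeast0LessThan)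
    thus "(A * B) $$ (i, j) = 1\<^sub>m n $$ (i, j)"
      using st(3) ij by (simp add: biorthogonal_def N)
  qed (auto simp: A_def B_def)
  have BA: "B * A = 1\<^sub>m n"
    using mat_mult_left_right_inverse[OF carr AB] .
  have "invertible_mat A" "invertible_mat B"
    using carr AB BA unfolding invertible_mat_def inverts_mat_def by auto
  thus ?thesis
    using that[of A B] carr AB st(1,4,5) by (auto simp: GL_def N A_def B_def)
qed

section \<open>Local Gorenstein algebras\<close>

text \<open>A commutative ring \<open>'b\<close> containing the field \<open>'a\<close> via \<open>\<kappa>\<close> and filtered by ideals \<open>F i\<close>, with a
  linear functional \<open>\<pi>\<close> vanishing on \<open>F (d + 1)\<close>. Modulo the radical of the form \<open>\<pi> (x * y)\<close> it is a
  local Gorenstein algebra with maximal ideal \<open>F 1\<close> and socle spanned by \<open>e\<close>, and \<open>\<pi> (e * x)\<close> is the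
  residue of \<open>x\<close> in \<open>'a\<close>. Instead of passing to the quotient we compute up to the congruence
  \<open>eqv\<close>.\<close>

locale gorenstein_functional =
  fixes \<kappa> :: "'a::field_char_0 \<Rightarrow> 'b::idom" and \<pi> :: "'b \<Rightarrow> 'a"
    and F :: "nat \<Rightarrow> 'b set" and d :: nat and e :: 'b
  assumes \<kappa>_1: "\<kappa> 1 = 1" and \<kappa>_add: "\<kappa> (a + b) = \<kappa> a + \<kappa> b" and \<kappa>_mult: "\<kappa> (a * b) = \<kappa> a * \<kappa> b"
    and \<pi>_add: "\<pi> (x + y) = \<pi> x + \<pi> y" and \<pi>_scale: "\<pi> (\<kappa> a * x) = a * \<pi> x"
    and F_0: "x \<in> F 0" and F_Suc: "x \<in> F (Suc i) \<Longrightarrow> x \<in> F i"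
    and F_add: "x \<in> F i \<Longrightarrow> y \<in> F i \<Longrightarrow> x + y \<in> F i"
    and F_mult: "x \<in> F i \<Longrightarrow> y \<in> F j \<Longrightarrow> x * y \<in> F (i + j)"
    and F_top: "x \<in> F (Suc d) \<Longrightarrow> \<pi> x = 0"
    and d_ge_2: "d \<ge> 2"
    and e_in: "e \<in> F d" and \<pi>_e: "\<pi> e = 1"
    and residue: "x - \<kappa> (\<pi> (e * x)) \<in> F 1"
begin

definition eps :: "'b \<Rightarrow> 'a" where "eps x = \<pi> (e * x)"

definition eqv :: "'b \<Rightarrow> 'b \<Rightarrow> bool" where "eqv x y \<longleftrightarrow> (\<forall>w. \<pi> (x * w) = \<pi> (y * w))"

lemma \<kappa>_0 [simp]: "\<kappa> 0 = 0"
  using \<kappa>_add[of 0 0] by (metis add_0_left add_cancel_right_right)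

lemma \<kappa>_minus: "\<kappa> (- a) = - \<kappa> a"
  using \<kappa>_add[of "- a" a] by (simp add: eq_neg_iff_add_eq_0)

lemma \<kappa>_of_nat: "\<kappa> (of_nat n) = of_nat n"
  by (induction n) (auto simp: \<kappa>_add \<kappa>_1)

lemma \<kappa>_power: "\<kappa> (a ^ n) = \<kappa> a ^ n"
  by (induction n) (auto simp: \<kappa>_mult \<kappa>_1)

lemma \<kappa>_neq_0: "a \<noteq> 0 \<Longrightarrow> \<kappa> a \<noteq> 0"
  using \<kappa>_mult[of a "1 / a"] by (auto simp: \<kappa>_1)

lemma of_nat_Suc_neq_0: "of_nat (Suc n) \<noteq> (0 :: 'b)"
  using \<kappa>_neq_0[of "of_nat (Suc n)"] by (simp only: \<kappa>_of_nat of_nat_neq_0) simp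

lemma \<pi>_0 [simp]: "\<pi> 0 = 0"
  using \<pi>_add[of 0 0] by simp

lemma \<pi>_minus: "\<pi> (- x) = - \<pi> x"
  using \<pi>_scale[of "-1" x] by (simp add: \<kappa>_minus \<kappa>_1)

lemma \<pi>_diff: "\<pi> (x - y) = \<pi> x - \<pi> y"
  using \<pi>_add[of x "- y"] by (simp add: \<pi>_minus)

lemma \<pi>_sum: "\<pi> (sum f I) = (\<Sum>i\<in>I. \<pi> (f i))"
  by (induction I rule: infinite_finite_induct) (auto simp: \<pi>_add)

lemma F_mult_right: "x \<in> F i \<Longrightarrow> x * y \<in> F i"
  using F_mult[OF _ F_0, of x i y] by simp

lemma F_mult_left: "x \<in> F i \<Longrightarrow> y * x \<in> F i"
  using F_mult_right[of x i y] by (simp add: mult.commute)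

lemma F_minus: "x \<in> F i \<Longrightarrow> - x \<in> F i"
  using F_mult_left[of x i "-1"] by simp

lemma F_diff: "x \<in> F i \<Longrightarrow> y \<in> F i \<Longrightarrow> x - y \<in> F i"
  using F_add[of x i "- y"] F_minus by simp

lemma F_zero: "0 \<in> F i"
  using F_mult_left[of _ i 0] F_diff by (induction i) (use F_0 F_mult[of 0] residue[of 0] in fastforce)+

lemma F_sum: "(\<And>j. j \<in> I \<Longrightarrow> f j \<in> F i) \<Longrightarrow> sum f I \<in> F i"
  by (induction I rule: infinite_finite_induct) (auto simp: F_zero intro: F_add)

lemma F_antimono: "x \<in> F j \<Longrightarrow> i \<le> j \<Longrightarrow> x \<in> F i"
  by (induction j) (auto simp: le_Suc_eq dest: F_Suc)

lemma F_power: "x \<in> F 1 \<Longrightarrow> x ^ i \<in> F i"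
proof (induction i)
  case (Suc i)
  thus ?case using F_mult[of x 1 "x ^ i" i] by simp
qed (simp add: F_0)

lemma eqv_refl [simp, intro]: "eqv x x" by (simp add: eqv_def)
lemma eqv_sym: "eqv x y \<Longrightarrow> eqv y x" by (simp add: eqv_def)
lemma eqv_trans [trans]: "eqv x y \<Longrightarrow> eqv y z \<Longrightarrow> eqv x z" by (simp add: eqv_def)
lemma eqv_add: "eqv x y \<Longrightarrow> eqv x' y' \<Longrightarrow> eqv (x + x') (y + y')"
  by (simp add: eqv_def \<pi>_add algebra_simps)
lemma eqv_mult: "eqv x y \<Longrightarrow> eqv x' y' \<Longrightarrow> eqv (x * x') (y * y')"
  unfolding eqv_def by (metis mult.assoc mult.left_commute)
lemma eqv_diff: "eqv x y \<Longrightarrow> eqv x' y' \<Longrightarrow> eqv (x - x') (y - y')"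
  by (simp add: eqv_def \<pi>_diff algebra_simps)
lemma eqv_power: "eqv x y \<Longrightarrow> eqv (x ^ n) (y ^ n)"
  by (induction n) (auto intro: eqv_mult)
lemma eqv_sum: "(\<And>i. i \<in> I \<Longrightarrow> eqv (f i) (g i)) \<Longrightarrow> eqv (sum f I) (sum g I)"
  by (induction I rule: infinite_finite_induct) (auto intro: eqv_add)
lemma eqv_\<pi>: "eqv x y \<Longrightarrow> \<pi> x = \<pi> y"
  unfolding eqv_def by (metis mult.right_neutral)
lemma eqv_eps: "eqv x y \<Longrightarrow> eps x = eps y"
  unfolding eqv_def eps_def by (metis mult.commute)
lemma eqv_0_iff: "eqv (x - y) 0 \<longleftrightarrow> eqv x y"
  by (simp add: eqv_def \<pi>_diff algebra_simps)
lemma F_eqv_0: "x \<in> F (Suc d) \<Longrightarrow> eqv x 0"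
  by (simp add: eqv_def F_top F_mult_right)

lemma eps_add: "eps (x + y) = eps x + eps y"
  by (simp add: eps_def \<pi>_add algebra_simps)

lemma eps_scale: "eps (\<kappa> a * x) = a * eps x"
  using \<pi>_scale[of a "e * x"] by (simp add: eps_def mult.left_commute)

lemma eps_1 [simp]: "eps 1 = 1"
  by (simp add: eps_def \<pi>_e)

lemma eps_\<kappa> [simp]: "eps (\<kappa> a) = a"
  using eps_scale[of a 1] by simp

lemma eps_0 [simp]: "eps 0 = 0"
  by (simp add: eps_def)

lemma eps_diff: "eps (x - y) = eps x - eps y"
  by (simp add: eps_def \<pi>_diff algebra_simps)

lemma eps_F: "x \<in> F 1 \<Longrightarrow> eps x = 0"
  using F_mult[OF e_in, of x 1] by (simp add: eps_def F_top)

lemma eps_iff: "eps x = 0 \<longleftrightarrow> x \<in> F 1"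
  using eps_F residue[of x] by (auto simp: eps_def)

lemma in_F1_iff: "x \<in> F (Suc 0) \<longleftrightarrow> eps x = 0"
  using eps_iff[of x] by simp

lemma residue': "x - \<kappa> (eps x) \<in> F 1"
  using residue by (simp add: eps_def)

text \<open>\<open>F 1\<close> is an ideal on which \<open>eps\<close> vanishes, so replacing
  \<open>x\<close> by the scalar \<open>eps x\<close> does not change the left-hand side.\<close>

lemma eps_mult: "eps (x * y) = eps x * eps y"
proof -
  have "(x - \<kappa> (eps x)) * y \<in> F 1" by (intro F_mult_right residue')
  hence "eps ((x - \<kappa> (eps x)) * y) = 0" by (rule eps_F)
  thus ?thesis by (simp add: left_diff_distrib eps_diff eps_scale)
qed

lemma eps_power: "eps (x ^ n) = eps x ^ n"
  by (induction n) (auto simp: eps_mult)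

lemma eps_sum: "eps (sum f I) = (\<Sum>i\<in>I. eps (f i))"
  by (induction I rule: infinite_finite_induct) (auto simp: eps_add)

text \<open>The error \<open>e * (x - \<kappa> (eps x))\<close> lies in \<open>F (d + 1)\<close>:
  the maximal ideal annihilates \<open>e\<close>.\<close>

lemma e_mult: "eqv (e * x) (\<kappa> (eps x) * e)"
proof -
  have "e * (x - \<kappa> (eps x)) \<in> F (d + 1)"
    by (intro F_mult e_in residue')
  hence "eqv (e * (x - \<kappa> (eps x))) 0" by (intro F_eqv_0) simp
  thus ?thesis by (subst eqv_0_iff[symmetric]) (simp add: algebra_simps)
qed

lemma e_in_1: "e \<in> F 1"
  using F_antimono[OF e_in, of 1] d_ge_2 by simp

lemma e_square: "eqv (e * e) 0"
  by (intro F_eqv_0 F_antimono[OF F_mult[OF e_in e_in]]) (use d_ge_2 in simp)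

text \<open>\<open>y\<close> is a unit because \<open>1 - y\<close> is nilpotent: \<open>x\<close>
  is congruent to \<open>x * (1 - y) ^ j\<close> for every \<open>j\<close>, and this vanishes for
  \<open>j = Suc d\<close>.\<close>

lemma eqv_unit_cancel:
  assumes "eqv (x * y) 0" "eps y = 1"
  shows "eqv x 0"
proof -
  have "eqv (x * (1 - y) ^ j) x" for j
  proof (induction j)
    case (Suc j)
    have "eqv (x * (1 - y) ^ j - (x * y) * (1 - y) ^ j) (x - 0 * (1 - y) ^ j)"
      by (intro eqv_diff Suc eqv_mult assms(1) eqv_refl)
    thus ?case by (simp add: algebra_simps)
  qed auto
  moreover have "eqv (x * (1 - y) ^ Suc d) 0"
    by (intro F_eqv_0 F_mult_left F_power) (simp add: in_F1_iff eps_diff assms(2))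
  ultimately show ?thesis using eqv_trans eqv_sym by blast
qed

section \<open>Truncated exponential and logarithm\<close>

text \<open>On \<open>F 1\<close> the terms of degree above \<open>d\<close> are invisible to
  \<open>eqv\<close>, so the truncations \<open>E\<close> of exp (z) and \<open>L\<close> of ln (1 +
  z) satisfy the identities of the full series up to \<open>eqv\<close>.\<close>

definition E :: "'b \<Rightarrow> 'b" where "E z = (\<Sum>i\<le>d. \<kappa> (1 / fact i) * z ^ i)"

definition L :: "'b \<Rightarrow> 'b" where "L z = (\<Sum>i=1..d. \<kappa> ((-1) ^ (i - 1) / of_nat i) * z ^ i)"

lemma E_cong: "eqv x y \<Longrightarrow> eqv (E x) (E y)"
  unfolding E_def by (intro eqv_sum eqv_mult eqv_power eqv_refl)

lemma E_0 [simp]: "E 0 = 1"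
  unfolding E_def by (simp add: power_0_left if_distrib \<kappa>_1 sum.delta cong: if_cong)

lemma eps_E: "x \<in> F 1 \<Longrightarrow> eps (E x) = 1"
  unfolding E_def by (simp add: eps_sum eps_scale eps_power eps_F power_0_left if_distrib sum.delta cong: if_cong)

lemma L_in: "x \<in> F 1 \<Longrightarrow> L x \<in> F 1"
  unfolding L_def by (intro F_sum F_mult_left) (auto intro: F_antimono[OF F_power])

text \<open>The terms with \<open>i + j \<le> d\<close> regroup by the binomial theorem into
  \<open>E (u + v)\<close>; all others lie in \<open>F (Suc d)\<close>.\<close>

lemma E_add:
  assumes "u \<in> F 1" "v \<in> F 1"
  shows "eqv (E (u + v)) (E u * E v)"
proof -
  let ?t = "\<lambda>i j. \<kappa> (1 / fact i) * u ^ i * (\<kappa> (1 / fact j) * v ^ j)"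
  let ?A = "{(i, j). i + j \<le> d}"
  have "E u * E v = (\<Sum>(i, j)\<in>{..d} \<times> {..d}. ?t i j)"
    by (simp add: E_def sum_product sum.cartesian_product)
  also have "{..d} \<times> {..d} = ?A \<union> ({..d} \<times> {..d} - ?A)" by auto
  also have "(\<Sum>(i, j)\<in>\<dots>. ?t i j) =
      (\<Sum>(i, j)\<in>?A. ?t i j) + (\<Sum>(i, j)\<in>{..d} \<times> {..d} - ?A. ?t i j)"
  proof (rule sum.union_disjoint)
    show "finite ?A" by (rule finite_subset[of _ "{..d} \<times> {..d}"]) auto
  qed auto
  also have "(\<Sum>(i, j)\<in>?A. ?t i j) = (\<Sum>k\<le>d. \<Sum>i\<le>k. ?t i (k - i))"
    by (rule sum.triangle_reindex_eq)
  also have "\<dots> = E (u + v)"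
    unfolding E_def
  proof (intro sum.cong refl)
    fix k
    have "(1::'a) / fact k * of_nat (k choose i) = 1 / fact i * (1 / fact (k - i))" if "i \<le> k" for i
      using that by (simp add: binomial_fact)
    hence "\<kappa> (1 / fact k) * of_nat (k choose i) = \<kappa> (1 / fact i) * \<kappa> (1 / fact (k - i))" if "i \<le> k" for i
      using that by (metis \<kappa>_mult \<kappa>_of_nat)
    hence *: "\<kappa> (1 / fact k) * (of_nat (k choose i) * u ^ i * v ^ (k - i)) = ?t i (k - i)" if "i \<le> k" for i
      using that by (simp only: mult.assoc[symmetric]) (simp only: mult_ac)
    show "(\<Sum>i\<le>k. ?t i (k - i)) = \<kappa> (1 / fact k) * (u + v) ^ k"
      unfolding binomial_ring sum_distrib_left by (intro sum.cong refl) (simp only: * atMost_iff)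
  qed
  finally have eq: "E u * E v = E (u + v) + (\<Sum>(i, j)\<in>{..d} \<times> {..d} - ?A. ?t i j)" .
  have "(\<Sum>(i, j)\<in>{..d} \<times> {..d} - ?A. ?t i j) \<in> F (Suc d)"
  proof (intro F_sum, clarsimp)
    fix i j assume "\<not> i + j \<le> d"
    hence "u ^ i * v ^ j \<in> F (Suc d)"
      by (intro F_antimono[OF F_mult[OF F_power F_power]] assms) simp
    hence "(\<kappa> (1 / fact i) * \<kappa> (1 / fact j)) * (u ^ i * v ^ j) \<in> F (Suc d)" by (rule F_mult_left)
    thus "?t i j \<in> F (Suc d)" by (simp add: mult_ac)
  qed
  hence "eqv (\<Sum>(i, j)\<in>{..d} \<times> {..d} - ?A. ?t i j) 0" by (rule F_eqv_0)
  thus ?thesis using eqv_add[OF eqv_refl, of _ 0 "E (u + v)"] eqv_sym by (simp add: eq)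
qed

lemma E_minus: "u \<in> F 1 \<Longrightarrow> eqv (E u * E (- u)) 1"
  using E_add[of u "- u"] F_minus eqv_sym by simp

text \<open>\<open>R = exp \<circ> ln\<close>, both truncated, satisfies \<open>(1 + t) R' \<equiv> R\<close> modulo \<open>t\<^sup>d\<close>; comparing coefficients
  gives \<open>R \<equiv> 1 + t\<close> modulo \<open>t\<^bsup>d+1\<^esup>\<close>.\<close>

lemma E_L_poly: "\<exists>q. \<forall>z. E (L z) = 1 + z + z ^ Suc d * poly q z"
proof -
  define EP :: "'b poly" where "EP = (\<Sum>i\<le>d. monom (\<kappa> (1 / fact i)) i)"
  define LP :: "'b poly" where "LP = (\<Sum>i=1..d. monom (\<kappa> ((-1) ^ (i - 1) / of_nat i)) i)"
  define R where "R = pcompose EP LP"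
  let ?X = "[:0, 1:] :: 'b poly"
  have EP: "poly EP z = E z" and LP: "poly LP z = L z" for z
    by (simp_all add: EP_def LP_def E_def L_def poly_sum poly_monom)
  have cEP: "coeff EP n = (if n \<le> d then \<kappa> (1 / fact n) else 0)" for n
    by (simp add: EP_def coeff_sum sum.delta)
  have cLP: "coeff LP n = (if 1 \<le> n \<and> n \<le> d then \<kappa> ((-1) ^ (n - 1) / of_nat n) else 0)" for n
    by (simp add: LP_def coeff_sum sum.delta)
  have dEP: "pderiv EP = EP - monom (\<kappa> (1 / fact d)) d"
  proof (rule poly_eqI)
    fix n
    have "of_nat (Suc n) * \<kappa> (1 / fact (Suc n)) = \<kappa> (of_nat (Suc n) * (1 / fact (Suc n)))"
      by (simp only: \<kappa>_mult \<kappa>_of_nat)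
    also have "of_nat (Suc n) * (1 / fact (Suc n)) = (1 / fact n :: 'a)"
      by (simp del: of_nat_Suc)
    finally show "coeff (pderiv EP) n = coeff (EP - monom (\<kappa> (1 / fact d)) d) n"
      by (auto simp: coeff_pderiv cEP simp del: of_nat_Suc fact_Suc)
  qed
  have dLP: "pderiv LP = (\<Sum>i<d. (- ?X) ^ i)"
  proof (rule poly_eqI)
    fix n
    have X: "(- ?X) ^ i = monom ((-1) ^ i) i" for i
      by (induction i) (auto simp: monom_Suc mult.commute minus_monom)
    have "of_nat (Suc n) * \<kappa> ((-1) ^ n / of_nat (Suc n)) = \<kappa> (of_nat (Suc n) * ((-1) ^ n / of_nat (Suc n)))"
      by (simp only: \<kappa>_mult \<kappa>_of_nat)
    also have "of_nat (Suc n) * ((-1) ^ n / of_nat (Suc n)) = ((-1) ^ n :: 'a)"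
      by (simp del: of_nat_Suc)
    also have "\<kappa> ((-1) ^ n) = (-1) ^ n" by (simp add: \<kappa>_power \<kappa>_minus \<kappa>_1)
    finally show "coeff (pderiv LP) n = coeff (\<Sum>i<d. (- ?X) ^ i) n"
      unfolding X by (auto simp: coeff_pderiv cLP coeff_sum sum.delta simp del: of_nat_Suc)
  qed
  have geom: "[:1, 1:] * pderiv LP = 1 - (- ?X) ^ d"
  proof -
    have "(1 - (- ?X)) = [:1, 1:]" by (simp add: one_pCons)
    thus ?thesis unfolding dLP one_diff_power_eq by simp
  qed
  have "pderiv R = pcompose (pderiv EP) LP * pderiv LP"
    unfolding R_def by (rule pderiv_pcompose)
  also have "pcompose (pderiv EP) LP = R - smult (\<kappa> (1 / fact d)) (LP ^ d)"
  proof -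
    have "pcompose (monom c n) LP = smult c (LP ^ n)" for c n
      by (induction n) (simp_all add: monom_0 monom_Suc pcompose_pCons)
    thus ?thesis by (simp add: dEP R_def pcompose_diff)
  qed
  finally have "[:1, 1:] * pderiv R = (R - smult (\<kappa> (1 / fact d)) (LP ^ d)) * ([:1, 1:] * pderiv LP)"
    by (simp only: mult.left_commute)
  hence "[:1, 1:] * pderiv R = (R - smult (\<kappa> (1 / fact d)) (LP ^ d)) * (1 - (- ?X) ^ d)"
    by (simp only: geom)
  hence R': "[:1, 1:] * pderiv R - R =
      - (smult (\<kappa> (1 / fact d)) (LP ^ d) * (1 - (- ?X) ^ d)) - R * (- ?X) ^ d"
    by (simp add: algebra_simps)
  \<comment> \<open>Both error terms contain a d-th power of a polynomial without constant term, so
    the differential equation holds modulo the d-th power of the variable.\<close>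
  have "?X dvd LP"
    using cLP[of 0] by (simp add: dvd_iff_poly_eq_0 poly_0_coeff_0 flip: minus_pCons)
  hence "?X ^ d dvd LP ^ d" by (rule dvd_power_same)
  moreover have "?X ^ d dvd (- ?X) ^ d" by (rule dvd_power_same) (simp only: dvd_minus_iff dvd_refl)
  ultimately have "?X ^ d dvd [:1, 1:] * pderiv R - R"
    unfolding R' by (intro dvd_diff) (auto intro: dvd_smult simp: dvd_mult dvd_mult2)
  hence rec: "coeff ([:1, 1:] * pderiv R) n = coeff R n" if "n < d" for n
    using that by (simp add: monom_1_dvd_iff' flip: monom_altdef[of 1, simplified])
  have R0: "coeff R 0 = 1"
    by (simp add: R_def coeff_pcompose_0 poly_0_coeff_0[symmetric] EP LP)
       (simp add: poly_0_coeff_0 cLP cEP \<kappa>_1 flip: LP EP)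
  \<comment> \<open>The factor \<open>1 - of_nat n\<close> vanishes at \<open>n = 1\<close>: the
    coefficient of degree 2 is killed, and with it all later ones up to degree
    \<open>d\<close>.\<close>
  have step: "of_nat (Suc n) * coeff R (Suc n) = (1 - of_nat n) * coeff R n" if "n < d" for n
  proof -
    have "of_nat (Suc n) * coeff R (Suc n) + of_nat n * coeff R n = coeff R n"
      using rec[OF that] by (cases n) (simp_all add: coeff_pderiv del: of_nat_Suc)
    thus ?thesis by (simp add: left_diff_distrib eq_diff_eq del: of_nat_Suc)
  qed
  have R1: "coeff R 1 = 1"
    using step[of 0] R0 d_ge_2 by simp
  have "coeff R (Suc (Suc n)) = 0" if "Suc (Suc n) \<le> d" for n
    using that
  proof (induction n)
    case 0
    thus ?case using step[of 1] of_nat_Suc_neq_0[of 1] by (simp add: numeral_2_eq_2)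
  next
    case (Suc n)
    hence "of_nat (Suc (Suc (Suc n))) * coeff R (Suc (Suc (Suc n))) = 0"
      using step[of "Suc (Suc n)"] by simp
    thus ?case using of_nat_Suc_neq_0 mult_eq_0_iff by blast
  qed
  hence "coeff (R - [:1, 1:]) n = 0" if "n < Suc d" for n
    using that R0 R1 by (cases n; cases "n - 1") auto
  hence "monom 1 (Suc d) dvd R - [:1, 1:]"
    by (simp add: monom_1_dvd_iff')
  then obtain q where q: "R - [:1, 1:] = monom 1 (Suc d) * q" by (elim dvdE)
  have "E (L z) = 1 + z + z ^ Suc d * poly q z" for z
  proof -
    have "E (L z) = poly R z" by (simp add: R_def poly_pcompose EP LP)
    also have "R = [:1, 1:] + monom 1 (Suc d) * q" using q by (simp add: algebra_simps)
    finally show ?thesis by (simp add: poly_monom)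
  qed
  thus ?thesis by blast
qed

lemma E_L:
  assumes "z \<in> F 1"
  shows "eqv (E (L z)) (1 + z)"
proof -
  obtain q where q: "E (L z) = 1 + z + z ^ Suc d * poly q z" using E_L_poly by blast
  have "eqv (z ^ Suc d * poly q z) 0" by (intro F_eqv_0 F_mult_right F_power assms)
  thus ?thesis using eqv_add[OF eqv_refl, of _ 0 "1 + z"] by (simp add: q)
qed

text \<open>For \<open>w = u - v\<close> the series gives \<open>E w = 1 + w * y\<close> with
  \<open>eps y = 1\<close>. Since \<open>E w\<close> is congruent to 1, so is \<open>w * y\<close>
  to 0, and the unit \<open>y\<close> cancels.\<close>

lemma E_inj:
  assumes "u \<in> F 1" "v \<in> F 1" "eqv (E u) (E v)"
  shows "eqv u v"
proof -
  define w where "w = u - v"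
  define y where "y = (\<Sum>i<d. \<kappa> (1 / fact (Suc i)) * w ^ i)"
  have w: "w \<in> F 1" unfolding w_def by (intro F_diff assms)
  have "eqv (E (u + - v)) (E u * E (- v))" by (intro E_add assms F_minus)
  also have "eqv \<dots> (E v * E (- v))" by (intro eqv_mult assms eqv_refl)
  also have "eqv \<dots> 1" by (intro E_minus assms)
  finally have "eqv (E w) 1" by (simp add: w_def)
  moreover have "E w = 1 + w * y"
    unfolding E_def y_def sum.atMost_shift
    by (simp add: \<kappa>_1 sum_distrib_left mult_ac del: fact_Suc)
  ultimately have "eqv (w * y) 0" using eqv_diff[OF _ eqv_refl, of "1 + w * y" 1 1] by simp
  moreover have "eps y = 1"
    unfolding y_def using d_ge_2
    by (simp add: eps_sum eps_scale eps_power eps_F[OF w] power_0_left if_distrib sum.delta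
             del: fact_Suc cong: if_cong)
  ultimately have "eqv w 0" by (rule eqv_unit_cancel)
  thus ?thesis by (simp add: w_def eqv_0_iff)
qed

lemma E_minus_1_in: "u \<in> F 1 \<Longrightarrow> E u - 1 \<in> F 1"
  by (simp add: in_F1_iff eps_diff eps_E)

text \<open>The second inversion formula follows from \<open>E_L\<close> by injectivity of
  \<open>E\<close>, without another computation with series.\<close>

lemma L_E: "u \<in> F 1 \<Longrightarrow> eqv (L (E u - 1)) u"
  using E_inj[OF L_in[OF E_minus_1_in]] E_L[OF E_minus_1_in] by fastforce

section \<open>The invariant form\<close>

text \<open>\<open>G z = z\<^sub>0\<^sup>d \<pi> (ln (1 + z'/z\<^sub>0))\<close> for \<open>z = z\<^sub>0 + z'\<close>.\<close>

definition G :: "'b \<Rightarrow> 'a" where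
  "G z = (\<Sum>i=1..d. (-1) ^ (i - 1) / of_nat i * (eps z ^ (d - i) * \<pi> ((z - \<kappa> (eps z)) ^ i)))"

lemma G_cong: "eqv x y \<Longrightarrow> G x = G y"
proof -
  assume *: "eqv x y"
  hence "eqv ((x - \<kappa> (eps x)) ^ i) ((y - \<kappa> (eps y)) ^ i)" for i
    by (intro eqv_power eqv_diff) (auto simp: eqv_eps)
  hence "\<pi> ((x - \<kappa> (eps x)) ^ i) = \<pi> ((y - \<kappa> (eps y)) ^ i)" for i
    by (rule eqv_\<pi>)
  thus ?thesis unfolding G_def using eqv_eps[OF *] by simp
qed

lemma G_scale: "G (\<kappa> c * z) = c ^ d * G z"
  unfolding G_def sum_distrib_left
proof (intro sum.cong refl)
  fix i assume i: "i \<in> {1..d}"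
  have "\<kappa> c * z - \<kappa> (eps (\<kappa> c * z)) = \<kappa> c * (z - \<kappa> (eps z))"
    by (simp add: eps_scale \<kappa>_mult right_diff_distrib)
  hence "(\<kappa> c * z - \<kappa> (eps (\<kappa> c * z))) ^ i = \<kappa> (c ^ i) * (z - \<kappa> (eps z)) ^ i"
    by (simp add: power_mult_distrib \<kappa>_power)
  moreover have "c ^ d = c ^ (d - i) * c ^ i"
    using i by (simp add: power_add[symmetric])
  ultimately show "(-1) ^ (i - 1) / of_nat i *
      (eps (\<kappa> c * z) ^ (d - i) * \<pi> ((\<kappa> c * z - \<kappa> (eps (\<kappa> c * z))) ^ i)) =
      c ^ d * ((-1) ^ (i - 1) / of_nat i * (eps z ^ (d - i) * \<pi> ((z - \<kappa> (eps z)) ^ i)))"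
    by (simp add: \<pi>_scale eps_scale power_mult_distrib)
qed

lemma G_unit: "eps z = 1 \<Longrightarrow> G z = \<pi> (L (z - 1))"
  unfolding G_def L_def by (simp add: \<kappa>_1 \<pi>_sum \<pi>_scale)

lemma G_max_ideal:
  assumes "eps z = 0"
  shows "G z = (-1) ^ (d - 1) / of_nat d * \<pi> (z ^ d)"
proof -
  have "G z = (\<Sum>i=1..d. if i = d then (-1) ^ (i - 1) / of_nat i * \<pi> (z ^ i) else 0)"
    unfolding G_def by (intro sum.cong refl) (use assms in \<open>auto simp: power_0_left\<close>)
  thus ?thesis using d_ge_2 by simp
qed

lemma G_E_1: "y \<in> F 1 \<Longrightarrow> G (E y) = \<pi> y"
  using eqv_\<pi>[OF L_E] by (simp add: G_unit eps_E)

text \<open>Division by the residue moves \<open>z\<close> into \<open>1 + F 1\<close>, where the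
  logarithm is defined. In terms of \<open>eps z\<close> and \<open>x\<close>, units multiply by
  adding their \<open>x\<close>, and \<open>G\<close> is linear in \<open>x\<close>.\<close>

lemma unit_decomposition:
  assumes "eps z \<noteq> 0"
  obtains x where "x \<in> F 1" "eqv z (\<kappa> (eps z) * E x)" "G z = eps z ^ d * \<pi> x"
proof -
  define z1 where "z1 = \<kappa> (1 / eps z) * z"
  have z: "z = \<kappa> (eps z) * z1"
    using assms by (simp add: z1_def mult.assoc[symmetric] \<kappa>_mult[symmetric] \<kappa>_1)
  have "z1 - 1 \<in> F 1"
    using assms by (simp add: in_F1_iff eps_diff z1_def eps_scale)
  hence x: "L (z1 - 1) \<in> F 1" "eqv z1 (E (L (z1 - 1)))"
    using L_in E_L eqv_sym by force+
  hence eq: "eqv z (\<kappa> (eps z) * E (L (z1 - 1)))"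
    by (subst z) (intro eqv_mult eqv_refl)
  have "G z = eps z ^ d * \<pi> (L (z1 - 1))"
    using G_cong[OF eq] x by (simp add: G_scale G_E_1)
  thus ?thesis using that x eq by blast
qed

text \<open>On units logarithms add up. On the maximal ideal, which has no logarithm, only
  \<open>\<pi> (z ^ d)\<close> counts, and the factor \<open>E x ^ d\<close> acts on
  \<open>z ^ d \<in> F d\<close> like 1. With \<open>\<pi> x = 0\<close> this is the invariance
  under exp U.\<close>

lemma G_E_mult:
  assumes "x \<in> F 1"
  shows "G (E x * z) = G z + eps z ^ d * \<pi> x"
proof (cases "eps z = 0")
  case True
  have "eqv (E x ^ d * z ^ d) (1 * z ^ d)"
  proof (subst eqv_0_iff[symmetric], rule F_eqv_0)
    have "E x ^ d - 1 \<in> F 1" by (simp add: in_F1_iff eps_diff eps_power eps_E[OF assms])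
    moreover have "z ^ d \<in> F d" using True by (intro F_power) (simp add: eps_iff)
    ultimately have "(E x ^ d - 1) * z ^ d \<in> F (1 + d)" by (rule F_mult)
    thus "E x ^ d * z ^ d - 1 * z ^ d \<in> F (Suc d)" by (simp add: algebra_simps)
  qed
  from eqv_\<pi>[OF this] show ?thesis
    using True d_ge_2 by (simp add: G_max_ideal eps_mult power_mult_distrib)
next
  case False
  then obtain y where y: "y \<in> F 1" "eqv z (\<kappa> (eps z) * E y)" "G z = eps z ^ d * \<pi> y"
    by (rule unit_decomposition)
  have "eqv (E x * z) (E x * (\<kappa> (eps z) * E y))" by (intro eqv_mult y eqv_refl)
  also have "E x * (\<kappa> (eps z) * E y) = \<kappa> (eps z) * (E x * E y)" by (simp add: mult_ac)
  also have "eqv \<dots> (\<kappa> (eps z) * E (x + y))"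
    by (intro eqv_mult eqv_refl eqv_sym[OF E_add] assms y)
  finally have "G (E x * z) = eps z ^ d * G (E (x + y))"
    using G_cong G_scale by metis
  thus ?thesis using assms y by (simp add: G_E_1 F_add \<pi>_add algebra_simps)
qed

lemma E_socle: "eqv (E (\<kappa> c * e)) (1 + \<kappa> c * e)"
proof -
  let ?w = "\<kappa> c * e"
  have "eqv (E ?w) (\<Sum>i\<le>d. (if i = 0 then 1 else 0) + (if i = 1 then ?w else 0))"
    unfolding E_def
  proof (rule eqv_sum)
    fix i
    have "eqv ((\<kappa> (1 / fact i) * \<kappa> c ^ i * e ^ (i - 2)) * (e * e)) 0" if "i \<ge> 2"
      using eqv_mult[OF eqv_refl e_square] by simp
    moreover have "e ^ i = e ^ (i - 2) * (e * e)" if "i \<ge> 2"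
      using power_add[of e "i - 2" 2] that by (simp only: le_add_diff_inverse2 power2_eq_square)
    ultimately show "eqv (\<kappa> (1 / fact i) * ?w ^ i) ((if i = 0 then 1 else 0) + (if i = 1 then ?w else 0))"
      by (cases "i \<ge> 2") (auto simp: power_mult_distrib mult.assoc \<kappa>_1 not_le less_2_cases_iff)
  qed
  also have "(\<Sum>i\<le>d. (if i = 0 then 1 else 0) + (if i = 1 then ?w else 0)) = 1 + ?w"
    using d_ge_2 by (simp add: sum.distrib)
  finally show ?thesis .
qed

text \<open>Translation along the socle is a multiplication in disguise: \<open>e * z\<close> is
  congruent to \<open>\<kappa> (eps z) * e\<close>, so adding \<open>\<kappa> c * e\<close> amounts
  to multiplying by \<open>E (\<kappa> (c / eps z) * e)\<close>. Thus \<open>G\<close> has degree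
  one in the socle coordinate.\<close>

lemma G_add_socle:
  assumes "eps z \<noteq> 0"
  shows "G (z + \<kappa> c * e) = G z + eps z ^ (d - 1) * c"
proof -
  let ?c = "\<kappa> (c / eps z)"
  have "eqv (E (?c * e) * z) ((1 + ?c * e) * z)" by (intro eqv_mult E_socle eqv_refl)
  also have "(1 + ?c * e) * z = z + ?c * (e * z)" by (simp add: algebra_simps)
  also have "eqv \<dots> (z + ?c * (\<kappa> (eps z) * e))" by (intro eqv_add eqv_mult eqv_refl e_mult)
  also have "?c * (\<kappa> (eps z) * e) = \<kappa> c * e"
    using assms by (simp add: mult.assoc[symmetric] \<kappa>_mult[symmetric])
  finally have "G (z + \<kappa> c * e) = G (E (?c * e) * z)" using G_cong by simp
  also have "\<dots> = G z + eps z ^ d * (c / eps z)"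
    by (simp add: G_E_mult[OF F_mult_left[OF e_in_1]] \<pi>_scale \<pi>_e)
  also have "eps z ^ d = eps z * eps z ^ (d - 1)"
    using d_ge_2 by (simp add: power_eq_if)
  finally show ?thesis using assms by simp
qed

text \<open>The first-order term of \<open>G\<close> at the unit \<open>E (- x)\<close> in the
  direction \<open>v\<close> is \<open>\<pi> (E x * v)\<close>. So an invariant direction is
  orthogonal to all elements \<open>1 + s\<close> with \<open>s \<in> F 1\<close>, and these
  together with scalars exhaust the algebra.\<close>

lemma G_nondegenerate:
  assumes inv: "\<And>w r. G (w + \<kappa> r * v) = G w"
  shows "eqv v 0"
proof -
  have G0: "G 0 = 0" using d_ge_2 by (simp add: G_max_ideal power_0_left)
  \<comment> \<open>If \<open>v\<close> were a unit, invariance would give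
    \<open>G v = G 0 = 0\<close> and \<open>G (v + e) = G e = 0\<close>, against
    \<open>G_add_socle\<close>. That \<open>G e\<close> vanishes depends on
    \<open>d \<ge> 2\<close>: then \<open>e ^ d\<close> is a multiple of
    \<open>e * e\<close>.\<close>
  have v0: "eps v = 0"
  proof (rule ccontr)
    assume nz: "eps v \<noteq> 0"
    have "G e = 0"
    proof -
      have "e ^ d = e * e * e ^ (d - 2)"
        using d_ge_2 by (simp add: power_eq_if numeral_2_eq_2 mult_ac)
      hence "eqv (e ^ d) 0" using eqv_mult[OF e_square eqv_refl, of "e ^ (d - 2)"] by simp
      thus ?thesis using eqv_\<pi>[of "e ^ d" 0] by (simp add: G_max_ideal eps_F[OF e_in_1])
    qed
    moreover have "G v = 0" using inv[of 0 1] G0 by (simp add: \<kappa>_1)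
    moreover have "G (v + e) = G e" using inv[of e 1] by (simp add: \<kappa>_1 add.commute)
    ultimately show False using G_add_socle[OF nz, of 1] nz by (simp add: \<kappa>_1)
  qed
  \<comment> \<open>\<open>G (1 + \<kappa> r * y)\<close> is a polynomial in \<open>r\<close> whose
    linear coefficient is \<open>\<pi> y\<close>.\<close>
  have \<pi>_vanish: "\<pi> y = 0" if y: "eps y = 0" "\<And>r. G (1 + \<kappa> r * y) = 0" for y
  proof -
    define p where "p = (\<Sum>i=1..d. monom ((-1) ^ (i - 1) / of_nat i * \<pi> (y ^ i)) i)"
    have "poly p r = 0" for r
    proof -
      have "\<kappa> a * (\<kappa> r * y) ^ i = \<kappa> (a * r ^ i) * y ^ i" for a i
        by (simp add: \<kappa>_mult \<kappa>_power power_mult_distrib mult.assoc)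
      hence "poly p r = \<pi> (L (\<kappa> r * y))"
        by (simp add: p_def L_def poly_sum poly_monom \<pi>_sum \<pi>_scale) (simp add: mult_ac)
      thus ?thesis using y(2)[of r] G_unit[of "1 + \<kappa> r * y"] y(1) by (simp add: eps_add eps_scale)
    qed
    hence "p = 0" by (rule poly_eq_0_if_all_roots)
    moreover have "coeff p 1 = \<pi> y"
      using d_ge_2 by (simp add: p_def coeff_sum sum.delta)
    ultimately show ?thesis by simp
  qed
  \<comment> \<open>Factoring out \<open>E x\<close> turns \<open>1 + \<kappa> r * (E x * v)\<close>
    into the translate of \<open>E (- x)\<close> along \<open>v\<close>, to which invariance
    applies.\<close>
  have *: "\<pi> ((1 + s) * v) = 0" if s: "s \<in> F 1" for s
  proof -
    define x where "x = L s"
    have x: "x \<in> F 1" "- x \<in> F 1" using L_in[OF s] F_minus by (auto simp: x_def)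
    have "G (1 + \<kappa> r * (E x * v)) = 0" for r
    proof -
      have "eqv (1 + \<kappa> r * (E x * v)) (E x * E (- x) + \<kappa> r * (E x * v))"
        by (intro eqv_add eqv_refl eqv_sym[OF E_minus] x)
      hence "G (1 + \<kappa> r * (E x * v)) = G (E x * (E (- x) + \<kappa> r * v))"
        using G_cong by (simp add: algebra_simps)
      also have "\<dots> = G (E (- x)) + \<pi> x"
        using x v0 by (simp add: G_E_mult inv eps_add eps_scale eps_E)
      finally show ?thesis using x by (simp add: G_E_1 \<pi>_minus)
    qed
    hence "\<pi> (E x * v) = 0" by (intro \<pi>_vanish) (simp_all add: eps_mult v0)
    moreover have "eqv (E x * v) ((1 + s) * v)"
      unfolding x_def by (intro eqv_mult E_L eqv_refl s)
    ultimately show ?thesis using eqv_\<pi> by simp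
  qed
  show ?thesis unfolding eqv_def
  proof
    fix w
    have "\<pi> v = 0" using *[of 0] F_zero by simp
    moreover have "\<pi> ((1 + (w - \<kappa> (eps w))) * v) = 0" by (rule *[OF residue'])
    ultimately have "\<pi> (w * v) = 0" by (simp add: distrib_right left_diff_distrib \<pi>_add \<pi>_diff \<pi>_scale)
    thus "\<pi> (v * w) = \<pi> (0 * w)" by (simp add: mult.commute)
  qed
qed

end

section \<open>Projective points and linear changes of coordinates\<close>

definition proj_pt :: "'a::field vec \<Rightarrow> 'a vec set" where
  "proj_pt x = {c \<cdot>\<^sub>v x | c. c \<noteq> 0}"

lemma proj_pt_self: "x \<in> proj_pt x"
  unfolding proj_pt_def by (rule CollectI, rule exI[of _ 1]) simp

lemma proj_pt_smult:
  assumes "c \<noteq> 0"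
  shows "proj_pt (c \<cdot>\<^sub>v x) = proj_pt x"
proof -
  have "\<exists>b'. b \<cdot>\<^sub>v (c \<cdot>\<^sub>v x) = b' \<cdot>\<^sub>v x \<and> b' \<noteq> 0" if "b \<noteq> 0" for b
    using that assms by (intro exI[of _ "b * c"]) (simp add: smult_smult_assoc)
  moreover have "\<exists>b'. b \<cdot>\<^sub>v x = b' \<cdot>\<^sub>v (c \<cdot>\<^sub>v x) \<and> b' \<noteq> 0" if "b \<noteq> 0" for b
    using that assms by (intro exI[of _ "b / c"]) (simp add: smult_smult_assoc)
  ultimately show ?thesis unfolding proj_pt_def by blast
qed

lemma proj_pt_eq_iff: "proj_pt x = proj_pt y \<longleftrightarrow> (\<exists>c. c \<noteq> 0 \<and> y = c \<cdot>\<^sub>v x)"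
proof
  assume "proj_pt x = proj_pt y"
  with proj_pt_self[of y] have "y \<in> proj_pt x" by simp
  thus "\<exists>c. c \<noteq> 0 \<and> y = c \<cdot>\<^sub>v x" unfolding proj_pt_def by blast
qed (auto simp: proj_pt_smult)

lemma smult_vec_nonzero:
  assumes "x \<in> carrier_vec N" "x \<noteq> 0\<^sub>v N" "c \<noteq> (0::'a::field)"
  shows "c \<cdot>\<^sub>v x \<noteq> 0\<^sub>v N"
proof
  assume "c \<cdot>\<^sub>v x = 0\<^sub>v N"
  hence "(1 / c) \<cdot>\<^sub>v (c \<cdot>\<^sub>v x) = (1 / c) \<cdot>\<^sub>v 0\<^sub>v N" by simp
  moreover have "(1 / c) \<cdot>\<^sub>v 0\<^sub>v N = 0\<^sub>v N" by (auto simp: vec_eq_iff)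
  ultimately show False using assms by (simp add: smult_smult_assoc)
qed

lemma proj_space_iff:
  "p \<in> proj_space N \<longleftrightarrow> (\<exists>x. x \<in> carrier_vec (Suc N) \<and> x \<noteq> 0\<^sub>v (Suc N) \<and> p = proj_pt x)"
proof -
  have "proj_rel N `` {x} = proj_pt x" if "x \<in> carrier_vec (Suc N)" "x \<noteq> 0\<^sub>v (Suc N)" for x :: "'a vec"
    using that smult_vec_nonzero[OF that] by (auto simp: proj_rel_def proj_pt_def)
  thus ?thesis unfolding proj_space_def quotient_def by auto
qed

lemma proj_pt_in_proj_space:
  "x \<in> carrier_vec (Suc N) \<Longrightarrow> x \<noteq> 0\<^sub>v (Suc N) \<Longrightarrow> proj_pt x \<in> proj_space N"
  using proj_space_iff by blast

lemma proj_space_memD: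
  assumes "p \<in> proj_space N" "x \<in> p"
  shows "x \<in> carrier_vec (Suc N)" "x \<noteq> 0\<^sub>v (Suc N)" "p = proj_pt x"
proof -
  obtain y where y: "y \<in> carrier_vec (Suc N)" "y \<noteq> 0\<^sub>v (Suc N)" "p = proj_pt y"
    using assms(1) proj_space_iff by blast
  then obtain c where c: "c \<noteq> 0" "x = c \<cdot>\<^sub>v y" using assms(2) by (auto simp: proj_pt_def)
  thus "x \<in> carrier_vec (Suc N)" "x \<noteq> 0\<^sub>v (Suc N)" "p = proj_pt x"
    using y smult_vec_nonzero[OF y(1,2) c(1)] proj_pt_smult[OF c(1)] by simp_all
qed

lemma proj_pt_in_zero_locus_iff:
  assumes "f \<in> forms (Suc N) d" "x \<in> carrier_vec (Suc N)" "x \<noteq> 0\<^sub>v (Suc N)"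
  shows "proj_pt x \<in> zero_locus N f \<longleftrightarrow> peval f x = 0"
proof -
  have "peval f y = 0" if "peval f x = 0" "y \<in> proj_pt x" for y
    using that assms peval_form_smult[OF assms(1,2)] by (auto simp: proj_pt_def)
  thus ?thesis
    using proj_pt_in_proj_space[OF assms(2,3)] proj_pt_self[of x] by (auto simp: zero_locus_def)
qed

lemma zero_locus_subset: "zero_locus N f \<subseteq> proj_space N"
  by (auto simp: zero_locus_def)

lemma zariski_closed_zero_locus:
  assumes "f \<in> forms (Suc N) d"
  shows "zariski_closed N (zero_locus N f)"
  unfolding zariski_closed_def using assms zero_locus_subset
  by (intro exI[of _ "{f}"]) (auto intro: subsetD[OF zero_locus_subset])

lemma hyperplane0_zero_locus:
  "hyperplane0 N = zero_locus N (Poly_Mapping.single (Poly_Mapping.single 0 1) 1)"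
  by (simp add: hyperplane0_def zero_locus_def)

lemma coord_in_forms: "i < r \<Longrightarrow> Poly_Mapping.single (Poly_Mapping.single i 1) 1 \<in> forms r 1"
  using part_forms_coord[of i 0 r 1] by simp

lemma proj_pt_in_hyperplane0_iff:
  assumes "x \<in> carrier_vec (Suc N)" "x \<noteq> 0\<^sub>v (Suc N)"
  shows "proj_pt x \<in> hyperplane0 N \<longleftrightarrow> x $ 0 = 0"
  unfolding hyperplane0_zero_locus
  using proj_pt_in_zero_locus_iff[OF coord_in_forms[of 0] assms] by simp

lemma vCons_smult: "c \<cdot>\<^sub>v vCons (0::'a::comm_ring_1) y = vCons 0 (c \<cdot>\<^sub>v y)"
  by (auto simp: vec_eq_iff vCons_def split: nat.split)

lemma hyperplane0_emb_proj_pt: "hyperplane0_emb (proj_pt y) = proj_pt (vCons 0 y)"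
  unfolding hyperplane0_emb_def proj_pt_def by (auto simp: vCons_smult)

lemma GL_inverse:
  assumes "A \<in> GL n"
  obtains B where "B \<in> carrier_mat n n" "A * B = 1\<^sub>m n" "B * A = 1\<^sub>m n"
proof -
  have A: "A \<in> carrier_mat n n" "invertible_mat A" using assms by (auto simp: GL_def)
  then obtain B where B: "inverts_mat A B" "inverts_mat B A" by (auto simp: invertible_mat_def)
  have 1: "A * B = 1\<^sub>m n" using B(1) A(1) by (simp add: inverts_mat_def)
  have 2: "B * A = 1\<^sub>m (dim_row B)" using B(2) by (simp add: inverts_mat_def)
  have "dim_col B = n" using arg_cong[OF 1, of dim_col] by simp
  moreover have "dim_row B = n" using arg_cong[OF 2, of dim_col] A(1) by simp
  ultimately show ?thesis using that[of B] 1 2 by auto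
qed

text \<open>If variable \<open>j\<close> disappears under the substitution \<open>A\<close>, then
  \<open>f\<close> is invariant under translation along the j-th column of \<open>A\<close>, which
  is nonzero.\<close>

lemma nondegenerate_formI:
  fixes f :: "'a::field_char_0 mpoly"
  assumes "vars f \<subseteq> {..<n}"
    and inv: "\<And>v. v \<in> carrier_vec n \<Longrightarrow>
      (\<And>w r. w \<in> carrier_vec n \<Longrightarrow> peval f (w + r \<cdot>\<^sub>v v) = peval f w) \<Longrightarrow> v = 0\<^sub>v n"
    and A: "A \<in> GL n"
  shows "\<not> card (vars (lin_subst A f)) < n"
proof
  assume lt: "card (vars (lin_subst A f)) < n"
  have carr: "A \<in> carrier_mat n n" using A by (simp add: GL_def)
  have sub: "vars (lin_subst A f) \<subseteq> {..<n}" using vars_lin_subst[of A f] carr by simp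
  have "vars (lin_subst A f) \<noteq> {..<n}" using lt by (metis card_lessThan less_irrefl)
  with sub obtain j where j: "j < n" "j \<notin> vars (lin_subst A f)" by auto
  obtain B where B: "B \<in> carrier_mat n n" "A * B = 1\<^sub>m n" "B * A = 1\<^sub>m n"
    using GL_inverse[OF A] .
  let ?v = "A *\<^sub>v unit_vec n j"
  have "peval f (w + r \<cdot>\<^sub>v ?v) = peval f w" if w: "w \<in> carrier_vec n" for w r
  proof -
    have Bw: "B *\<^sub>v w \<in> carrier_vec n" using B(1) w by auto
    have w_eq: "w = A *\<^sub>v (B *\<^sub>v w)"
      using assoc_mult_mat_vec[OF carr B(1) w] B(2) w by simp
    have "w + r \<cdot>\<^sub>v ?v = A *\<^sub>v (B *\<^sub>v w + r \<cdot>\<^sub>v unit_vec n j)"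
      using w_eq mult_add_distrib_mat_vec[OF carr Bw, of "r \<cdot>\<^sub>v unit_vec n j"]
        mult_mat_vec[OF carr, of "unit_vec n j" r] by simp
    hence "peval f (w + r \<cdot>\<^sub>v ?v) = peval (lin_subst A f) (B *\<^sub>v w + r \<cdot>\<^sub>v unit_vec n j)"
      using assms(1) carr Bw by (subst peval_lin_subst) auto
    also have "\<dots> = peval (lin_subst A f) (B *\<^sub>v w)"
      unfolding peval_def
    proof (intro sum.cong refl, intro arg_cong2[where f = times] refl prod.cong)
      fix \<mu> i assume "\<mu> \<in> Poly_Mapping.keys (lin_subst A f)" "i \<in> Poly_Mapping.keys \<mu>"
      hence "i \<in> vars (lin_subst A f)" by (auto simp: vars_def)
      hence "i < n" "i \<noteq> j" using sub j by auto
      thus "(B *\<^sub>v w + r \<cdot>\<^sub>v unit_vec n j) $ i ^ Poly_Mapping.lookup \<mu> i =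
          (B *\<^sub>v w) $ i ^ Poly_Mapping.lookup \<mu> i"
        using j(1) by (simp add: unit_vec_def)
    qed
    also have "\<dots> = peval f w"
      using assms(1) carr Bw w_eq by (subst peval_lin_subst) auto
    finally show ?thesis .
  qed
  hence "?v = 0\<^sub>v n" using inv[of ?v] carr by auto
  hence "B *\<^sub>v ?v = 0\<^sub>v n" using B(1) by auto
  moreover have "B *\<^sub>v ?v = unit_vec n j"
    using assoc_mult_mat_vec[OF B(1) carr, of "unit_vec n j"] B(3) by simp
  ultimately have "unit_vec n j $ j = (0::'a)" using j(1) by simp
  thus False using j(1) by simp
qed

text \<open>An invertible matrix with first column \<open>v\<close> turns translation along
  \<open>v\<close> into a shift of variable 0, which therefore does not occur after the
  substitution.\<close>

lemma nondegenerate_formD: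
  fixes f :: "'a::field_char_0 mpoly"
  assumes "vars f \<subseteq> {..<n}"
    and nondeg: "\<And>A. A \<in> GL n \<Longrightarrow> \<not> card (vars (lin_subst A f)) < n"
    and v: "v \<in> carrier_vec n"
    and inv: "\<And>w r. w \<in> carrier_vec n \<Longrightarrow> peval f (w + r \<cdot>\<^sub>v v) = peval f w"
  shows "v = 0\<^sub>v n"
proof (rule ccontr)
  assume "v \<noteq> 0\<^sub>v n"
  then obtain l where l: "l < n" "v $ l \<noteq> 0" using v by (auto simp: vec_eq_iff)
  \<comment> \<open>The functional \<open>x $ l / v $ l\<close> takes the value 1 at
    \<open>v\<close>, so \<open>v\<close> extends to the columns of an invertible matrix.\<close>
  have bo: "biorthogonal (\<lambda>x y. \<Sum>i<n. x i * y i) 1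
    (\<lambda>_ i. if i = l then 1 / v $ l else 0) (\<lambda>_ i. v $ i)"
    using l by (simp add: biorthogonal_def if_distrib[of "\<lambda>x. x * _"] sum.delta cong: if_cong)
  obtain A B :: "'a mat" where AB: "1 \<le> n" "A \<in> GL n" "B \<in> GL n"
    and B0: "\<And>i j. i < 1 \<Longrightarrow> j < n \<Longrightarrow> B $$ (j, i) = v $ j"
    by (rule biorthogonal_extend_GL[OF bo]) (rule that; simp)
  have carr: "B \<in> carrier_mat n n" using AB by (simp add: GL_def)
  have Bv: "B *\<^sub>v unit_vec n 0 = v"
    using carr v B0 AB(1) by (intro eq_vecI) (auto simp: scalar_prod_right_unit)
  have "0 \<notin> vars (lin_subst B f)"
  proof (rule not_in_vars_if_peval_indep[of _ n])
    show "vars (lin_subst B f) \<subseteq> {..<n}" using vars_lin_subst[of B f] carr by simp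
    show "0 < n" using AB(1) by simp
    fix w :: "'a vec" and r assume w: "w \<in> carrier_vec n"
    have "B *\<^sub>v (w + r \<cdot>\<^sub>v unit_vec n 0) = B *\<^sub>v w + r \<cdot>\<^sub>v v"
      using mult_add_distrib_mat_vec[OF carr w, of "r \<cdot>\<^sub>v unit_vec n 0"]
        mult_mat_vec[OF carr, of "unit_vec n 0" r] Bv by simp
    thus "peval (lin_subst B f) (w + r \<cdot>\<^sub>v unit_vec n 0) = peval (lin_subst B f) w"
      using assms(1) carr w inv[of "B *\<^sub>v w" r] by (simp add: peval_lin_subst)
  qed
  hence "vars (lin_subst B f) \<subseteq> {..<n} - {0}" using vars_lin_subst[of B f] carr by auto
  hence "card (vars (lin_subst B f)) \<le> card ({..<n} - {0})" by (intro card_mono) auto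
  also have "\<dots> < n" using AB(1) by simp
  finally show False using nondeg[OF AB(3)] by simp
qed

section \<open>Linear actions on projective space\<close>

text \<open>A linear lift of an action on projective space: \<open>act_form\<close> makes the
  coordinates of \<open>act t x\<close> polynomial in \<open>t\<close> and linear in
  \<open>x\<close>.\<close>

locale projective_flow =
  fixes m n :: nat and act :: "'a::field vec \<Rightarrow> 'a vec \<Rightarrow> 'a vec"
  assumes act_carrier: "t \<in> carrier_vec m \<Longrightarrow> x \<in> carrier_vec (Suc n) \<Longrightarrow> act t x \<in> carrier_vec (Suc n)"
    and act_zero: "x \<in> carrier_vec (Suc n) \<Longrightarrow> act (0\<^sub>v m) x = x"
    and act_add: "t \<in> carrier_vec m \<Longrightarrow> t' \<in> carrier_vec m \<Longrightarrow> x \<in> carrier_vec (Suc n) \<Longrightarrow>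
      act (t + t') x = act t (act t' x)"
    and act_smult: "t \<in> carrier_vec m \<Longrightarrow> x \<in> carrier_vec (Suc n) \<Longrightarrow> act t (c \<cdot>\<^sub>v x) = c \<cdot>\<^sub>v act t x"
    and act_form: "i < Suc n \<Longrightarrow>
      form_fun m (Suc n) 1 (\<lambda>v. act (vec_first v m) (vec_last v (Suc n)) $ i)"
begin

text \<open>\<open>restrict\<close>, because the elements of \<open>BijGroup X\<close> are
  extensional. The parameter \<open>X\<close> allows both the hypersurface and the whole projective
  space.\<close>

definition flow :: "'a vec set set \<Rightarrow> 'a vec \<Rightarrow> 'a vec set \<Rightarrow> 'a vec set" where
  "flow X t = restrict (\<lambda>p. act t ` p) X"

lemma act_uminus:
  "t \<in> carrier_vec m \<Longrightarrow> x \<in> carrier_vec (Suc n) \<Longrightarrow> act (- t) (act t x) = x"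
  using act_add[of "- t" t x] act_zero[of x] by (simp add: uminus_l_inv_vec)

lemma act_nonzero:
  assumes "t \<in> carrier_vec m" "x \<in> carrier_vec (Suc n)" "x \<noteq> 0\<^sub>v (Suc n)"
  shows "act t x \<noteq> 0\<^sub>v (Suc n)"
proof
  assume eq: "act t x = 0\<^sub>v (Suc n)"
  have zero: "0 \<cdot>\<^sub>v 0\<^sub>v (Suc n) = (0\<^sub>v (Suc n) :: 'a vec)" by auto
  hence "x = act (- t) (0 \<cdot>\<^sub>v 0\<^sub>v (Suc n))" using act_uminus[OF assms(1,2)] by (simp only: zero eq)
  also have "\<dots> = 0 \<cdot>\<^sub>v act (- t) (0\<^sub>v (Suc n))" using assms(1) by (intro act_smult) auto
  also have "\<dots> = 0\<^sub>v (Suc n)"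
    using act_carrier[of "- t" "0\<^sub>v (Suc n)"] assms(1) by auto
  finally show False using assms(3) by simp
qed

lemma act_proj_pt:
  "t \<in> carrier_vec m \<Longrightarrow> x \<in> carrier_vec (Suc n) \<Longrightarrow> act t ` proj_pt x = proj_pt (act t x)"
  unfolding proj_pt_def by (auto simp: act_smult) (metis (mono_tags, lifting) act_smult image_eqI mem_Collect_eq)

lemma regular_action_flow:
  assumes sub: "X \<subseteq> proj_space n"
    and inv: "\<And>t p. t \<in> carrier_vec m \<Longrightarrow> p \<in> X \<Longrightarrow> act t ` p \<in> X"
  shows "regular_action m n X (flow X)"
  unfolding regular_action_def
proof
  have comp: "act t ` (act t' ` p) = act (t + t') ` p"
    if "t \<in> carrier_vec m" "t' \<in> carrier_vec m" "p \<in> X" for t t' p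
    using that act_add[OF that(1,2)] proj_space_memD(1)[of p n] sub by (force simp: image_image)
  have zero: "act (0\<^sub>v m) ` p = p" if "p \<in> X" for p
  proof -
    have "act (0\<^sub>v m) x = x" if "x \<in> p" for x
      using \<open>p \<in> X\<close> that sub proj_space_memD(1)[of p n x] by (intro act_zero) auto
    thus ?thesis by simp
  qed
  have bij: "flow X t \<in> Bij X" if t: "t \<in> carrier_vec m" for t
  proof -
    have t': "- t \<in> carrier_vec m" "t + - t = 0\<^sub>v m" "- t + t = 0\<^sub>v m"
      using t by (auto simp: uminus_r_inv_vec uminus_l_inv_vec)
    have "bij_betw (flow X t) X X"
      by (rule bij_betw_byWitness[of _ "flow X (- t)"])
         (use t t' in \<open>auto simp: flow_def inv comp zero\<close>)
    thus ?thesis by (simp add: Bij_def flow_def)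
  qed
  show "group_action (monoid_vec TYPE('a) m) X (flow X)"
    unfolding group_action_def group_hom_def group_hom_axioms_def
  proof (intro conjI)
    show "group (monoid_vec TYPE('a) m)" using comm_group_vec comm_group.axioms(2) by blast
    show "group (BijGroup X)" by (rule group_BijGroup)
    show "flow X \<in> hom (monoid_vec TYPE('a) m) (BijGroup X)"
    proof (rule homI)
      fix t t' :: "'a vec"
      assume "t \<in> carrier (monoid_vec TYPE('a) m)" "t' \<in> carrier (monoid_vec TYPE('a) m)"
      hence t: "t \<in> carrier_vec m" "t' \<in> carrier_vec m" by (auto simp: monoid_vec_simps)
      have "flow X (t + t') = compose X (flow X t) (flow X t')"
        by (rule ext) (use t in \<open>auto simp: flow_def compose_def comp inv\<close>)
      thus "flow X (t \<otimes>\<^bsub>monoid_vec TYPE('a) m\<^esub> t') = flow X t \<otimes>\<^bsub>BijGroup X\<^esub> flow X t'"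
        using bij t by (simp add: monoid_vec_simps BijGroup_def)
    qed (use bij in \<open>auto simp: monoid_vec_simps BijGroup_def\<close>)
  qed
  show "regular_map m n (carrier_vec m \<times> X) n (\<lambda>(t, p). flow X t p)"
    unfolding regular_map_def
  proof (intro conjI)
    show "(\<lambda>(t, p). flow X t p) ` (carrier_vec m \<times> X) \<subseteq> proj_space n"
      using inv sub by (auto simp: flow_def)
    have "\<exists>f. f \<in> part_forms m (Suc n) 1 \<and>
      (\<forall>v\<in>carrier_vec (m + Suc n). peval f v = act (vec_first v m) (vec_last v (Suc n)) $ i)"
      if "i < Suc n" for i using act_form[OF that] unfolding form_fun_def by blast
    then obtain Fi where Fi: "\<And>i. i < Suc n \<Longrightarrow> Fi i \<in> part_forms m (Suc n) 1"
      "\<And>i v. i < Suc n \<Longrightarrow> v \<in> carrier_vec (m + Suc n) \<Longrightarrow>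
         peval (Fi i) v = act (vec_first v m) (vec_last v (Suc n)) $ i"
      by metis
    have val: "vec (Suc n) (\<lambda>i. peval (Fi i) (t @\<^sub>v x)) \<in> flow X t p"
      if "t \<in> carrier_vec m" "p \<in> X" "x \<in> p" for t p x
    proof -
      have x: "x \<in> carrier_vec (Suc n)" using that sub proj_space_memD(1)[of p n x] by auto
      have first: "vec_first (t @\<^sub>v x) m = t" and last: "vec_last (t @\<^sub>v x) (Suc n) = x"
        using that(1) x by (auto simp: vec_first_def vec_last_def)
      have "vec (Suc n) (\<lambda>i. peval (Fi i) (t @\<^sub>v x)) = act t x"
        using Fi(2) that(1) x act_carrier[OF that(1) x] append_carrier_vec[OF that(1) x]
        by (intro eq_vecI) (auto simp: first last)
      thus ?thesis using that by (simp add: flow_def)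
    qed
    \<comment> \<open>One global chart suffices: \<open>h = 1\<close> of degree 0, with the linear
      forms \<open>Fi\<close> as coordinates.\<close>
    show "\<forall>(t0, p0)\<in>carrier_vec m \<times> X. \<exists>e d h F.
        h \<in> part_forms m (Suc n) e \<and> (\<forall>i\<le>n. F i \<in> part_forms m (Suc n) d) \<and>
        (\<forall>x\<in>p0. peval h (t0 @\<^sub>v x) \<noteq> 0) \<and>
        (\<forall>(t, p)\<in>carrier_vec m \<times> X. \<forall>x\<in>p. peval h (t @\<^sub>v x) \<noteq> 0 \<longrightarrow>
           vec (Suc n) (\<lambda>i. peval (F i) (t @\<^sub>v x)) \<in> (case (t, p) of (t, p) \<Rightarrow> flow X t p))"
      using Fi(1) val part_forms_const[of "1::'a" m "Suc n"]
      by (intro ballI, clarify)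
         (rule exI[of _ 0], rule exI[of _ 1], rule exI[of _ "Poly_Mapping.single 0 1"], rule exI[of _ Fi],
          auto simp del: single_one)
  qed
qed

end

text \<open>A polynomial agrees with its restriction to \<open>x\<^sub>0 = 0\<close> up to a
  multiple of \<open>x\<^sub>0\<close>. The quotient must itself be polynomial, so it is built along
  the structure of \<open>q\<close>.\<close>

lemma poly_fun_split_coord0:
  assumes "poly_fun N q" "0 < N"
  shows "\<exists>q1. poly_fun N q1 \<and>
    (\<forall>x\<in>carrier_vec N. q x = q (vec N (\<lambda>i. if i = 0 then 0 else x $ i)) + x $ 0 * q1 x)"
proof -
  let ?z = "\<lambda>x :: 'a vec. vec N (\<lambda>i. if i = 0 then 0 else x $ i)"
  define S where "S q q1 \<longleftrightarrow> (\<forall>x\<in>carrier_vec N. q x = q (?z x) + x $ 0 * q1 x)"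
    for q q1 :: "'a vec \<Rightarrow> 'a"
  have coord: "poly_fun N (\<lambda>x :: 'a vec. if i = 0 then 0 else x $ i)" if "i < N" for i
    using that by (cases "i = 0") (auto intro: form_fun_0 form_fun_coord_low)
  \<comment> \<open>Polynomiality of \<open>q\<close> is carried through the induction because the
    product case needs it for the factors.\<close>
  have "poly_fun N q \<and> (\<exists>q1. poly_fun N q1 \<and> S q q1)"
    using assms(1)
  proof (induction rule: poly_fun_induct)
    case (cong p q)
    then obtain p1 where p1: "poly_fun N p" "poly_fun N p1" "S p p1" by blast
    have "S q p1" unfolding S_def
    proof
      fix x :: "'a vec" assume x: "x \<in> carrier_vec N"
      have "p x = p (?z x) + x $ 0 * p1 x" using p1(3) x unfolding S_def by blast
      thus "q x = q (?z x) + x $ 0 * p1 x" using cong(2)[OF x] cong(2)[of "?z x"] by (metis vec_carrier)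
    qed
    moreover have "poly_fun N q" by (rule form_fun_cong[OF p1(1)]) (use cong(2) in simp)
    ultimately show ?case using p1(2) by blast
  next
    case (const c)
    have "S (\<lambda>_. c) (\<lambda>_. 0)" by (simp add: S_def)
    thus ?case by (blast intro: form_fun_const form_fun_0)
  next
    case (coord i)
    have "S (\<lambda>x. x $ i) (\<lambda>_. if i = 0 then 1 else 0)" using coord assms(2) by (simp add: S_def)
    thus ?case using coord by (blast intro: form_fun_const form_fun_coord_low)
  next
    case (add p q)
    then obtain p1 q1 where pq: "poly_fun N p" "poly_fun N q" "poly_fun N p1" "S p p1" "poly_fun N q1" "S q q1"
      by blast
    have "S (\<lambda>x. p x + q x) (\<lambda>x. p1 x + q1 x)" unfolding S_def
    proof
      fix x :: "'a vec" assume x: "x \<in> carrier_vec N"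
      have "p x = p (?z x) + x $ 0 * p1 x" "q x = q (?z x) + x $ 0 * q1 x"
        using pq(4,6) x unfolding S_def by blast+
      thus "p x + q x = p (?z x) + q (?z x) + x $ 0 * (p1 x + q1 x)" by (simp only: distrib_left add_ac)
    qed
    thus ?case using pq by (blast intro: form_fun_add)
  next
    case (mult p q)
    then obtain p1 q1 where pq: "poly_fun N p" "poly_fun N q" "poly_fun N p1" "S p p1" "poly_fun N q1" "S q q1"
      by blast
    have zp: "poly_fun N (\<lambda>x. p (?z x))" by (rule poly_fun_compose[OF pq(1) coord])
    have "S (\<lambda>x. p x * q x) (\<lambda>x. p (?z x) * q1 x + p1 x * q x)" unfolding S_def
    proof
      fix x :: "'a vec" assume x: "x \<in> carrier_vec N"
      have "p x = p (?z x) + x $ 0 * p1 x" "q x = q (?z x) + x $ 0 * q1 x"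
        using pq(4,6) x unfolding S_def by blast+
      moreover have "a * b = a' * b' + c * (a' * b1 + a1 * b)"
        if "a = a' + c * a1" "b = b' + c * b1" for a b a' b' a1 b1 c :: 'a
        using that by (simp add: algebra_simps)
      ultimately show "p x * q x = p (?z x) * q (?z x) + x $ 0 * (p (?z x) * q1 x + p1 x * q x)"
        by blast
    qed
    moreover have "poly_fun N (\<lambda>x. p (?z x) * q1 x + p1 x * q x)"
      by (intro form_fun_add poly_fun_mult zp pq)
    ultimately show ?case using poly_fun_mult[OF pq(1,2)] by blast
  qed
  thus ?thesis by (auto simp: S_def)
qed

section \<open>Coordinates\<close>

text \<open>Dual bases of the algebra, whose dimension is \<open>m + 2\<close>. Starting them with
  \<open>1, e\<close> and \<open>e, 1\<close> makes coordinate 0 the residue and coordinate 1 the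
  value of \<open>\<pi>\<close>, so the remaining \<open>m\<close> elements of \<open>s\<close> span
  \<open>U\<close>. By \<open>top_form_nonzero\<close> the equation is not divisible by coordinate
  0.\<close>

locale gorenstein_basis = gorenstein_functional \<kappa> \<pi> F d e
  for \<kappa> :: "'a::field_char_0 \<Rightarrow> 'b::idom" and \<pi> F d e +
  fixes s \<tau> :: "nat \<Rightarrow> 'b" and m :: nat
  assumes biorth: "biorthogonal (\<lambda>x y. \<pi> (x * y)) (Suc (Suc m)) s \<tau>"
    and expand: "\<pi> (x * y) = (\<Sum>i<Suc (Suc m). \<pi> (x * \<tau> i) * \<pi> (s i * y))"
    and s_0: "s 0 = 1" and s_1: "s (Suc 0) = e" and \<tau>_0: "\<tau> 0 = e" and \<tau>_1: "\<tau> (Suc 0) = 1"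
    and top_form_nonzero: "\<exists>y. eps y = 0 \<and> \<pi> (y ^ d) \<noteq> 0"
begin

abbreviation N :: nat where "N \<equiv> Suc (Suc m)"

definition comb :: "'a vec \<Rightarrow> 'b" where "comb v = (\<Sum>i<N. \<kappa> (v $ i) * s i)"

definition coords :: "'b \<Rightarrow> 'a vec" where "coords x = vec N (\<lambda>i. \<pi> (x * \<tau> i))"

lemma coords_carrier [simp]: "coords x \<in> carrier_vec N"
  by (simp add: coords_def)

lemma \<pi>_s_\<tau>: "i < N \<Longrightarrow> j < N \<Longrightarrow> \<pi> (s i * \<tau> j) = (if i = j then 1 else 0)"
  using biorth by (simp add: biorthogonal_def)

lemma \<pi>_comb_\<tau>:
  assumes "j < N" shows "\<pi> (comb v * \<tau> j) = v $ j"
proof -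
  have "\<pi> (comb v * \<tau> j) = (\<Sum>i<N. v $ i * \<pi> (s i * \<tau> j))"
    unfolding comb_def sum_distrib_right \<pi>_sum by (simp only: mult.assoc \<pi>_scale)
  also have "\<dots> = (\<Sum>i<N. if i = j then v $ i else 0)"
    by (intro sum.cong refl) (use assms in \<open>simp add: \<pi>_s_\<tau>\<close>)
  also have "\<dots> = v $ j" using assms by (simp only: sum.delta finite_lessThan) simp
  finally show ?thesis .
qed

lemma coords_comb: "v \<in> carrier_vec N \<Longrightarrow> coords (comb v) = v"
  by (intro eq_vecI) (auto simp: coords_def \<pi>_comb_\<tau>)

lemma comb_coords: "eqv (comb (coords x)) x"
  unfolding eqv_def
proof
  fix w
  have "\<pi> (comb (coords x) * w) = (\<Sum>i<N. \<pi> (x * \<tau> i) * \<pi> (s i * w))"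
    unfolding comb_def sum_distrib_right \<pi>_sum mult.assoc \<pi>_scale
    by (intro sum.cong refl) (simp add: coords_def)
  thus "\<pi> (comb (coords x) * w) = \<pi> (x * w)" by (simp only: expand[of x w])
qed

lemma coords_cong: "eqv x y \<Longrightarrow> coords x = coords y"
  unfolding coords_def eqv_def by (intro eq_vecI) auto

lemma coords_eqD: "coords x = coords y \<Longrightarrow> eqv x y"
  using comb_coords eqv_sym eqv_trans by metis

lemma coords_scale: "coords (\<kappa> c * x) = c \<cdot>\<^sub>v coords x"
  by (intro eq_vecI) (auto simp: coords_def mult.assoc \<pi>_scale)

lemma comb_add: "v \<in> carrier_vec N \<Longrightarrow> w \<in> carrier_vec N \<Longrightarrow> comb (v + w) = comb v + comb w"
  unfolding comb_def sum.distrib[symmetric]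
  by (intro sum.cong refl) (simp add: \<kappa>_add distrib_right)

lemma comb_smult: "v \<in> carrier_vec N \<Longrightarrow> comb (c \<cdot>\<^sub>v v) = \<kappa> c * comb v"
  unfolding comb_def sum_distrib_left
  by (intro sum.cong refl) (simp add: \<kappa>_mult mult.assoc)

lemma eps_comb: "eps (comb v) = v $ 0"
  using \<pi>_comb_\<tau>[of 0 v] by (simp add: \<tau>_0 eps_def mult.commute)

lemma coords_0: "coords x $ 0 = eps x"
  by (simp add: coords_def \<tau>_0 eps_def mult.commute)

definition orig :: "'a vec" where "orig = unit_vec N 0"

lemma orig: "orig \<in> carrier_vec N" "orig $ 0 = 1" "orig \<noteq> 0\<^sub>v N"
proof -
  show "orig \<in> carrier_vec N" "orig $ 0 = 1" by (simp_all add: orig_def)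
  thus "orig \<noteq> 0\<^sub>v N" by auto
qed

lemma coords_1: "coords 1 = orig"
  using \<pi>_s_\<tau>[of 0] by (intro eq_vecI) (auto simp: coords_def orig_def s_0)

lemma comb_orig: "eqv (comb orig) 1"
  using comb_coords[of 1] by (simp add: coords_1)

section \<open>The additive action\<close>

text \<open>Linear coordinates on \<open>U\<close>; the shift by two skips \<open>1\<close> and the
  socle element.\<close>

definition lie :: "'a vec \<Rightarrow> 'b" where "lie t = (\<Sum>j<m. \<kappa> (t $ j) * s (Suc (Suc j)))"

definition act :: "'a vec \<Rightarrow> 'a vec \<Rightarrow> 'a vec" where "act t x = coords (E (lie t) * comb x)"

lemma lie_in: "lie t \<in> F 1"
proof -
  have "eps (s (Suc (Suc j))) = 0" if "j < m" for j
    using \<pi>_s_\<tau>[of "Suc (Suc j)" 0] that by (simp add: \<tau>_0 eps_def mult.commute)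
  thus ?thesis by (simp add: in_F1_iff lie_def eps_sum eps_scale)
qed

lemma \<pi>_lie: "\<pi> (lie t) = 0"
proof -
  have "\<pi> (s (Suc (Suc j))) = 0" if "j < m" for j
    using \<pi>_s_\<tau>[of "Suc (Suc j)" "Suc 0"] that by (simp add: \<tau>_1)
  thus ?thesis by (simp add: lie_def \<pi>_sum \<pi>_scale)
qed

lemma lie_add: "t \<in> carrier_vec m \<Longrightarrow> t' \<in> carrier_vec m \<Longrightarrow> lie (t + t') = lie t + lie t'"
  unfolding lie_def sum.distrib[symmetric]
  by (intro sum.cong refl) (simp add: \<kappa>_add distrib_right)

lemma lie_0: "lie (0\<^sub>v m) = 0"
  by (simp add: lie_def)

lemma \<pi>_lie_\<tau>:
  assumes "j < m" shows "\<pi> (lie t * \<tau> (Suc (Suc j))) = t $ j"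
proof -
  have "\<pi> (lie t * \<tau> (Suc (Suc j))) = (\<Sum>i<m. t $ i * \<pi> (s (Suc (Suc i)) * \<tau> (Suc (Suc j))))"
    unfolding lie_def sum_distrib_right \<pi>_sum by (simp only: mult.assoc \<pi>_scale)
  also have "\<dots> = (\<Sum>i<m. if i = j then t $ i else 0)"
    by (intro sum.cong refl) (use assms in \<open>simp add: \<pi>_s_\<tau>\<close>)
  also have "\<dots> = t $ j" using assms by simp
  finally show ?thesis .
qed

lemma lie_surj:
  assumes "y \<in> F 1" "\<pi> y = 0"
  obtains t where "t \<in> carrier_vec m" "eqv y (lie t)"
proof
  let ?t = "vec m (\<lambda>j. \<pi> (y * \<tau> (Suc (Suc j))))"
  show "?t \<in> carrier_vec m" by simp
  have "comb (coords y) = lie ?t"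
    unfolding comb_def sum.lessThan_Suc_shift lie_def
    using assms eps_F[OF assms(1)] by (simp add: coords_def \<tau>_0 \<tau>_1 eps_def mult.commute)
  thus "eqv y (lie ?t)" using comb_coords eqv_sym by metis
qed

lemma act_add:
  assumes "t \<in> carrier_vec m" "t' \<in> carrier_vec m"
  shows "act (t + t') x = act t (act t' x)"
  unfolding act_def
proof (rule coords_cong)
  have "eqv (E (lie (t + t')) * comb x) (E (lie t) * E (lie t') * comb x)"
    unfolding lie_add[OF assms] by (intro eqv_mult E_add lie_in eqv_refl)
  also have "\<dots> = E (lie t) * (E (lie t') * comb x)" by (simp add: mult.assoc)
  also have "eqv \<dots> (E (lie t) * comb (coords (E (lie t') * comb x)))"
    by (intro eqv_mult eqv_refl eqv_sym[OF comb_coords])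
  finally show "eqv (E (lie (t + t')) * comb x) (E (lie t) * comb (coords (E (lie t') * comb x)))" .
qed

lemma act_0: "x \<in> carrier_vec N \<Longrightarrow> act (0\<^sub>v m) x = x"
  by (simp add: act_def lie_0 coords_comb)

lemma act_smult: "x \<in> carrier_vec N \<Longrightarrow> act t (c \<cdot>\<^sub>v x) = c \<cdot>\<^sub>v act t x"
  by (simp add: act_def comb_smult coords_scale[symmetric] mult.left_commute)

lemma act_coord0: "act t x $ 0 = x $ 0"
  by (simp add: act_def coords_0 eps_mult eps_E lie_in eps_comb del: One_nat_def)

lemma G_act: "G (comb (act t x)) = G (comb x)"
  using G_cong[OF comb_coords] by (simp add: act_def G_E_mult[OF lie_in] \<pi>_lie)

lemma act_orig: "act t orig = coords (E (lie t))"
  unfolding act_def using eqv_mult[OF eqv_refl comb_orig, of "E (lie t)"] by (intro coords_cong) simp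

text \<open>The action preserves coordinate 0, which forces the projective scalar to be 1;
  \<open>E_inj\<close> does the rest.\<close>

lemma act_orig_inj:
  assumes "t \<in> carrier_vec m" "t' \<in> carrier_vec m" "proj_pt (act t orig) = proj_pt (act t' orig)"
  shows "t = t'"
proof -
  obtain c where c: "act t' orig = c \<cdot>\<^sub>v act t orig" using assms(3) proj_pt_eq_iff by blast
  have "dim_vec (act t orig) = N" by (simp add: act_def coords_def)
  hence "c = 1" using arg_cong[OF c, of "\<lambda>v. v $ 0"] by (simp add: act_coord0 orig)
  hence "coords (E (lie t')) = coords (E (lie t))" using c by (simp only: act_orig one_smult_vec)
  hence "eqv (lie t') (lie t)" by (rule E_inj[OF lie_in lie_in coords_eqD])
  hence "t $ j = t' $ j" if "j < m" for j
    using \<pi>_lie_\<tau>[OF that] by (metis eqv_def)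
  thus ?thesis using assms by (intro eq_vecI) auto
qed

text \<open>Once the point is written as a scalar times \<open>E y\<close>, the equation says
  \<open>\<pi> y = 0\<close>, that is, \<open>y\<close> lies in \<open>U\<close>.\<close>

lemma open_part_orbit:
  assumes "x \<in> carrier_vec N" "x $ 0 \<noteq> 0" "G (comb x) = 0"
  obtains t where "t \<in> carrier_vec m" "x = x $ 0 \<cdot>\<^sub>v act t orig"
proof -
  obtain y where y: "y \<in> F 1" "eqv (comb x) (\<kappa> (x $ 0) * E y)" "G (comb x) = x $ 0 ^ d * \<pi> y"
    using unit_decomposition[of "comb x"] assms(2) by (auto simp: eps_comb)
  hence "\<pi> y = 0" using assms by simp
  then obtain t where t: "t \<in> carrier_vec m" "eqv y (lie t)" using lie_surj y(1) by blast
  have "eqv (comb x) (\<kappa> (x $ 0) * E (lie t))"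
    by (rule eqv_trans[OF y(2)]) (intro eqv_mult eqv_refl E_cong t)
  hence "x = x $ 0 \<cdot>\<^sub>v act t orig"
    using coords_cong coords_comb[OF assms(1)] by (simp add: act_orig coords_scale[symmetric])
  thus ?thesis using that t by blast
qed

definition sform :: "nat \<Rightarrow> nat \<Rightarrow> nat \<Rightarrow> ('a vec \<Rightarrow> 'b) \<Rightarrow> bool" where
  "sform l r k Q \<longleftrightarrow> (\<forall>w. form_fun l r k (\<lambda>v. \<pi> (Q v * w)))"

lemma sform_const: "sform l r 0 (\<lambda>v. x)"
  by (simp add: sform_def form_fun_const)

lemma sform_sum: "(\<And>i. i \<in> I \<Longrightarrow> sform l r k (Q i)) \<Longrightarrow> sform l r k (\<lambda>v. \<Sum>i\<in>I. Q i v)"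
  by (simp add: sform_def sum_distrib_right \<pi>_sum form_fun_sum)

lemma sform_scale: "sform l r k Q \<Longrightarrow> sform l r k (\<lambda>v. \<kappa> c * Q v)"
  by (simp add: sform_def mult.assoc \<pi>_scale form_fun_cmult)

lemma sform_lin_mult:
  assumes "\<And>i. i \<in> I \<Longrightarrow> form_fun l r a (q i)" "sform l r b Q"
  shows "sform l r (a + b) (\<lambda>v. (\<Sum>i\<in>I. \<kappa> (q i v) * x i) * Q v)"
  unfolding sform_def
proof
  fix w
  have "\<pi> ((\<Sum>i\<in>I. \<kappa> (q i v) * x i) * Q v * w) = (\<Sum>i\<in>I. q i v * \<pi> (Q v * (x i * w)))" for v
    by (simp add: sum_distrib_right \<pi>_sum mult.assoc \<pi>_scale) (simp add: mult_ac)
  thus "form_fun l r (a + b) (\<lambda>v. \<pi> ((\<Sum>i\<in>I. \<kappa> (q i v) * x i) * Q v * w))"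
    using assms by (auto simp: sform_def intro!: form_fun_sum form_fun_mult)
qed

lemma sform_lin_power_mult:
  assumes "\<And>i. i \<in> I \<Longrightarrow> form_fun l r a (q i)" "sform l r b Q"
  shows "sform l r (j * a + b) (\<lambda>v. (\<Sum>i\<in>I. \<kappa> (q i v) * x i) ^ j * Q v)"
proof (induction j)
  case (Suc j)
  show ?case using sform_lin_mult[of I l r a q, OF assms(1) Suc, of x] by (simp add: mult.assoc add.assoc)
qed (use assms in simp)

lemma sform_E_mult:
  assumes "\<And>i. i \<in> I \<Longrightarrow> form_fun l r 0 (q i)" "sform l r b Q"
  shows "sform l r b (\<lambda>v. E (\<Sum>i\<in>I. \<kappa> (q i v) * x i) * Q v)"
  unfolding E_def sum_distrib_right mult.assoc
  using sform_lin_power_mult[of I l r 0 q b Q, OF assms] by (intro sform_sum sform_scale) simp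

lemma act_form:
  assumes "i < N"
  shows "form_fun m N 1 (\<lambda>v. act (vec_first v m) (vec_last v N) $ i)"
proof -
  \<comment> \<open>\<open>v\<close> is the group parameter followed by the vector, hence the offset
    \<open>m\<close>.\<close>
  let ?C = "\<lambda>v :: 'a vec. (\<Sum>i<N. \<kappa> (v $ (m + i)) * s i)"
  have "sform m N (1 + 0) (\<lambda>v. ?C v * 1)"
    by (intro sform_lin_mult sform_const form_fun_coord_high) auto
  hence "sform m N 1 (\<lambda>v. E (\<Sum>j<m. \<kappa> (v $ j) * s (Suc (Suc j))) * (?C v * 1))"
    by (intro sform_E_mult form_fun_coord_low) auto
  hence "form_fun m N 1 (\<lambda>v. \<pi> (E (\<Sum>j<m. \<kappa> (v $ j) * s (Suc (Suc j))) * (?C v * 1) * \<tau> i))"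
    unfolding sform_def by blast
  thus ?thesis
  proof (rule form_fun_cong)
    fix v :: "'a vec" assume v: "v \<in> carrier_vec (m + N)"
    have "lie (vec_first v m) = (\<Sum>j<m. \<kappa> (v $ j) * s (Suc (Suc j)))"
      unfolding lie_def by (intro sum.cong refl) (simp add: vec_first_def)
    moreover have "comb (vec_last v N) = ?C v"
      unfolding comb_def by (intro sum.cong refl) (use v in \<open>simp add: vec_last_def\<close>)
    ultimately show "\<pi> (E (\<Sum>j<m. \<kappa> (v $ j) * s (Suc (Suc j))) * (?C v * 1) * \<tau> i) =
        act (vec_first v m) (vec_last v N) $ i"
      using assms by (simp only: act_def coords_def index_vec mult_1_right)
  qed
qed

sublocale flow: projective_flow m "Suc m" act
  by unfold_locales (use act_0 act_add act_smult act_form in \<open>auto simp: act_def\<close>)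

lemma orbit_coord_poly: "poly_fun m (\<lambda>t. act t orig $ i)" if "i < N"
proof -
  have "sform m 0 0 (\<lambda>v. E (\<Sum>j<m. \<kappa> (v $ j) * s (Suc (Suc j))) * 1)"
    by (intro sform_E_mult form_fun_coord_low sform_const) auto
  thus ?thesis using that by (simp add: act_orig coords_def lie_def sform_def)
qed

lemma G_form: "form_fun 0 N d (\<lambda>v. G (comb v))"
proof -
  let ?z = "\<lambda>v :: 'a vec. \<Sum>j\<in>{1..<N}. \<kappa> (v $ j) * s j"
  have "form_fun 0 N d (\<lambda>v. \<Sum>i=1..d. (-1) ^ (i - 1) / of_nat i * (v $ 0 ^ (d - i) * \<pi> (?z v ^ i)))"
  proof (intro form_fun_sum form_fun_cmult)
    fix i assume i: "i \<in> {1..d}"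
    have "sform 0 N (i * 1 + 0) (\<lambda>v. ?z v ^ i * 1)"
      by (intro sform_lin_power_mult sform_const form_fun_coord_high) auto
    hence 1: "form_fun 0 N i (\<lambda>v. \<pi> (?z v ^ i))" unfolding sform_def by (auto dest: spec[of _ 1])
    have 2: "form_fun 0 N ((d - i) * 1) (\<lambda>v. v $ 0 ^ (d - i))"
      by (intro form_fun_power form_fun_coord_high) auto
    show "form_fun 0 N d (\<lambda>v. v $ 0 ^ (d - i) * \<pi> (?z v ^ i))"
      using form_fun_mult[OF 2 1] i by simp
  qed
  \<comment> \<open>As \<open>s 0 = 1\<close>, subtracting the residue removes exactly the summand
    of index 0, so the i-th power is a form of degree \<open>i\<close> in the other
    coordinates.\<close>
  moreover have "comb v - \<kappa> (eps (comb v)) = ?z v" for v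
  proof -
    have c: "comb v = \<kappa> (v $ 0) * s 0 + ?z v"
      unfolding comb_def lessThan_atLeast0 by (subst sum.atLeast_Suc_lessThan) auto
    show ?thesis unfolding eps_comb by (simp only: c s_0 mult_1_right add_diff_cancel_left')
  qed
  ultimately show ?thesis by (simp add: G_def eps_comb)
qed

definition geq :: "'a mpoly" where
  "geq = (SOME f. f \<in> forms N d \<and> (\<forall>v\<in>carrier_vec N. peval f v = G (comb v)))"

lemma geq: "geq \<in> forms N d" "v \<in> carrier_vec N \<Longrightarrow> peval geq v = G (comb v)"
proof -
  have "\<exists>f. f \<in> forms N d \<and> (\<forall>v\<in>carrier_vec N. peval f v = G (comb v))"
    using G_form unfolding form_fun_def by auto
  from someI_ex[OF this] show "geq \<in> forms N d" "v \<in> carrier_vec N \<Longrightarrow> peval geq v = G (comb v)"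
    unfolding geq_def by blast+
qed

end

section \<open>Density of the part of the hypersurface where coordinate 0 is nonzero\<close>

context gorenstein_basis
begin

lemma poly_fun_G: "poly_fun N (\<lambda>x. G (comb x))"
  using form_fun_imp_poly_fun[OF G_form] by simp

text \<open>Moving \<open>x\<close> with \<open>x\<^sub>0 \<noteq> 0\<close> along the socle direction onto the hypersurface, on which the
  coordinate \<open>x\<^sub>1\<close> is a rational function of the others.\<close>

definition retract :: "'a vec \<Rightarrow> 'a vec" where
  "retract x = x + (- (G (comb x) / x $ 0 ^ (d - 1))) \<cdot>\<^sub>v unit_vec N 1"

lemma retract_carrier: "x \<in> carrier_vec N \<Longrightarrow> retract x \<in> carrier_vec N"
  by (simp add: retract_def)

lemma retract_index:
  "x \<in> carrier_vec N \<Longrightarrow> i < N \<Longrightarrow>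
    retract x $ i = (if i = 1 then x $ 1 - G (comb x) / x $ 0 ^ (d - 1) else x $ i)"
  by (auto simp: retract_def unit_vec_def)

lemma comb_unit_vec_1: "comb (unit_vec N 1) = e"
proof -
  have "comb (unit_vec N 1) = (\<Sum>i<N. if i = 1 then s i else 0)"
    unfolding comb_def by (intro sum.cong refl) (simp add: unit_vec_def \<kappa>_1)
  also have "\<dots> = s 1" by (simp only: sum.delta finite_lessThan) simp
  finally show ?thesis by (simp add: s_1)
qed

lemma G_retract:
  assumes "x \<in> carrier_vec N" "x $ 0 \<noteq> 0"
  shows "G (comb (retract x)) = 0"
proof -
  have "comb (retract x) = comb x + \<kappa> (- (G (comb x) / x $ 0 ^ (d - 1))) * e"
    unfolding retract_def using assms(1) comb_unit_vec_1
    by (subst comb_add) (auto simp: comb_smult)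
  thus ?thesis using G_add_socle[of "comb x"] assms(2) by (simp add: eps_comb)
qed

text \<open>Pseudo-division by \<open>G\<close>, which has degree one in coordinate 1:
  \<open>retract\<close> changes this coordinate only, by \<open>G\<close> divided by a power of
  \<open>x\<^sub>0\<close>.\<close>

lemma pseudo_division:
  assumes "poly_fun N q"
  shows "\<exists>M h. poly_fun N h \<and>
    (\<forall>x\<in>carrier_vec N. x $ 0 \<noteq> 0 \<longrightarrow> x $ 0 ^ M * (q x - q (retract x)) = G (comb x) * h x)"
proof -
  define S where "S q M h \<longleftrightarrow> (\<forall>x\<in>carrier_vec N. x $ 0 \<noteq> 0 \<longrightarrow>
    x $ 0 ^ M * (q x - q (retract x)) = G (comb x) * h x)" for q :: "'a vec \<Rightarrow> 'a" and M h
  have "poly_fun N q \<and> (\<exists>M h. poly_fun N h \<and> S q M h)"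
    using assms
  proof (induction rule: poly_fun_induct)
    case (cong p q)
    then obtain M h where h: "poly_fun N p" "poly_fun N h" "S p M h" by blast
    have "S q M h" unfolding S_def
    proof (intro ballI impI)
      fix x :: "'a vec" assume x: "x \<in> carrier_vec N" "x $ 0 \<noteq> 0"
      show "x $ 0 ^ M * (q x - q (retract x)) = G (comb x) * h x"
        using h(3) x cong(2)[OF x(1)] cong(2)[OF retract_carrier[OF x(1)]] unfolding S_def by metis
    qed
    moreover have "poly_fun N q" by (rule form_fun_cong[OF h(1)]) (use cong(2) in simp)
    ultimately show ?case using h(2) by blast
  next
    case (const c)
    have "S (\<lambda>_. c) 0 (\<lambda>_. 0)" by (simp add: S_def)
    thus ?case by (blast intro: form_fun_const form_fun_0)
  next
    case (coord i)
    \<comment> \<open>The denominator in \<open>retract\<close>, which is the leading coefficient of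
      \<open>G\<close> in coordinate 1.\<close>
    have "S (\<lambda>x. x $ i) (d - 1) (\<lambda>_. if i = 1 then 1 else 0)"
      using coord by (auto simp: S_def retract_index)
    thus ?case using coord by (blast intro: form_fun_const form_fun_coord_low)
  next
    case (add p q)
    then obtain M h M' h' where h: "poly_fun N p" "poly_fun N h" "S p M h"
      "poly_fun N q" "poly_fun N h'" "S q M' h'" by blast
    let ?h = "\<lambda>x. x $ 0 ^ M' * h x + x $ 0 ^ M * h' x"
    have "S (\<lambda>x. p x + q x) (M + M') ?h" unfolding S_def
    proof (intro ballI impI)
      fix x :: "'a vec" assume x: "x \<in> carrier_vec N" "x $ 0 \<noteq> 0"
      have "x $ 0 ^ M * (p x - p (retract x)) = G (comb x) * h x"
        "x $ 0 ^ M' * (q x - q (retract x)) = G (comb x) * h' x"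
        using h(3,6) x unfolding S_def by blast+
      moreover have "(a * b) * (u + v - (u' + v')) = g * (b * k + a * k')"
        if "a * (u - u') = g * k" "b * (v - v') = g * k'" for a b u v u' v' g k k' :: 'a
        using arg_cong[OF that(1), of "\<lambda>z. b * z"] arg_cong[OF that(2), of "\<lambda>z. a * z"]
        by (simp add: algebra_simps)
      ultimately show "x $ 0 ^ (M + M') * (p x + q x - (p (retract x) + q (retract x))) = G (comb x) * ?h x"
        unfolding power_add by blast
    qed
    moreover have "poly_fun N ?h"
      by (intro form_fun_add poly_fun_mult poly_fun_power form_fun_coord_low h) simp_all
    ultimately show ?case using form_fun_add[OF h(1,4)] by blast
  next
    case (mult p q)
    then obtain M h M' h' where h: "poly_fun N p" "poly_fun N h" "S p M h"
      "poly_fun N q" "poly_fun N h'" "S q M' h'" by blast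
    \<comment> \<open>\<open>q (retract x)\<close> is not polynomial in \<open>x\<close>, but
      \<open>x $ 0 ^ M' * q (retract x)\<close> can be replaced by
      \<open>x $ 0 ^ M' * q x - G (comb x) * h' x\<close>, which is.\<close>
    let ?h = "\<lambda>x. x $ 0 ^ M * p x * h' x + (x $ 0 ^ M' * q x - G (comb x) * h' x) * h x"
    have "S (\<lambda>x. p x * q x) (M + M') ?h" unfolding S_def
    proof (intro ballI impI)
      fix x :: "'a vec" assume x: "x \<in> carrier_vec N" "x $ 0 \<noteq> 0"
      have "x $ 0 ^ M * (p x - p (retract x)) = G (comb x) * h x"
        "x $ 0 ^ M' * (q x - q (retract x)) = G (comb x) * h' x"
        using h(3,6) x unfolding S_def by blast+
      moreover have "(a * b) * (u * v - u' * v') = g * (a * u * k' + (b * v - g * k') * k)"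
        if 1: "a * (u - u') = g * k" and 2: "b * (v - v') = g * k'" for a b u v u' v' g k k' :: 'a
      proof -
        have "(a * b) * (u * v - u' * v') = a * u * (b * (v - v')) + b * v' * (a * (u - u'))"
          by (simp add: algebra_simps)
        also have "b * v' = b * v - g * k'" using 2 by (simp add: algebra_simps)
        finally show ?thesis by (simp only: 1 2) (simp add: algebra_simps)
      qed
      ultimately show "x $ 0 ^ (M + M') * (p x * q x - p (retract x) * q (retract x)) = G (comb x) * ?h x"
        unfolding power_add by blast
    qed
    moreover have "poly_fun N ?h"
      by (intro form_fun_add form_fun_diff poly_fun_mult poly_fun_power form_fun_coord_low poly_fun_G h)
         simp_all
    ultimately show ?case using poly_fun_mult[OF h(1,4)] by blast
  qed
  thus ?thesis unfolding S_def by blast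
qed

lemma poly_fun_cancel_coord0:
  fixes q :: "'a vec \<Rightarrow> 'a"
  assumes "poly_fun N q" "\<And>x. x \<in> carrier_vec N \<Longrightarrow> x $ 0 * q x = 0" "x \<in> carrier_vec N"
  shows "q x = 0"
proof -
  have "poly_fun N (\<lambda>x. x $ 0 :: 'a)" by (intro form_fun_coord_low) simp
  from poly_fun_mult_eq_0[where p = "\<lambda>x. x $ 0", OF this assms(1,2)] show ?thesis using orig assms(3) by auto
qed

text \<open>The equation of the hypersurface does not vanish identically on \<open>x\<^sub>0 = 0\<close>, so \<open>x\<^sub>0\<close> can be
  cancelled from multiples of it.\<close>

lemma cancel_coord0_power:
  assumes "poly_fun N q" "poly_fun N h" "\<And>x. x \<in> carrier_vec N \<Longrightarrow> x $ 0 ^ M * q x = G (comb x) * h x"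
  shows "\<exists>h'. \<forall>x\<in>carrier_vec N. q x = G (comb x) * h' x"
  using assms(2,3)
proof (induction M arbitrary: h)
  case 0
  thus ?case by auto
next
  case (Suc M)
  let ?z = "\<lambda>x :: 'a vec. vec N (\<lambda>i. if i = 0 then 0 else x $ i)"
  have coord: "poly_fun N (\<lambda>x :: 'a vec. if i = 0 then 0 else x $ i)" if "i < N" for i
    using that by (cases "i = 0") (auto intro: form_fun_0 form_fun_coord_low)
  obtain h1 where h1: "poly_fun N h1"
    "\<And>x. x \<in> carrier_vec N \<Longrightarrow> h x = h (?z x) + x $ 0 * h1 x"
    using poly_fun_split_coord0[OF Suc.prems(1)] by blast
  \<comment> \<open>Setting \<open>x\<^sub>0 = 0\<close> annihilates the left-hand side, whose
    exponent is \<open>Suc M\<close>. As \<open>G\<close> is not identically zero there,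
    \<open>h\<close> is, and one factor \<open>x\<^sub>0\<close> cancels.\<close>
  have "G (comb (?z x)) * h (?z x) = 0" for x
    using Suc.prems(2)[of "?z x"] by simp
  moreover have "poly_fun N (\<lambda>x. G (comb (?z x)))" "poly_fun N (\<lambda>x. h (?z x))"
    by (rule poly_fun_compose[OF poly_fun_G coord] poly_fun_compose[OF Suc.prems(1) coord]; assumption)+
  ultimately have "(\<forall>x\<in>carrier_vec N. G (comb (?z x)) = 0) \<or> (\<forall>x\<in>carrier_vec N. h (?z x) = 0)"
    by (intro poly_fun_mult_eq_0) auto
  moreover have "\<not> (\<forall>x\<in>carrier_vec N. G (comb (?z x)) = 0)"
  proof -
    obtain y where y: "eps y = 0" "\<pi> (y ^ d) \<noteq> 0" using top_form_nonzero by blast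
    have "?z (coords y) = coords y" using y(1) coords_0[of y] by (intro eq_vecI) (auto simp: coords_def)
    moreover have "G (comb (coords y)) \<noteq> 0"
      using G_cong[OF comb_coords] y d_ge_2 by (simp add: G_max_ideal)
    ultimately show ?thesis using coords_carrier by metis
  qed
  ultimately have hz: "h (?z x) = 0" if "x \<in> carrier_vec N" for x using that by blast
  have "x $ 0 ^ M * q x - G (comb x) * h1 x = 0" if "x \<in> carrier_vec N" for x
  proof (rule poly_fun_cancel_coord0[OF _ _ that])
    show "poly_fun N (\<lambda>x. x $ 0 ^ M * q x - G (comb x) * h1 x)"
      by (intro form_fun_diff poly_fun_mult poly_fun_power form_fun_coord_low poly_fun_G h1 assms(1)) simp
    fix x :: "'a vec" assume x: "x \<in> carrier_vec N"
    have "h x = x $ 0 * h1 x" using h1(2)[OF x] hz[OF x] by simp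
    thus "x $ 0 * (x $ 0 ^ M * q x - G (comb x) * h1 x) = 0"
      using Suc.prems(2)[OF x] by (simp add: algebra_simps)
  qed
  thus ?case by (intro Suc.IH[OF h1(1)]) simp
qed

text \<open>\<open>q\<close> vanishes at every \<open>retract x\<close>, so a power of
  \<open>x\<^sub>0\<close> times \<open>q\<close> is a multiple of \<open>G\<close>, and cancelling
  the power makes \<open>q\<close> one. Hence the zero locus of \<open>G\<close> is the orbit
  closure.\<close>

lemma open_part_dense:
  assumes "poly_fun N q"
    and vanish: "\<And>x. x \<in> carrier_vec N \<Longrightarrow> x $ 0 \<noteq> 0 \<Longrightarrow> G (comb x) = 0 \<Longrightarrow> q x = 0"
    and "x \<in> carrier_vec N" "G (comb x) = 0"
  shows "q x = 0"
proof -
  obtain M h where h: "poly_fun N h"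
    "\<And>x. x \<in> carrier_vec N \<Longrightarrow> x $ 0 \<noteq> 0 \<Longrightarrow> x $ 0 ^ M * (q x - q (retract x)) = G (comb x) * h x"
    using pseudo_division[OF assms(1)] by blast
  have "x $ 0 ^ M * q x - G (comb x) * h x = 0" if "x \<in> carrier_vec N" for x
  proof (rule poly_fun_cancel_coord0[OF _ _ that])
    show "poly_fun N (\<lambda>x. x $ 0 ^ M * q x - G (comb x) * h x)"
      by (intro form_fun_diff poly_fun_mult poly_fun_power form_fun_coord_low poly_fun_G h assms(1)) simp
    fix x :: "'a vec" assume x: "x \<in> carrier_vec N"
    \<comment> \<open>The extra factor covers the hyperplane, about which pseudo-division says
      nothing; \<open>poly_fun_cancel_coord0\<close> removes it.\<close>
    show "x $ 0 * (x $ 0 ^ M * q x - G (comb x) * h x) = 0"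
    proof (cases "x $ 0 = 0")
      case False
      have "q (retract x) = 0"
        using x False by (intro vanish retract_carrier G_retract) (auto simp: retract_index)
      thus ?thesis using h(2)[OF x False] by simp
    qed simp
  qed
  then obtain h' where "\<forall>x\<in>carrier_vec N. q x = G (comb x) * h' x"
    using cancel_coord0_power[OF assms(1) h(1), of M] by auto
  thus ?thesis using assms(3,4) by simp
qed

section \<open>The hypersurface\<close>

definition X :: "'a vec set set" where "X = zero_locus (Suc m) geq"

definition U :: "'a vec set set" where "U = {proj_pt (act t orig) | t. t \<in> carrier_vec m}"

lemma X_subset: "X \<subseteq> proj_space (Suc m)"
  unfolding X_def by (rule zero_locus_subset)

lemma proj_pt_in_X_iff:
  "x \<in> carrier_vec N \<Longrightarrow> x \<noteq> 0\<^sub>v N \<Longrightarrow> proj_pt x \<in> X \<longleftrightarrow> G (comb x) = 0"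
  unfolding X_def by (simp add: proj_pt_in_zero_locus_iff[OF geq(1)] geq(2))

lemma X_cases:
  assumes "p \<in> X"
  obtains x where "x \<in> carrier_vec N" "x \<noteq> 0\<^sub>v N" "p = proj_pt x" "G (comb x) = 0"
  using assms X_subset proj_space_iff[of p "Suc m"] proj_pt_in_X_iff by blast

lemma act_orig_point:
  assumes "t \<in> carrier_vec m"
  shows "act t orig \<in> carrier_vec N" "act t orig \<noteq> 0\<^sub>v N" "act t orig $ 0 = 1" "proj_pt (act t orig) \<in> X"
proof -
  show 1: "act t orig \<in> carrier_vec N" by (simp add: act_def)
  show 2: "act t orig $ 0 = 1" by (simp add: act_coord0 orig)
  thus 3: "act t orig \<noteq> 0\<^sub>v N" by auto
  have "G (comb orig) = G (E 0)" using G_cong[OF comb_orig] by simp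
  hence "G (comb orig) = 0" using G_E_1[OF F_zero] by simp
  thus "proj_pt (act t orig) \<in> X" using proj_pt_in_X_iff[OF 1 3] by (simp add: G_act)
qed

lemma U_eq: "U = X - hyperplane0 (Suc m)"
proof (intro equalityI subsetI)
  fix p assume "p \<in> U"
  then obtain t where t: "t \<in> carrier_vec m" "p = proj_pt (act t orig)" by (auto simp: U_def)
  thus "p \<in> X - hyperplane0 (Suc m)"
    using act_orig_point[OF t(1)] proj_pt_in_hyperplane0_iff[of "act t orig" "Suc m"] by simp
next
  fix p assume p: "p \<in> X - hyperplane0 (Suc m)"
  then obtain x where x: "x \<in> carrier_vec N" "x \<noteq> 0\<^sub>v N" "p = proj_pt x" "G (comb x) = 0"
    using X_cases by blast
  hence x0: "x $ 0 \<noteq> 0" using p proj_pt_in_hyperplane0_iff[of x "Suc m"] by simp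
  obtain t where t: "t \<in> carrier_vec m" "x = x $ 0 \<cdot>\<^sub>v act t orig"
    using open_part_orbit[OF x(1) x0 x(4)] .
  have "p = proj_pt (act t orig)" using proj_pt_smult[OF x0, of "act t orig"] t(2) x(3) by simp
  thus "p \<in> U" using t(1) by (auto simp: U_def)
qed

lemma hypersurface_eq_geq: "hypersurface_eq (Suc m) geq X"
proof -
  obtain y where y: "eps y = 0" "\<pi> (y ^ d) \<noteq> 0" using top_form_nonzero by blast
  have "peval geq (coords y) \<noteq> 0"
    using G_cong[OF comb_coords] y d_ge_2 by (simp add: geq(2) G_max_ideal)
  hence "geq \<noteq> 0" by auto
  thus ?thesis unfolding hypersurface_eq_def X_def using geq(1) d_ge_2 by (auto intro!: exI[of _ d])
qed

lemma nondegenerate_X: "nondegenerate_hypersurface (Suc m) X"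
  unfolding nondegenerate_hypersurface_def
proof (intro exI[of _ geq] conjI hypersurface_eq_geq notI)
  assume "\<exists>A\<in>GL N. card (vars (lin_subst A geq)) < N"
  then obtain A where A: "A \<in> GL N" "card (vars (lin_subst A geq)) < N" by blast
  have "\<not> card (vars (lin_subst A geq)) < N"
  proof (rule nondegenerate_formI[OF _ _ A(1)])
    show "vars geq \<subseteq> {..<N}" using geq(1) by (auto simp: part_forms_def)
    fix v :: "'a vec" assume v: "v \<in> carrier_vec N"
      and inv: "\<And>w r. w \<in> carrier_vec N \<Longrightarrow> peval geq (w + r \<cdot>\<^sub>v v) = peval geq w"
    have "eqv (comb v) 0"
    proof (rule G_nondegenerate)
      fix w r
      have "G (w + \<kappa> r * comb v) = G (comb (coords w) + \<kappa> r * comb v)"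
        by (intro G_cong eqv_add eqv_refl eqv_sym[OF comb_coords])
      also have "comb (coords w) + \<kappa> r * comb v = comb (coords w + r \<cdot>\<^sub>v v)"
        using v by (subst comb_add) (auto simp: comb_smult)
      also have "G \<dots> = G (comb (coords w))"
        using inv[of "coords w" r] v by (simp add: geq(2))
      also have "\<dots> = G w" by (rule G_cong[OF comb_coords])
      finally show "G (w + \<kappa> r * comb v) = G w" .
    qed
    hence "coords (comb v) = coords 0" by (rule coords_cong)
    thus "v = 0\<^sub>v N" using coords_comb[OF v] by (auto simp: coords_def)
  qed
  thus False using A(2) by simp
qed

text \<open>Some form defining \<open>C\<close> is nonzero at a point of \<open>X\<close>, by
  density even at a point of the orbit. Its pullback to the group is \<open>q\<close>.\<close>

lemma not_in_closed_orbit: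
  assumes "zariski_closed (Suc m) C" "\<not> X \<subseteq> C"
  obtains q where "poly_fun m q" "\<exists>t\<in>carrier_vec m. q t \<noteq> 0"
    "\<forall>t\<in>carrier_vec m. q t \<noteq> 0 \<longrightarrow> proj_pt (act t orig) \<notin> C"
proof -
  obtain T where T: "T \<subseteq> (\<Union>k. forms N k)" "C = {p \<in> proj_space (Suc m). \<forall>f\<in>T. p \<in> zero_locus (Suc m) f}"
    using assms(1) by (auto simp: zariski_closed_def)
  obtain p where p: "p \<in> X" "p \<notin> C" using assms(2) by blast
  then obtain f where f: "f \<in> T" "p \<notin> zero_locus (Suc m) f" using T(2) X_subset by blast
  obtain k where k: "f \<in> forms N k" using f T(1) by blast
  obtain x where x: "x \<in> carrier_vec N" "x \<noteq> 0\<^sub>v N" "p = proj_pt x" "G (comb x) = 0"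
    using p(1) by (rule X_cases)
  have fx: "peval f x \<noteq> 0" using f(2) x proj_pt_in_zero_locus_iff[OF k x(1,2)] by simp
  have pf: "poly_fun N (peval f)" using k by (intro peval_poly_fun) (auto simp: part_forms_def)
  obtain y where y: "y \<in> carrier_vec N" "y $ 0 \<noteq> 0" "G (comb y) = 0" "peval f y \<noteq> 0"
    using open_part_dense[OF pf _ x(1,4)] fx by blast
  obtain t where t: "t \<in> carrier_vec m" "y = y $ 0 \<cdot>\<^sub>v act t orig"
    using open_part_orbit[OF y(1-3)] .
  have ft: "peval f (act t orig) \<noteq> 0"
    using peval_form_smult[OF k act_orig_point(1)[OF t(1)], of "y $ 0"] t(2) y(4) by auto
  have vec: "vec N (\<lambda>i. act t orig $ i) = act t orig" for t
    by (intro eq_vecI) (auto simp: act_def coords_def)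
  have "poly_fun m (\<lambda>t. peval f (act t orig))"
    using poly_fun_compose[where h = "\<lambda>i t. act t orig $ i", OF pf orbit_coord_poly] by (simp only: vec)
  moreover have "proj_pt (act t orig) \<notin> C" if "t \<in> carrier_vec m" "peval f (act t orig) \<noteq> 0" for t
    using that f(1) T(2) proj_pt_in_zero_locus_iff[OF k act_orig_point(1,2)[OF that(1)]] by blast
  ultimately show ?thesis using that ft t(1) by blast
qed

text \<open>Two proper closed subsets would give two nonzero polynomials on the group; where their
  product is nonzero, the orbit point lies in neither subset.\<close>

lemma irreducible_X: "irreducible_variety (Suc m) X"
  unfolding irreducible_variety_def
proof (intro conjI allI impI)
  show "zariski_closed (Suc m) X" unfolding X_def by (rule zariski_closed_zero_locus) (rule geq)
  show "X \<noteq> {}" using act_orig_point(4)[of "0\<^sub>v m"] by auto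
  fix C D assume CD: "zariski_closed (Suc m) C \<and> zariski_closed (Suc m) D \<and> X \<subseteq> C \<union> D"
  show "X \<subseteq> C \<or> X \<subseteq> D"
  proof (rule ccontr)
    assume "\<not> (X \<subseteq> C \<or> X \<subseteq> D)"
    hence nsub: "\<not> X \<subseteq> C" "\<not> X \<subseteq> D" by auto
    have closed: "zariski_closed (Suc m) C" "zariski_closed (Suc m) D" using CD by auto
    obtain q where q: "poly_fun m q" "\<exists>t\<in>carrier_vec m. q t \<noteq> 0"
        "\<forall>t\<in>carrier_vec m. q t \<noteq> 0 \<longrightarrow> proj_pt (act t orig) \<notin> C"
      by (rule not_in_closed_orbit[OF closed(1) nsub(1)]) (rule that)
    obtain q' where q': "poly_fun m q'" "\<exists>t\<in>carrier_vec m. q' t \<noteq> 0"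
        "\<forall>t\<in>carrier_vec m. q' t \<noteq> 0 \<longrightarrow> proj_pt (act t orig) \<notin> D"
      by (rule not_in_closed_orbit[OF closed(2) nsub(2)]) (rule that)
    obtain t where "t \<in> carrier_vec m" "q t * q' t \<noteq> 0"
      using poly_fun_mult_eq_0[OF q(1) q'(1)] q(2) q'(2) by blast
    thus False using q(3) q'(3) act_orig_point(4) CD by fastforce
  qed
qed

lemma act_X:
  assumes "t \<in> carrier_vec m" "p \<in> X"
  shows "act t ` p \<in> X"
proof -
  obtain x where x: "x \<in> carrier_vec N" "x \<noteq> 0\<^sub>v N" "p = proj_pt x" "G (comb x) = 0"
    using assms(2) by (rule X_cases)
  thus ?thesis
    using flow.act_proj_pt[OF assms(1) x(1)] flow.act_carrier[OF assms(1) x(1)]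
      flow.act_nonzero[OF assms(1) x(1,2)] proj_pt_in_X_iff by (simp add: G_act)
qed

lemma act_proj_space:
  assumes "t \<in> carrier_vec m" "p \<in> proj_space (Suc m)"
  shows "act t ` p \<in> proj_space (Suc m)"
proof -
  obtain x where x: "x \<in> carrier_vec N" "x \<noteq> 0\<^sub>v N" "p = proj_pt x"
    using assms(2) proj_space_iff by blast
  thus ?thesis
    using flow.act_proj_pt[OF assms(1) x(1)] flow.act_carrier[OF assms(1) x(1)]
      flow.act_nonzero[OF assms(1) x(1,2)] by (simp add: proj_pt_in_proj_space)
qed

lemma proj_pt_orig: "proj_pt orig \<in> X"
  using act_orig_point(4)[of "0\<^sub>v m"] act_0[OF orig(1)] by simp

lemma flow_orig: "t \<in> carrier_vec m \<Longrightarrow> flow.flow X t (proj_pt orig) = proj_pt (act t orig)"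
  by (simp add: flow.flow_def proj_pt_orig flow.act_proj_pt orig)

lemma open_orbit_U: "open_orbit m (Suc m) X (flow.flow X) U"
  unfolding open_orbit_def
proof
  have "U = orbit (monoid_vec TYPE('a) m) (flow.flow X) (proj_pt orig)"
    unfolding orbit_def U_def monoid_vec_simps by (intro Collect_cong) (metis flow_orig)
  thus "U \<in> orbits (monoid_vec TYPE('a) m) X (flow.flow X)"
    unfolding orbits_def using proj_pt_orig by blast
  show "zariski_open_in (Suc m) X U"
    unfolding zariski_open_in_def U_eq hyperplane0_zero_locus
    using zariski_closed_zero_locus[OF coord_in_forms[of 0 N]] by blast
qed

text \<open>The group acts linearly on the algebra, so the same formula gives the extension to
  projective space.\<close>

lemma induced_additive_action_X: "induced_additive_action (Suc m) X (flow.flow X)"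
proof -
  have reg: "regular_action m (Suc m) X (flow.flow X)"
    by (rule flow.regular_action_flow[OF X_subset act_X])
  have "faithful_action (monoid_vec TYPE('a) m) X (flow.flow X)"
    unfolding faithful_action_def faithful_action_axioms_def
  proof
    show "group_action (monoid_vec TYPE('a) m) X (flow.flow X)"
      using reg by (simp add: regular_action_def)
    show "inj_on (flow.flow X) (carrier (monoid_vec TYPE('a) m))"
    proof (rule inj_onI)
      fix t t' assume t: "t \<in> carrier (monoid_vec TYPE('a) m)" "t' \<in> carrier (monoid_vec TYPE('a) m)"
        and eq: "flow.flow X t = flow.flow X t'"
      hence "t \<in> carrier_vec m" "t' \<in> carrier_vec m" by (auto simp: monoid_vec_simps)
      thus "t = t'"
        using fun_cong[OF eq, of "proj_pt orig"] by (intro act_orig_inj) (auto simp: flow_orig)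
    qed
  qed
  hence "additive_action m (Suc m) X (flow.flow X)"
    unfolding additive_action_def using irreducible_X reg open_orbit_U by blast
  moreover have "regular_action m (Suc m) (proj_space (Suc m)) (flow.flow (proj_space (Suc m)))"
    by (rule flow.regular_action_flow[OF order.refl act_proj_space])
  moreover have "flow.flow (proj_space (Suc m)) t p = flow.flow X t p" if "p \<in> X" for t p
    using that X_subset by (auto simp: flow.flow_def)
  ultimately show ?thesis
    unfolding induced_additive_action_def hypersurface_def using hypersurface_eq_geq
    by (auto intro!: exI[of _ "flow.flow (proj_space (Suc m))"])
qed

lemma boundary_X:
  assumes "y \<in> carrier_vec (Suc m)" "y \<noteq> 0\<^sub>v (Suc m)"
  shows "proj_pt (vCons 0 y) \<in> X \<longleftrightarrow> \<pi> (comb (vCons 0 y) ^ d) = 0"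
proof -
  have "vCons 0 y \<noteq> 0\<^sub>v N"
  proof
    assume "vCons 0 y = 0\<^sub>v N"
    hence "vCons 0 y $ Suc i = 0\<^sub>v N $ Suc i" for i by simp
    hence "y = 0\<^sub>v (Suc m)" using assms(1) by (intro eq_vecI) auto
    thus False using assms(2) by simp
  qed
  thus ?thesis
    using proj_pt_in_X_iff[of "vCons 0 y"] assms d_ge_2 by (simp add: G_max_ideal eps_comb)
qed

end

section \<open>Inverse systems\<close>

definition mdeg :: "(nat \<Rightarrow>\<^sub>0 nat) \<Rightarrow> nat" where
  "mdeg \<mu> = (\<Sum>i\<in>Poly_Mapping.keys \<mu>. Poly_Mapping.lookup \<mu> i)"

definition mfact :: "(nat \<Rightarrow>\<^sub>0 nat) \<Rightarrow> 'a::field_char_0" where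
  "mfact \<mu> = (\<Prod>i\<in>Poly_Mapping.keys \<mu>. fact (Poly_Mapping.lookup \<mu> i))"

lemma mdeg_superset:
  assumes "finite M" "Poly_Mapping.keys \<mu> \<subseteq> M"
  shows "mdeg \<mu> = (\<Sum>i\<in>M. Poly_Mapping.lookup \<mu> i)"
  unfolding mdeg_def by (rule sum.mono_neutral_left) (use assms in \<open>auto simp: in_keys_iff\<close>)

lemma mfact_superset:
  assumes "finite M" "Poly_Mapping.keys \<mu> \<subseteq> M"
  shows "mfact \<mu> = (\<Prod>i\<in>M. fact (Poly_Mapping.lookup \<mu> i))"
  unfolding mfact_def by (rule prod.mono_neutral_left) (use assms in \<open>auto simp: in_keys_iff\<close>)

lemma mdeg_add: "mdeg (\<mu> + \<nu>) = mdeg \<mu> + mdeg \<nu>"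
proof -
  let ?M = "Poly_Mapping.keys \<mu> \<union> Poly_Mapping.keys \<nu>"
  have "mdeg (\<mu> + \<nu>) = (\<Sum>i\<in>?M. Poly_Mapping.lookup (\<mu> + \<nu>) i)"
    by (rule mdeg_superset) (use Poly_Mapping.keys_add[of \<mu> \<nu>] in auto)
  thus ?thesis by (simp add: mdeg_superset[of ?M] lookup_add sum.distrib)
qed

lemma mdeg_eq_0_iff: "mdeg \<mu> = 0 \<longleftrightarrow> \<mu> = 0"
  by (auto simp: mdeg_def in_keys_iff simp flip: keys_eq_empty)

lemma mdeg_single [simp]: "mdeg (Poly_Mapping.single i n) = n"
  by (simp add: mdeg_def)

lemma single_1_eq_iff: "Poly_Mapping.single i (1::nat) = Poly_Mapping.single j 1 \<longleftrightarrow> i = j"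
  by (metis keys_single singleton_inject zero_neq_one)

lemma mfact_nonzero: "mfact \<mu> \<noteq> 0"
  by (simp add: mfact_def)

lemma single_add_minus:
  assumes "i \<in> Poly_Mapping.keys (\<nu> :: nat \<Rightarrow>\<^sub>0 nat)"
  shows "Poly_Mapping.single i 1 + (\<nu> - Poly_Mapping.single i 1) = \<nu>"
  by (rule poly_mapping_eqI)
     (use assms in \<open>auto simp: lookup_add minus_poly_mapping.rep_eq lookup_single when_def in_keys_iff\<close>)

lemma mdeg_minus_single:
  "i \<in> Poly_Mapping.keys \<nu> \<Longrightarrow> mdeg \<nu> = Suc (mdeg (\<nu> - Poly_Mapping.single i 1))"
  using arg_cong[OF single_add_minus, of i \<nu> mdeg] unfolding mdeg_add by simp

lemma mdeg_eq_1E: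
  assumes "mdeg \<alpha> = 1" obtains i where "\<alpha> = Poly_Mapping.single i 1"
proof -
  have "\<alpha> \<noteq> 0" using assms by (auto simp: mdeg_def)
  then obtain i where i: "i \<in> Poly_Mapping.keys \<alpha>" by (metis equals0I keys_eq_empty)
  hence "\<alpha> - Poly_Mapping.single i 1 = 0" using mdeg_minus_single assms mdeg_eq_0_iff by simp
  hence "\<alpha> = Poly_Mapping.single i 1" using single_add_minus[OF i] by simp
  thus ?thesis by (rule that)
qed

lemma keys_minus_single: "Poly_Mapping.keys (\<nu> - Poly_Mapping.single i 1) \<subseteq> Poly_Mapping.keys (\<nu> :: nat \<Rightarrow>\<^sub>0 nat)"
  by (auto simp: in_keys_iff minus_poly_mapping.rep_eq)

lemma lookup_minus_single:
  "Poly_Mapping.lookup (\<nu> - Poly_Mapping.single i 1) j =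
     (if j = i then Poly_Mapping.lookup \<nu> i - 1 else Poly_Mapping.lookup (\<nu> :: nat \<Rightarrow>\<^sub>0 nat) j)"
  by (auto simp: minus_poly_mapping.rep_eq lookup_single when_def)

lemma mfact_minus_single:
  assumes "i \<in> Poly_Mapping.keys \<nu>"
  shows "(mfact \<nu> :: 'a::field_char_0) = of_nat (Poly_Mapping.lookup \<nu> i) * mfact (\<nu> - Poly_Mapping.single i 1)"
proof -
  let ?K = "Poly_Mapping.keys \<nu>"
  have "(mfact \<nu> :: 'a) = fact (Poly_Mapping.lookup \<nu> i) * (\<Prod>j\<in>?K - {i}. fact (Poly_Mapping.lookup \<nu> j))"
    unfolding mfact_def by (rule prod.remove) (use assms in auto)
  moreover have "(mfact (\<nu> - Poly_Mapping.single i 1) :: 'a) =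
      fact (Poly_Mapping.lookup \<nu> i - 1) * (\<Prod>j\<in>?K - {i}. fact (Poly_Mapping.lookup \<nu> j))"
    unfolding mfact_superset[OF finite_keys keys_minus_single]
    by (subst prod.remove[of _ i]) (use assms in \<open>auto simp: lookup_minus_single simp del: One_nat_def intro!: prod.cong\<close>)
  moreover have "fact (Poly_Mapping.lookup \<nu> i) =
      (of_nat (Poly_Mapping.lookup \<nu> i) * fact (Poly_Mapping.lookup \<nu> i - 1) :: 'a)"
    using assms by (intro fact_reduce) (simp add: in_keys_iff)
  ultimately show ?thesis by simp
qed

lemma mon_minus_single:
  fixes \<nu> :: "nat \<Rightarrow>\<^sub>0 nat"
  assumes "i \<in> Poly_Mapping.keys \<nu>"
  shows "(\<Prod>j\<in>Poly_Mapping.keys \<nu>. (c j :: 'a::comm_ring_1) ^ Poly_Mapping.lookup \<nu> j) =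
    c i * (\<Prod>j\<in>Poly_Mapping.keys (\<nu> - Poly_Mapping.single i 1). c j ^ Poly_Mapping.lookup (\<nu> - Poly_Mapping.single i 1) j)"
proof -
  let ?K = "Poly_Mapping.keys \<nu>" and ?\<nu> = "\<nu> - Poly_Mapping.single i 1"
  have "(\<Prod>j\<in>?K. c j ^ Poly_Mapping.lookup \<nu> j) =
      c i ^ Poly_Mapping.lookup \<nu> i * (\<Prod>j\<in>?K - {i}. c j ^ Poly_Mapping.lookup \<nu> j)"
    by (rule prod.remove) (use assms in auto)
  moreover have "(\<Prod>j\<in>Poly_Mapping.keys ?\<nu>. c j ^ Poly_Mapping.lookup ?\<nu> j) = (\<Prod>j\<in>?K. c j ^ Poly_Mapping.lookup ?\<nu> j)"
    by (rule prod.mono_neutral_left[OF finite_keys keys_minus_single]) (auto simp: in_keys_iff)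
  moreover have "\<dots> = c i ^ (Poly_Mapping.lookup \<nu> i - 1) * (\<Prod>j\<in>?K - {i}. c j ^ Poly_Mapping.lookup \<nu> j)"
    by (subst prod.remove[of _ i]) (use assms in \<open>auto simp: lookup_minus_single simp del: One_nat_def intro!: prod.cong\<close>)
  moreover have "c i ^ Poly_Mapping.lookup \<nu> i = c i * c i ^ (Poly_Mapping.lookup \<nu> i - 1)"
    using assms by (simp add: in_keys_iff power_eq_if)
  ultimately show ?thesis by (simp add: mult.assoc)
qed

lemma lookup_const_mult: "Poly_Mapping.lookup (Poly_Mapping.single 0 a * x) \<mu> = a * Poly_Mapping.lookup x \<mu>"
  by (simp add: mult_map_scale_conv_mult[symmetric] Poly_Mapping.map.rep_eq when_def)

definition ord_ge :: "nat \<Rightarrow> 'a::zero mpoly set" where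
  "ord_ge i = {z. \<forall>\<mu>\<in>Poly_Mapping.keys z. i \<le> mdeg \<mu>}"

lemma ord_ge_mult:
  assumes "x \<in> ord_ge i" "y \<in> ord_ge j" shows "x * y \<in> ord_ge (i + j)"
  unfolding ord_ge_def
proof (intro CollectI ballI)
  fix \<mu> assume "\<mu> \<in> Poly_Mapping.keys (x * y)"
  then obtain a b where "\<mu> = a + b" "a \<in> Poly_Mapping.keys x" "b \<in> Poly_Mapping.keys y"
    using keys_mult[of x y] by blast
  thus "i + j \<le> mdeg \<mu>" using assms by (auto simp: ord_ge_def mdeg_add intro: add_mono)
qed

lemma ord_ge_power: "x \<in> ord_ge 1 \<Longrightarrow> (x :: 'a::comm_semiring_1 mpoly) ^ j \<in> ord_ge j"
proof (induction j)
  case 0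
  show ?case by (simp add: ord_ge_def)
next
  case (Suc j)
  thus ?case using ord_ge_mult[of x 1 "x ^ j" j] by simp
qed

text \<open>The degree \<open>Suc j\<close> is the lowest possible one, so only linear terms of
  \<open>z\<close> meet terms of degree \<open>j\<close> of \<open>w\<close>.\<close>

lemma lookup_mult_ord_ge:
  assumes "z \<in> ord_ge 1" "w \<in> ord_ge j" "mdeg \<nu> = Suc j"
  shows "Poly_Mapping.lookup (z * w) \<nu> = (\<Sum>i\<in>Poly_Mapping.keys \<nu>.
    Poly_Mapping.lookup z (Poly_Mapping.single i 1) * Poly_Mapping.lookup w (\<nu> - Poly_Mapping.single i 1))"
proof -
  let ?g = "\<lambda>i. (Poly_Mapping.single i (1::nat), \<nu> - Poly_Mapping.single i 1)"
  let ?T = "{(\<alpha>, \<beta>) \<in> Poly_Mapping.keys z \<times> Poly_Mapping.keys w. \<alpha> + \<beta> = \<nu>}"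
  let ?h = "\<lambda>(\<alpha>, \<beta>). Poly_Mapping.lookup z \<alpha> * Poly_Mapping.lookup w \<beta>"
  have "Poly_Mapping.lookup (z * w) \<nu> =
      (\<Sum>(\<alpha>, \<beta>)\<in>Poly_Mapping.keys z \<times> Poly_Mapping.keys w. if \<alpha> + \<beta> = \<nu> then ?h (\<alpha>, \<beta>) else 0)"
    unfolding mpoly_mult_expand[of z w] lookup_sum lookup_single when_def sum.cartesian_product
    by (intro sum.cong refl) (auto simp: lookup_single when_def)
  also have "\<dots> = sum ?h ?T"
    by (rule sum.mono_neutral_cong_right) (auto split: if_splits)
  also have "\<dots> = sum ?h (?g ` Poly_Mapping.keys \<nu>)"
  proof (rule sum.mono_neutral_left)
    show "?T \<subseteq> ?g ` Poly_Mapping.keys \<nu>"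
    proof
      fix p assume "p \<in> ?T"
      then obtain \<alpha> \<beta> where p: "p = (\<alpha>, \<beta>)" "\<alpha> \<in> Poly_Mapping.keys z" "\<beta> \<in> Poly_Mapping.keys w" "\<alpha> + \<beta> = \<nu>"
        by auto
      have "mdeg \<alpha> = 1" using assms p(2-4) mdeg_add[of \<alpha> \<beta>] by (fastforce simp: ord_ge_def)
      then obtain i where i: "\<alpha> = Poly_Mapping.single i 1" by (rule mdeg_eq_1E)
      have "Poly_Mapping.lookup \<nu> i \<noteq> 0" using p(4)[symmetric] i by (simp add: lookup_add)
      moreover have "\<beta> = \<nu> - Poly_Mapping.single i 1" using p(4) i by auto
      ultimately show "p \<in> ?g ` Poly_Mapping.keys \<nu>" using p(1) i by (auto simp: in_keys_iff)
    qed
    show "\<forall>p\<in>?g ` Poly_Mapping.keys \<nu> - ?T. ?h p = 0"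
      using single_add_minus[of _ \<nu>] by (auto simp: in_keys_iff)
  qed auto
  also have "\<dots> = (\<Sum>i\<in>Poly_Mapping.keys \<nu>. ?h (?g i))"
    by (subst sum.reindex) (auto simp: inj_on_def o_def single_1_eq_iff simp del: One_nat_def)
  finally show ?thesis by simp
qed

text \<open>The multinomial theorem for the lowest-order coefficients of \<open>z\<^sup>j\<close>.\<close>

lemma lookup_power_ord_ge:
  fixes z :: "'a::field_char_0 mpoly"
  assumes "z \<in> ord_ge 1" "mdeg \<nu> = j"
  shows "mfact \<nu> * Poly_Mapping.lookup (z ^ j) \<nu> =
    fact j * (\<Prod>i\<in>Poly_Mapping.keys \<nu>. Poly_Mapping.lookup z (Poly_Mapping.single i 1) ^ Poly_Mapping.lookup \<nu> i)"
  using assms(2)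
proof (induction j arbitrary: \<nu>)
  case 0
  hence "\<nu> = 0" by (simp add: mdeg_eq_0_iff)
  thus ?case by (simp add: mfact_def)
next
  case (Suc j)
  let ?c = "\<lambda>i. Poly_Mapping.lookup z (Poly_Mapping.single i 1)"
  let ?\<nu> = "\<lambda>i. \<nu> - Poly_Mapping.single i 1"
  let ?mon = "\<lambda>\<nu>. \<Prod>i\<in>Poly_Mapping.keys \<nu>. ?c i ^ Poly_Mapping.lookup \<nu> i"
  have "mfact \<nu> * Poly_Mapping.lookup (z ^ Suc j) \<nu> =
      (\<Sum>i\<in>Poly_Mapping.keys \<nu>. mfact \<nu> * (?c i * Poly_Mapping.lookup (z ^ j) (?\<nu> i)))"
    using lookup_mult_ord_ge[OF assms(1) ord_ge_power[OF assms(1)] Suc.prems]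
    by (simp add: sum_distrib_left)
  also have "\<dots> = (\<Sum>i\<in>Poly_Mapping.keys \<nu>. of_nat (Poly_Mapping.lookup \<nu> i) * (fact j * ?mon \<nu>))"
  proof (rule sum.cong[OF refl])
    fix i assume i: "i \<in> Poly_Mapping.keys \<nu>"
    have "mdeg (?\<nu> i) = j" using mdeg_minus_single[OF i] Suc.prems by simp
    from Suc.IH[OF this]
    have IH: "mfact (?\<nu> i) * Poly_Mapping.lookup (z ^ j) (?\<nu> i) = fact j * ?mon (?\<nu> i)" .
    have "mfact \<nu> * (?c i * Poly_Mapping.lookup (z ^ j) (?\<nu> i)) =
        of_nat (Poly_Mapping.lookup \<nu> i) * (?c i * (mfact (?\<nu> i) * Poly_Mapping.lookup (z ^ j) (?\<nu> i)))"
      unfolding mfact_minus_single[OF i] by (simp only: mult_ac)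
    also have "\<dots> = of_nat (Poly_Mapping.lookup \<nu> i) * (fact j * (?c i * ?mon (?\<nu> i)))"
      unfolding IH by (simp only: mult_ac)
    also have "?c i * ?mon (?\<nu> i) = ?mon \<nu>" by (rule mon_minus_single[OF i, symmetric])
    finally show "mfact \<nu> * (?c i * Poly_Mapping.lookup (z ^ j) (?\<nu> i)) =
        of_nat (Poly_Mapping.lookup \<nu> i) * (fact j * ?mon \<nu>)" .
  qed
  \<comment> \<open>The exponents of the variables add up to the degree \<open>Suc j\<close>, which
    raises the factorial.\<close>
  also have "\<dots> = of_nat (mdeg \<nu>) * (fact j * ?mon \<nu>)"
    unfolding mdeg_def of_nat_sum sum_distrib_right ..
  also have "\<dots> = fact (Suc j) * ?mon \<nu>" by (simp add: Suc.prems algebra_simps)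
  finally show ?case .
qed

lemma finite_bounded_exponents: "finite {\<alpha> :: nat \<Rightarrow>\<^sub>0 nat. \<forall>i. Poly_Mapping.lookup \<alpha> i \<le> Poly_Mapping.lookup \<nu> i}"
proof (rule finite_imageD)
  let ?B = "{..\<Sum>i\<in>Poly_Mapping.keys \<nu>. Poly_Mapping.lookup \<nu> i}"
  have "Poly_Mapping.lookup \<nu> i \<in> ?B" if "i \<in> Poly_Mapping.keys \<nu>" for i
    using that by (auto intro!: member_le_sum)
  hence "Poly_Mapping.lookup ` {\<alpha>. \<forall>i. Poly_Mapping.lookup \<alpha> i \<le> Poly_Mapping.lookup \<nu> i}
      \<subseteq> {h. \<forall>i. (i \<in> Poly_Mapping.keys \<nu> \<longrightarrow> h i \<in> ?B) \<and> (i \<notin> Poly_Mapping.keys \<nu> \<longrightarrow> h i = 0)}"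
    by (auto simp: in_keys_iff intro: order_trans) (metis le_zero_eq)
  thus "finite (Poly_Mapping.lookup ` {\<alpha>. \<forall>i. Poly_Mapping.lookup \<alpha> i \<le> Poly_Mapping.lookup \<nu> i})"
    by (rule finite_subset) (intro finite_set_of_finite_funs; simp)
qed (auto intro!: inj_onI poly_mapping_eqI)

lemma peval_cong:
  "vars f \<subseteq> {..<k} \<Longrightarrow> (\<And>i. i < k \<Longrightarrow> v $ i = w $ i) \<Longrightarrow> peval f v = peval f w"
  unfolding peval_def
  by (intro sum.cong refl, rule arg_cong2[where f = times], rule refl, intro prod.cong refl)
     (metis UN_I lessThan_iff subset_iff vars_def)

text \<open>Macaulay's inverse system: polynomials act on \<open>f\<close> as differential operators, and \<open>apolar z\<close> is the
  value at \<open>0\<close> of \<open>z(\<partial>) f\<close>.\<close>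

locale inverse_system =
  fixes f :: "'a::field_char_0 mpoly" and k d :: nat
  assumes f_form: "f \<in> forms k d" and d_ge: "d \<ge> 2" and f_nonzero: "f \<noteq> 0"
    and f_nondegenerate: "v \<in> carrier_vec k \<Longrightarrow>
      (\<And>w r. w \<in> carrier_vec k \<Longrightarrow> peval f (w + r \<cdot>\<^sub>v v) = peval f w) \<Longrightarrow> v = 0\<^sub>v k"
begin

text \<open>The derivative belonging to one monomial, applied to another of the same degree, is zero
  unless they coincide, and then the multi-index factorial.\<close>

definition apolar :: "'a mpoly \<Rightarrow> 'a" where
  "apolar z = (\<Sum>\<mu>\<in>Poly_Mapping.keys f. mfact \<mu> * Poly_Mapping.lookup f \<mu> * Poly_Mapping.lookup z \<mu>)"

text \<open>Any monomial of \<open>f\<close>, normalised to the value 1 under \<open>apolar\<close>,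
  represents a generator of the socle.\<close>

definition socle_elt :: "'a mpoly" where
  "socle_elt = (let \<mu> = (SOME \<mu>. \<mu> \<in> Poly_Mapping.keys f) in
     Poly_Mapping.single \<mu> (1 / (mfact \<mu> * Poly_Mapping.lookup f \<mu>)))"

lemma keys_f: "\<mu> \<in> Poly_Mapping.keys f \<Longrightarrow> Poly_Mapping.keys \<mu> \<subseteq> {..<k}"
  using f_form by (auto simp: part_forms_def vars_def)

lemma mdeg_f: "\<mu> \<in> Poly_Mapping.keys f \<Longrightarrow> mdeg \<mu> = d"
  using f_form keys_f by (simp add: mdeg_superset[of "{..<k}"] part_forms_def atLeast0LessThan)

lemma apolar_add: "apolar (x + y) = apolar x + apolar y"
  by (simp add: apolar_def lookup_add algebra_simps sum.distrib)

lemma apolar_scale: "apolar (Poly_Mapping.single 0 a * x) = a * apolar x"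
  unfolding apolar_def lookup_const_mult sum_distrib_left by (simp only: mult_ac)

lemma apolar_0: "apolar 0 = 0"
  by (simp add: apolar_def)

lemma apolar_sum: "apolar (sum h I) = (\<Sum>i\<in>I. apolar (h i))"
  by (induction I rule: infinite_finite_induct) (auto simp: apolar_add apolar_0)

lemma apolar_single: "apolar (Poly_Mapping.single \<mu> c) = mfact \<mu> * Poly_Mapping.lookup f \<mu> * c"
proof -
  have "apolar (Poly_Mapping.single \<mu> c) =
      (\<Sum>\<nu>\<in>Poly_Mapping.keys f. if \<nu> = \<mu> then mfact \<mu> * Poly_Mapping.lookup f \<mu> * c else 0)"
    unfolding apolar_def by (intro sum.cong) (auto simp: lookup_single when_def)
  thus ?thesis by (auto simp: in_keys_iff)
qed

lemma apolar_ord_ge: "x \<in> ord_ge (Suc d) \<Longrightarrow> apolar x = 0"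
proof -
  assume x: "x \<in> ord_ge (Suc d)"
  have "Poly_Mapping.lookup x \<mu> = 0" if "\<mu> \<in> Poly_Mapping.keys f" for \<mu>
  proof -
    have "\<mu> \<notin> Poly_Mapping.keys x" using x mdeg_f[OF that] by (auto simp: ord_ge_def)
    thus ?thesis by (simp add: in_keys_iff)
  qed
  thus ?thesis unfolding apolar_def by (intro sum.neutral) simp
qed

lemma socle_elt: "socle_elt \<in> ord_ge d" "apolar socle_elt = 1"
proof -
  define \<mu> where "\<mu> = (SOME \<mu>. \<mu> \<in> Poly_Mapping.keys f)"
  have \<mu>: "\<mu> \<in> Poly_Mapping.keys f"
    unfolding \<mu>_def some_in_eq using f_nonzero by simp
  have s: "socle_elt = Poly_Mapping.single \<mu> (1 / (mfact \<mu> * Poly_Mapping.lookup f \<mu>))"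
    by (simp add: socle_elt_def \<mu>_def Let_def)
  show "socle_elt \<in> ord_ge d" using mdeg_f[OF \<mu>] by (simp add: s ord_ge_def)
  show "apolar socle_elt = 1" using \<mu> by (simp add: s apolar_single mfact_nonzero in_keys_iff)
qed

lemma minus_const_in_ord_ge: "x - Poly_Mapping.single 0 (Poly_Mapping.lookup x 0) \<in> ord_ge 1"
proof -
  have "mdeg \<mu> \<noteq> 0" if "\<mu> \<in> Poly_Mapping.keys (x - Poly_Mapping.single 0 (Poly_Mapping.lookup x 0))" for \<mu>
    using that by (auto simp: mdeg_eq_0_iff in_keys_iff lookup_minus)
  thus ?thesis by (fastforce simp: ord_ge_def)
qed

lemma apolar_socle_elt_mult: "apolar (socle_elt * x) = Poly_Mapping.lookup x 0"
proof -
  let ?c = "Poly_Mapping.single 0 (Poly_Mapping.lookup x 0)"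
  have "socle_elt * x = ?c * socle_elt + socle_elt * (x - ?c)" by (simp add: algebra_simps)
  moreover have "apolar (socle_elt * (x - ?c)) = 0"
    using ord_ge_mult[OF socle_elt(1) minus_const_in_ord_ge, of x] by (intro apolar_ord_ge) simp
  ultimately show ?thesis by (simp add: apolar_add apolar_scale socle_elt(2))
qed

sublocale gorenstein_functional "Poly_Mapping.single 0" apolar ord_ge d socle_elt
proof
  fix x y :: "'a mpoly" and a b :: 'a and i j :: nat
  show "Poly_Mapping.single 0 1 = (1 :: 'a mpoly)" by simp
  show "(Poly_Mapping.single 0 (a + b) :: 'a mpoly) = Poly_Mapping.single 0 a + Poly_Mapping.single 0 b"
    by (rule single_add)
  show "(Poly_Mapping.single 0 (a * b) :: 'a mpoly) = Poly_Mapping.single 0 a * Poly_Mapping.single 0 b"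
    by (simp add: mult_single)
  show "apolar (x + y) = apolar x + apolar y" by (rule apolar_add)
  show "apolar (Poly_Mapping.single 0 a * x) = a * apolar x" by (rule apolar_scale)
  show "x \<in> ord_ge 0" by (simp add: ord_ge_def)
  show "x \<in> ord_ge (Suc i) \<Longrightarrow> x \<in> ord_ge i" by (auto simp: ord_ge_def dest: Suc_leD)
  show "x \<in> ord_ge i \<Longrightarrow> y \<in> ord_ge i \<Longrightarrow> x + y \<in> ord_ge i"
    using Poly_Mapping.keys_add[of x y] by (auto simp: ord_ge_def)
  show "x \<in> ord_ge i \<Longrightarrow> y \<in> ord_ge j \<Longrightarrow> x * y \<in> ord_ge (i + j)" by (rule ord_ge_mult)
  show "x \<in> ord_ge (Suc d) \<Longrightarrow> apolar x = 0" by (rule apolar_ord_ge)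
  show "2 \<le> d" by (rule d_ge)
  show "socle_elt \<in> ord_ge d" "apolar socle_elt = 1" by (rule socle_elt)+
  show "x - Poly_Mapping.single 0 (apolar (socle_elt * x)) \<in> ord_ge 1"
    unfolding apolar_socle_elt_mult by (rule minus_const_in_ord_ge)
qed

text \<open>The polynomial ring has infinite dimension, even infinitely many variables, but the
  pairing sees only the finitely many pairs of exponents whose sum occurs in \<open>f\<close>. This
  bounds the length of dual bases.\<close>

lemma apolar_form_rank:
  "apolar (x * y) = (\<Sum>(\<alpha>, \<beta>)\<in>{(\<alpha>, \<beta>). \<alpha> + \<beta> \<in> Poly_Mapping.keys f}.
     Poly_Mapping.lookup x \<alpha> * (mfact (\<alpha> + \<beta>) * Poly_Mapping.lookup f (\<alpha> + \<beta>) * Poly_Mapping.lookup y \<beta>))"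
    (is "_ = sum ?h ?P")
  and finite_apolar_form_rank: "finite {(\<alpha>, \<beta>). \<alpha> + \<beta> \<in> Poly_Mapping.keys f}"
proof -
  let ?D = "\<lambda>\<nu> :: nat \<Rightarrow>\<^sub>0 nat. {\<alpha>. \<forall>i. Poly_Mapping.lookup \<alpha> i \<le> Poly_Mapping.lookup \<nu> i}"
  have "?P \<subseteq> (\<Union>\<nu>\<in>Poly_Mapping.keys f. ?D \<nu> \<times> ?D \<nu>)"
    by (auto intro!: bexI simp: lookup_add)
  moreover have "finite (\<Union>\<nu>\<in>Poly_Mapping.keys f. ?D \<nu> \<times> ?D \<nu>)"
    by (intro finite_UN_I finite_cartesian_product finite_bounded_exponents) simp
  ultimately show fin: "finite ?P" by (rule finite_subset)
  have "apolar (x * y) = sum ?h (Poly_Mapping.keys x \<times> Poly_Mapping.keys y)"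
    unfolding mpoly_mult_expand[of x y] apolar_sum apolar_single
    by (simp add: sum.cartesian_product mult_ac)
  also have "\<dots> = sum ?h (?P \<union> Poly_Mapping.keys x \<times> Poly_Mapping.keys y)"
    by (rule sum.mono_neutral_left) (use fin in \<open>auto simp: in_keys_iff\<close>)
  also have "\<dots> = sum ?h ?P"
    by (rule sum.mono_neutral_right) (use fin in \<open>auto simp: in_keys_iff\<close>)
  finally show "apolar (x * y) = sum ?h ?P" .
qed

section \<open>Linear parts and the recovery of the form from d-th powers\<close>

definition lin_part :: "'a mpoly \<Rightarrow> 'a vec" where
  "lin_part z = vec k (\<lambda>i. Poly_Mapping.lookup z (Poly_Mapping.single i 1))"

text \<open>In degree \<open>d\<close>, only the linear part of \<open>z\<close> contributes to
  \<open>z ^ d\<close>; the weights \<open>mfact\<close> cancel the denominators of the multinomial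
  coefficients.\<close>

lemma apolar_power: "z \<in> ord_ge 1 \<Longrightarrow> apolar (z ^ d) = fact d * peval f (lin_part z)"
proof -
  assume z: "z \<in> ord_ge 1"
  have "mfact \<mu> * Poly_Mapping.lookup f \<mu> * Poly_Mapping.lookup (z ^ d) \<mu> =
      fact d * (Poly_Mapping.lookup f \<mu> * mon_eval \<mu> (lin_part z))" if "\<mu> \<in> Poly_Mapping.keys f" for \<mu>
  proof -
    have "(\<Prod>i\<in>Poly_Mapping.keys \<mu>. Poly_Mapping.lookup z (Poly_Mapping.single i 1) ^ Poly_Mapping.lookup \<mu> i) =
        mon_eval \<mu> (lin_part z)"
      unfolding mon_eval_def by (intro prod.cong refl) (use keys_f[OF that] in \<open>auto simp: lin_part_def\<close>)
    thus ?thesis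
      using arg_cong[OF lookup_power_ord_ge[OF z mdeg_f[OF that]], of "\<lambda>x. Poly_Mapping.lookup f \<mu> * x"]
      by (simp add: mult_ac)
  qed
  thus ?thesis unfolding apolar_def peval_mon sum_distrib_left by (intro sum.cong refl)
qed

definition lin_form :: "'a vec \<Rightarrow> 'a mpoly" where
  "lin_form a = (\<Sum>i<k. Poly_Mapping.single (Poly_Mapping.single i 1) (a $ i))"

lemma lin_form_in: "lin_form a \<in> ord_ge 1"
  unfolding lin_form_def by (intro F_sum) (simp add: ord_ge_def)

lemma lin_part_lin_form:
  assumes "a \<in> carrier_vec k" shows "lin_part (lin_form a) = a"
proof (rule eq_vecI)
  fix j assume "j < dim_vec a"
  hence j: "j < k" using assms by simp
  have "Poly_Mapping.lookup (lin_form a) (Poly_Mapping.single j 1) = (\<Sum>i<k. if i = j then a $ i else 0)"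
    unfolding lin_form_def lookup_sum
    by (intro sum.cong refl) (auto simp: lookup_single when_def single_1_eq_iff simp del: One_nat_def)
  thus "lin_part (lin_form a) $ j = a $ j" using j by (simp add: lin_part_def)
qed (use assms in \<open>simp add: lin_part_def\<close>)

lemma lin_part_add: "lin_part (x + y) = lin_part x + lin_part y"
  by (intro eq_vecI) (auto simp: lin_part_def lookup_add)

lemma lin_part_scale: "lin_part (Poly_Mapping.single 0 c * x) = c \<cdot>\<^sub>v lin_part x"
  by (intro eq_vecI) (auto simp: lin_part_def lookup_const_mult)

text \<open>Here non-degeneracy of \<open>f\<close> enters: a linear form annihilating \<open>f\<close> is a direction of
  translation invariance.\<close>

lemma lin_part_eqv_0:
  assumes "z \<in> ord_ge 1" "eqv z 0"
  shows "lin_part z = 0\<^sub>v k"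
proof (rule f_nondegenerate)
  show "lin_part z \<in> carrier_vec k" by (simp add: lin_part_def)
  fix w :: "'a vec" and r assume w: "w \<in> carrier_vec k"
  let ?z = "lin_form w + Poly_Mapping.single 0 r * z"
  have "eqv ?z (lin_form w + Poly_Mapping.single 0 r * 0)"
    by (intro eqv_add eqv_mult eqv_refl assms)
  hence "eqv (?z ^ d) (lin_form w ^ d)" by (intro eqv_power) simp
  hence "apolar (?z ^ d) = apolar (lin_form w ^ d)" by (rule eqv_\<pi>)
  moreover have "?z \<in> ord_ge 1" by (intro F_add lin_form_in F_mult_left assms)
  ultimately show "peval f (w + r \<cdot>\<^sub>v lin_part z) = peval f w"
    using apolar_power[of ?z] apolar_power[OF lin_form_in[of w]] w
    by (simp add: lin_part_add lin_part_scale lin_part_lin_form)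
qed

lemma lin_part_eqv:
  assumes "x \<in> ord_ge 1" "y \<in> ord_ge 1" "eqv x y"
  shows "lin_part x = lin_part y"
proof -
  have "lin_part (x - y) = 0\<^sub>v k"
    by (intro lin_part_eqv_0 F_diff assms) (simp add: eqv_0_iff assms)
  moreover have "lin_part x = lin_part (x - y) + lin_part y"
    unfolding lin_part_add[symmetric] by simp
  ultimately show ?thesis by (simp add: lin_part_def)
qed

text \<open>The pair \<open>1, e\<close> is dual to \<open>e, 1\<close> because
  \<open>\<pi> 1 = 0\<close> and \<open>\<pi> (e * e) = 0\<close>. Starting from it, a maximal
  biorthogonal system expands the whole pairing.\<close>

lemma ex_basis: "\<exists>s \<tau> m. gorenstein_basis (Poly_Mapping.single 0) apolar ord_ge d socle_elt s \<tau> m"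
proof -
  let ?\<beta> = "\<lambda>x y. apolar (x * y)"
  have "eps 1 = 1" "eps socle_elt = 0" "apolar 1 = 0"
  proof -
    show "eps 1 = 1" by simp
    show "eps socle_elt = 0" by (rule eps_F[OF e_in_1])
    have "\<mu> \<noteq> 0" if "\<mu> \<in> Poly_Mapping.keys f" for \<mu>
      using mdeg_f[OF that] d_ge by (auto simp: mdeg_def)
    thus "apolar 1 = 0" unfolding apolar_def by (intro sum.neutral) (auto simp: lookup_one when_def)
  qed
  hence init: "biorthogonal ?\<beta> 2 (\<lambda>i. if i = 0 then 1 else socle_elt) (\<lambda>i. if i = 0 then socle_elt else 1)"
    using socle_elt(2) by (auto simp: biorthogonal_def eps_def)
  have left: "\<exists>x''. \<forall>y. ?\<beta> x'' y = ?\<beta> x y - c * ?\<beta> x' y" for x x' c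
    by (rule exI[of _ "x - Poly_Mapping.single 0 c * x'"])
       (simp add: left_diff_distrib \<pi>_diff mult.assoc apolar_scale)
  have right: "\<exists>y''. \<forall>x. ?\<beta> x y'' = ?\<beta> x y - c * ?\<beta> x y'" for y y' c
    by (rule exI[of _ "y - Poly_Mapping.single 0 c * y'"])
       (simp add: right_diff_distrib \<pi>_diff mult.left_commute[of _ "Poly_Mapping.single 0 c"] apolar_scale)
  have rank: "?\<beta> x y = (\<Sum>p\<in>{(\<alpha>, \<beta>). \<alpha> + \<beta> \<in> Poly_Mapping.keys f}.
      Poly_Mapping.lookup x (fst p) * (mfact (fst p + snd p) * Poly_Mapping.lookup f (fst p + snd p) *
        Poly_Mapping.lookup y (snd p)))" for x y
    unfolding apolar_form_rank by (simp add: case_prod_beta)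
  obtain N s t where N: "2 \<le> N" "biorthogonal ?\<beta> N s t"
    "\<And>i. i < 2 \<Longrightarrow> s i = (if i = 0 then 1 else socle_elt)"
    "\<And>i. i < 2 \<Longrightarrow> t i = (if i = 0 then socle_elt else 1)"
    "\<And>x y. ?\<beta> x y = (\<Sum>i<N. ?\<beta> x (t i) * ?\<beta> (s i) y)"
    by (rule biorthogonal_extend[where \<beta> = ?\<beta>, OF init finite_apolar_form_rank rank left right], rule that)
  obtain m where m: "N = Suc (Suc m)" using N(1) by (metis add_2_eq_Suc le_Suc_ex)
  \<comment> \<open>The d-th powers of linear forms take all values of \<open>f\<close> up to the
    factor \<open>d!\<close>, and \<open>f\<close> is nonzero as a function.\<close>
  have top: "\<exists>y. eps y = 0 \<and> apolar (y ^ d) \<noteq> 0"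
  proof (rule ccontr)
    assume "\<nexists>y. eps y = 0 \<and> apolar (y ^ d) \<noteq> 0"
    hence "peval f v = 0" if "v \<in> carrier_vec k" for v
      using apolar_power[OF lin_form_in[of v]] eps_F[OF lin_form_in[of v]] lin_part_lin_form[OF that] by auto
    moreover have "vars f \<subseteq> {..<k}" using f_form by (simp add: part_forms_def)
    ultimately show False using peval_eq_0_imp_eq_0 f_nonzero by blast
  qed
  have "gorenstein_basis (Poly_Mapping.single 0) apolar ord_ge d socle_elt s t m"
  proof (unfold_locales)
    show "biorthogonal ?\<beta> (Suc (Suc m)) s t" using N(2) unfolding m .
    show "?\<beta> x y = (\<Sum>i<Suc (Suc m). ?\<beta> x (t i) * ?\<beta> (s i) y)" for x y
      using N(5)[of x y] unfolding m .
    show "s 0 = 1" "s (Suc 0) = socle_elt" "t 0 = socle_elt" "t (Suc 0) = 1"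
      using N(3)[of 0] N(3)[of 1] N(4)[of 0] N(4)[of 1] by simp_all
    show "\<exists>y. eps y = 0 \<and> apolar (y ^ d) \<noteq> 0" by (rule top)
  qed
  thus ?thesis by blast
qed

text \<open>In boundary coordinates, taking the linear part is a surjective linear map onto the
  space of \<open>f\<close>. Completing its matrix to an invertible \<open>A\<close> makes the
  boundary equation a substitution instance of \<open>f\<close>, hence a cone.\<close>

lemma ex_hypersurface:
  "\<exists>m X \<phi> U A. k \<le> Suc m \<and> A \<in> GL (Suc m) \<and> nondegenerate_hypersurface (Suc m) X \<and>
     induced_additive_action (Suc m) X \<phi> \<and> open_orbit m (Suc m) X \<phi> U \<and>
     U = X - hyperplane0 (Suc m) \<and> X \<inter> hyperplane0 (Suc m) = hyperplane0_emb ` zero_locus m (lin_subst A f)"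
proof -
  obtain s \<tau> m where "gorenstein_basis (Poly_Mapping.single 0) apolar ord_ge d socle_elt s \<tau> m"
    using ex_basis by blast
  then interpret basis: gorenstein_basis "Poly_Mapping.single 0" apolar ord_ge d socle_elt s \<tau> m .
  let ?n = "Suc m"
  \<comment> \<open>\<open>row\<close> is the matrix of the linear part, \<open>col\<close> lists
    the coordinates of the variables; biorthogonality says that the second is a right inverse of the
    first. Index \<open>Suc i\<close>, since coordinate 0 vanishes on the boundary.\<close>
  define row where "row l i = lin_part (s (Suc i)) $ l" for l i
  define col where "col j i = basis.coords (lin_form (unit_vec k j)) $ Suc i" for j i
  have vars: "vars f \<subseteq> {..<k}" using f_form by (simp add: part_forms_def)
  have comb0: "basis.comb v = (\<Sum>i<?n. Poly_Mapping.single 0 (v $ Suc i) * s (Suc i))" if "v $ 0 = 0" for v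
    unfolding basis.comb_def by (subst sum.lessThan_Suc_shift) (simp add: that)
  have in1: "basis.comb v \<in> ord_ge 1" if "v $ 0 = 0" for v
    using basis.eps_comb[of v] that by (simp add: in_F1_iff)
  have lin_part_sum: "lin_part (sum h I) $ l = (\<Sum>i\<in>I. lin_part (h i) $ l)" if "l < k" for h and I :: "nat set" and l
    using that by (simp add: lin_part_def lookup_sum)
  have lp: "lin_part (basis.comb v) $ l = (\<Sum>i<?n. row l i * v $ Suc i)" if "v $ 0 = 0" "l < k" for v l
    unfolding comb0[OF that(1)] lin_part_sum[OF that(2)]
    by (intro sum.cong refl, unfold lin_part_scale) (use that in \<open>simp add: row_def lin_part_def\<close>)
  have "biorthogonal (\<lambda>x y. \<Sum>i<?n. x i * y i) k row col"
    unfolding biorthogonal_def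
  proof (intro allI impI)
    fix l j assume lj: "l < k" "j < k"
    let ?v = "basis.coords (lin_form (unit_vec k j))"
    have v0: "?v $ 0 = 0" by (simp only: basis.coords_0 eps_F[OF lin_form_in])
    have "lin_part (basis.comb ?v) = lin_part (lin_form (unit_vec k j))"
      by (intro lin_part_eqv in1[OF v0] lin_form_in basis.comb_coords)
    hence "lin_part (basis.comb ?v) = unit_vec k j" by (simp only: lin_part_lin_form unit_vec_carrier)
    thus "(\<Sum>i<?n. row l i * col j i) = (if l = j then 1 else 0)"
      using lp[OF v0 lj(1)] lj by (simp only: col_def index_unit_vec)
  qed
  then obtain A B where A: "k \<le> ?n" "A \<in> GL ?n" "\<And>l i. l < k \<Longrightarrow> i < ?n \<Longrightarrow> A $$ (l, i) = row l i"
    by (rule biorthogonal_extend_GL) (rule that)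
  have carr: "A \<in> carrier_mat ?n ?n" using A(2) by (simp add: GL_def)
  \<comment> \<open>Only the first \<open>k\<close> rows of \<open>A\<close> enter, as
    \<open>f\<close> has no further variables.\<close>
  have eq: "apolar (basis.comb (vCons 0 y) ^ d) = fact d * peval (lin_subst A f) y" if y: "y \<in> carrier_vec ?n" for y
  proof -
    have "lin_part (basis.comb (vCons 0 y)) $ l = (A *\<^sub>v y) $ l" if l: "l < k" for l
    proof -
      have "(A *\<^sub>v y) $ l = (\<Sum>i<?n. row l i * y $ i)"
        using carr y l A(1,3) by (auto simp: scalar_prod_def atLeast0LessThan intro!: sum.cong)
      thus ?thesis using lp[OF _ l, of "vCons 0 y"] by simp
    qed
    hence "peval f (lin_part (basis.comb (vCons 0 y))) = peval f (A *\<^sub>v y)"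
      by (intro peval_cong[OF vars])
    also have "\<dots> = peval (lin_subst A f) y"
      using vars A(1) carr y by (subst peval_lin_subst) auto
    finally show ?thesis using apolar_power[OF in1[of "vCons 0 y"]] by simp
  qed
  have iff: "proj_pt (vCons 0 y) \<in> basis.X \<longleftrightarrow> peval (lin_subst A f) y = 0"
    if "y \<in> carrier_vec ?n" "y \<noteq> 0\<^sub>v ?n" for y
    using basis.boundary_X[OF that] eq[OF that(1)] by simp
  have "basis.X \<inter> hyperplane0 ?n = hyperplane0_emb ` zero_locus m (lin_subst A f)"
  proof (intro equalityI subsetI)
    fix p assume p: "p \<in> basis.X \<inter> hyperplane0 ?n"
    obtain x where x: "x \<in> carrier_vec (Suc ?n)" "x \<noteq> 0\<^sub>v (Suc ?n)" "p = proj_pt x"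
      using p basis.X_cases by blast
    have x0: "x $ 0 = 0" using p x proj_pt_in_hyperplane0_iff[OF x(1,2)] by simp
    define y where "y = vec ?n (\<lambda>i. x $ Suc i)"
    have xy: "x = vCons 0 y"
    proof (rule eq_vecI)
      fix i assume "i < dim_vec (vCons 0 y)"
      thus "x $ i = vCons 0 y $ i" using x0 by (cases i) (auto simp: y_def)
    qed (use x(1) in \<open>simp add: y_def\<close>)
    have y: "y \<in> carrier_vec ?n" by (simp add: y_def)
    have y0: "y \<noteq> 0\<^sub>v ?n"
    proof
      assume "y = 0\<^sub>v ?n"
      hence "x = 0\<^sub>v (Suc ?n)" by (simp add: xy zero_vec_Suc)
      thus False using x(2) by simp
    qed
    have "proj_pt y \<in> zero_locus m (lin_subst A f)"
      unfolding zero_locus_def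
    proof (intro CollectI conjI ballI proj_pt_in_proj_space y y0)
      fix y' assume "y' \<in> proj_pt y"
      then obtain c where c: "c \<noteq> 0" "y' = c \<cdot>\<^sub>v y" by (auto simp: proj_pt_def)
      have y': "y' \<in> carrier_vec ?n" "y' \<noteq> 0\<^sub>v ?n"
        using c y smult_vec_nonzero[OF y y0 c(1)] by auto
      have "proj_pt (vCons 0 y') = p"
        using proj_pt_smult[OF c(1), of x] by (simp add: c(2) vCons_smult[symmetric] x(3) xy)
      thus "peval (lin_subst A f) y' = 0" using p iff[OF y'] by simp
    qed
    thus "p \<in> hyperplane0_emb ` zero_locus m (lin_subst A f)"
      using x(3) xy hyperplane0_emb_proj_pt by blast
  next
    fix p assume "p \<in> hyperplane0_emb ` zero_locus m (lin_subst A f)"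
    then obtain q where q: "q \<in> zero_locus m (lin_subst A f)" "p = hyperplane0_emb q" by blast
    then obtain y where y: "y \<in> carrier_vec ?n" "y \<noteq> 0\<^sub>v ?n" "q = proj_pt y"
      using zero_locus_subset proj_space_iff by blast
    have "peval (lin_subst A f) y = 0" using q(1) y(3) proj_pt_self by (auto simp: zero_locus_def)
    hence pX: "p \<in> basis.X" using iff[OF y(1,2)] by (simp add: q(2) y(3) hyperplane0_emb_proj_pt)
    have px: "p = proj_pt (vCons 0 y)" by (simp add: q(2) y(3) hyperplane0_emb_proj_pt)
    have p: "p \<in> proj_space ?n" using pX basis.X_subset by blast
    have "vCons 0 y \<in> p" unfolding px by (rule proj_pt_self)
    hence "vCons 0 y \<in> carrier_vec (Suc ?n)" "vCons 0 y \<noteq> 0\<^sub>v (Suc ?n)"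
      by (rule proj_space_memD[OF p])+
    thus "p \<in> basis.X \<inter> hyperplane0 ?n" using pX px by (simp add: proj_pt_in_hyperplane0_iff)
  qed
  thus ?thesis
    using A(1,2) basis.nondegenerate_X basis.induced_additive_action_X basis.open_orbit_U basis.U_eq by blast
qed

end

text \<open>Squaring does not change the zero locus and makes the degree at least two, which the
  construction requires.\<close>

lemma inverse_system_square:
  fixes f :: "'a::field_char_0 mpoly"
  assumes "f \<in> forms k d" "d > 0" "f \<noteq> 0"
    and nondeg: "\<And>A. A \<in> GL k \<Longrightarrow> \<not> card (vars (lin_subst A f)) < k"
  shows "inverse_system (f * f) k (d + d)"
proof
  show "f * f \<in> forms k (d + d)" by (intro part_forms_mult assms)
  show "2 \<le> d + d" using assms(2) by simp
  show "f * f \<noteq> 0" using assms(3) by simp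
  have vars: "vars f \<subseteq> {..<k}" using assms(1) by (simp add: part_forms_def)
  fix v :: "'a vec" assume v: "v \<in> carrier_vec k"
    and inv: "\<And>w r. w \<in> carrier_vec k \<Longrightarrow> peval (f * f) (w + r \<cdot>\<^sub>v v) = peval (f * f) w"
  show "v = 0\<^sub>v k"
  proof (rule nondegenerate_formD[OF vars nondeg v])
    fix w :: "'a vec" and r assume w: "w \<in> carrier_vec k"
    \<comment> \<open>If the square of \<open>f\<close> is constant along a line, so is the square
      of the restriction \<open>p\<close>; then \<open>p\<close> has degree 0, and \<open>f\<close>
      is constant there too.\<close>
    obtain p where p: "\<And>r. poly p r = peval f (w + r \<cdot>\<^sub>v v)"
      using poly_fun_line[OF peval_poly_fun[OF vars] w v] by blast
    have "poly (p * p - [:peval (f * f) w:]) r = 0" for r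
      using inv[OF w, of r] by (simp add: p)
    hence "p * p - [:peval (f * f) w:] = 0" by (rule poly_eq_0_if_all_roots)
    hence "degree (p * p) = 0" by simp
    hence "degree p = 0" by (cases "p = 0") (simp_all add: degree_mult_eq)
    then obtain c where "p = [:c:]" by (rule degree_eq_zeroE)
    moreover have "w + 0 \<cdot>\<^sub>v v = w" using v w by auto
    ultimately show "peval f (w + r \<cdot>\<^sub>v v) = peval f w" using p[of r] p[of 0] by simp
  qed
qed

theorem theorem3:
  fixes Z\<^sub>0 :: "'a::{alg_closed_field, field_char_0} vec set set" and k :: nat
  assumes "k \<ge> 1" and "nondegenerate_hypersurface (k - 1) Z\<^sub>0"
  shows "\<exists>(n::nat) (X :: 'a vec set set) \<phi> U X\<^sub>0 Y.
           n \<ge> 1 \<and> nondegenerate_hypersurface n X \<and> induced_additive_action n X \<phi> \<and>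
           open_orbit (n - 1) n X \<phi> U \<and>
           X\<^sub>0 = X - U \<and> X\<^sub>0 = X \<inter> hyperplane0 n \<and>
           X\<^sub>0 = hyperplane0_emb ` Y \<and> projective_cone (n - 1) Y (k - 1) Z\<^sub>0"
proof -
  have k: "Suc (k - 1) = k" using assms(1) by simp
  obtain f d where f: "f \<in> forms k d" "d > 0" "f \<noteq> 0" "Z\<^sub>0 = zero_locus (k - 1) f"
    and nondeg: "\<And>A. A \<in> GL k \<Longrightarrow> \<not> card (vars (lin_subst A f)) < k"
    using assms(2) unfolding nondegenerate_hypersurface_def hypersurface_eq_def k by blast
  interpret inverse_system "f * f" k "d + d"
    by (rule inverse_system_square[OF f(1-3) nondeg])
  obtain m X \<phi> U A where X: "k \<le> Suc m" "A \<in> GL (Suc m)" "nondegenerate_hypersurface (Suc m) X"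
     "induced_additive_action (Suc m) X \<phi>" "open_orbit m (Suc m) X \<phi> U"
     "U = X - hyperplane0 (Suc m)"
     "X \<inter> hyperplane0 (Suc m) = hyperplane0_emb ` zero_locus m (lin_subst A (f * f))"
    using ex_hypersurface by (elim exE conjE) (rule that)
  \<comment> \<open>\<open>f * f\<close> already defines \<open>Z\<^sub>0\<close> in the given
    coordinates, so the identity serves on the smaller space and only \<open>A\<close> changes
    coordinates.\<close>
  have one: "1\<^sub>m k \<in> GL k" by (auto simp: GL_def invertible_mat_def inverts_mat_def intro: exI[of _ "1\<^sub>m k"])
  have "Z\<^sub>0 = zero_locus (k - 1) (lin_subst (1\<^sub>m k) (f * f))"
    unfolding f(4) zero_locus_def
  proof (intro Collect_cong conj_cong refl ball_cong)
    fix p and x :: "'a vec" assume "p \<in> proj_space (k - 1)" "x \<in> p"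
    hence "x \<in> carrier_vec k" using proj_space_memD(1)[of p "k - 1" x] k by simp
    moreover have "vars (f * f) \<subseteq> {..<k}" using f_form by (simp add: part_forms_def)
    ultimately show "(peval f x = 0) = (peval (lin_subst (1\<^sub>m k) (f * f)) x = 0)"
      by (simp add: peval_lin_subst)
  qed
  hence "projective_cone m (zero_locus m (lin_subst A (f * f))) (k - 1) Z\<^sub>0"
    unfolding projective_cone_def k using X(1,2) one f_form d_ge f_nonzero
    by (intro conjI exI[of _ "f * f"] exI[of _ "d + d"] bexI[of _ A] bexI[of _ "1\<^sub>m k"]) auto
  thus ?thesis
    using X(3-7)
    by (intro exI[of _ "Suc m"] exI[of _ X] exI[of _ \<phi>] exI[of _ U] exI[of _ "X \<inter> hyperplane0 (Suc m)"]
        exI[of _ "zero_locus m (lin_subst A (f * f))"]) auto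
qed

end
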